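(* For every regular Schur labeled skew shape poset $P\in\mathsf{RSP}_n$, the $H_n(0)$-module $\mathsf M_P$ has a distinguished filtration with respect to $\mathcal S=\{s_\lambda\mid\lambda\vdash n\}$, the set of Schur functions of degree $n$.
   Context: $\mathfrak S_n$ is the symmetric group on $[n]=\{1,\dots,n\}$ with length function $\ell$ and simple transpositions $s_i=(i,i+1)$; $\mathrm{Des}_L(\sigma)=\{i\in[n-1]\mid\ell(s_i\sigma)<\ell(\sigma)\}$. The $0$-Hecke algebra $H_n(0)$ is the unital associative $\mathbb C$-algebra generated by $\pi_1,\dots,\pi_{n-1}$ with $\pi_i^2=\pi_i$, $\pi_i\pi_{i+1}\pi_i=\pi_{i+1}\pi_i\pi_{i+1}$, and $\pi_i\pi_j=\pi_j\pi_i$ for $|i-j|\ge2$. For a composition $\alpha=(\alpha_1,\dots,\alpha_k)$ of $n$, $\mathrm{set}(\alpha)=\{\alpha_1,\alpha_1+\alpha_2,\dots,\alpha_1+\cdots+\alpha_{k-1}\}$. The irreducible $H_n(0)$-modules are the one-dimensional modules $\mathbf F_\alpha=\mathbb Cv_\alpha$ ($\alpha$ a composition of $n$) with $\pi_iv_\alpha=0$ if $i\in\mathrm{set}(\alpha)$ and $\pi_iv_\alpha=v_\alpha$ otherwise. The quasisymmetric characteristic $\mathrm{ch}$ is the additive map from the Grothendieck group of finite-dimensional left $H_n(0)$-modules (modulo short exact sequences) to $\mathrm{QSym}$ with $\mathrm{ch}([\mathbf F_\alpha])=F_\alpha$, where $F_\alpha=\sum x_{i_1}\cdots x_{i_n}$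 over $1\le i_1\le\cdots\le i_n$ with $i_j<i_{j+1}$ if $j\in\mathrm{set}(\alpha)$ is the fundamental quasisymmetric function. Let $\mathcal B=\{\mathcal B_\alpha\mid\alpha\in I\}$ be a linearly independent set of degree-$n$ quasisymmetric functions, each a nonnegative combination of the $F_\alpha$. A distinguished filtration of a finite-dimensional $H_n(0)$-module $M$ with respect to $\mathcal B$ is a series of submodules $0=M_0\subset M_1\subset\cdots\subset M_l=M$ such that for every $1\le k\le l$, $\mathrm{ch}([M_k/M_{k-1}])=\mathcal B_\alpha$ for some $\alpha\in I$. A skew partition $\lambda/\mu$ is a pair of partitions with $\mu_i\le\lambda_i$ for all $i$ (missing parts are $0$); its Young diagram is the set of boxes $(i,j)$ (row $i$ counted from the top, column $j$ from the left) with $\mu_i<j\le\lambda_i$; its size is $|\lambda|-|\mu|$. Every skew partition is assumed basic: its Young diagram has no empty rows and no empty columns. A Schur labeling of shape $\lambda/\mu$ (of size $n$) is a filling of the Young diagram in which each element of $[n]$ appears exactly once, with rows decreasing from left to right and columns increasing from top to bottom. For such $\tau$, $\mathsf{poset}(\tau)$ is the poset on $[n]$ with $i\preceq_\tau j$ iff the box of $i$ is weakly above and weakly left of the box of $j$ in $\tau$. $\mathsf{SP}_n$ (Schur labeled skew shape posets) is the set of all $\mathsf{poset}(\tau)$ with $\tau$ a Schur labeling of some skew shape of size $n$. A poset $P$ on $[n]$ is regular if for all $x,y,z\in[n]$ with $x\preceq_P z$ and ($x<y<z$ or $z<y<x$), one has $x\preceq_P y$ or $y\preceq_P z$. $\mathsf{RSP}_n$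 is the set of regular posets in $\mathsf{SP}_n$. For a poset $P$ on $[n]$, $\Sigma_L(P)=\{\sigma\in\mathfrak S_n\mid \sigma(i)\le\sigma(j)\text{ for all } i\preceq_P j\}$, and $\mathsf M_P$ is the left $H_n(0)$-module with underlying space $\mathbb C\Sigma_L(P)$ and action $\pi_i\cdot\gamma=\gamma$ if $i\in\mathrm{Des}_L(\gamma)$; $\pi_i\cdot\gamma=0$ if $i\notin\mathrm{Des}_L(\gamma)$ and $s_i\gamma\notin\Sigma_L(P)$; $\pi_i\cdot\gamma=s_i\gamma$ if $i\notin\mathrm{Des}_L(\gamma)$ and $s_i\gamma\in\Sigma_L(P)$. *)

theory Defs
  imports
    Complex_Main
    "HOL-Library.Multiset"
    "HOL-Library.FuncSet"
    "HOL-Combinatorics.Permutations"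
    "HOL-Algebra.Module"
    "HOL-Algebra.Generated_Groups"
    "HOL-Algebra.Free_Abelian_Groups"
    "HOL-Algebra.Algebraic_Closure_Type"
begin

section \<open>The symmetric group on \<open>{1..n}\<close>\<close>

abbreviation simple_transp :: "nat \<Rightarrow> nat \<Rightarrow> nat" where
  "simple_transp i \<equiv> Transposition.transpose i (Suc i)"

definition perm_word :: "nat list \<Rightarrow> nat \<Rightarrow> nat" where
  "perm_word w = foldr (\<lambda>i \<sigma>. simple_transp i \<circ> \<sigma>) w id"

definition perm_length :: "nat \<Rightarrow> (nat \<Rightarrow> nat) \<Rightarrow> nat" where
  "perm_length n \<sigma> = (LEAST k. \<exists>w. length w = k \<and> set w \<subseteq> {1..<n} \<and> perm_word w = \<sigma>)"

definition Des_L :: "nat \<Rightarrow> (nat \<Rightarrow> nat) \<Rightarrow> nat set" where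
  "Des_L n \<sigma> = {i \<in> {1..<n}. perm_length n (simple_transp i \<circ> \<sigma>) < perm_length n \<sigma>}"


section \<open>Compositions, partitions and quasisymmetric functions\<close>

definition composition_of :: "nat \<Rightarrow> nat list \<Rightarrow> bool" where
  "composition_of n \<alpha> \<longleftrightarrow> 0 \<notin> set \<alpha> \<and> sum_list \<alpha> = n"

definition comp_set :: "nat list \<Rightarrow> nat set" where
  "comp_set \<alpha> = {sum_list (take k \<alpha>) | k. 1 \<le> k \<and> k < length \<alpha>}"

definition is_partition :: "nat list \<Rightarrow> bool" where
  "is_partition lam \<longleftrightarrow> sorted_wrt (\<ge>) lam \<and> 0 \<notin> set lam"

definition part :: "nat list \<Rightarrow> nat \<Rightarrow> nat" where
  "part lam i = (if 1 \<le> i \<and> i \<le> length lam then lam ! (i - 1) else 0)"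

definition diagram :: "nat list \<Rightarrow> nat list \<Rightarrow> (nat \<times> nat) set" where
  "diagram lam \<mu> = {(i, j). 1 \<le> i \<and> part \<mu> i < j \<and> j \<le> part lam i}"

text \<open>
  A formal power series with integer coefficients in the variables \<open>x\<^sub>1, x\<^sub>2, \<dots>\<close> is represented
  by its coefficient function; the multiset \<open>{#i\<^sub>1, \<dots>, i\<^sub>d#}\<close> stands for the monomial
  \<open>x\<close>\<open>\<^bsub>i\<^sub>1\<^esub>\<close>\<open>\<cdots>x\<close>\<open>\<^bsub>i\<^sub>d\<^esub>\<close>. There is no variable with index 0.
\<close>

type_synonym series = "nat multiset \<Rightarrow> int"

definition quasisymmetric :: "series \<Rightarrow> bool" where
  "quasisymmetric f \<longleftrightarrow>
     (\<forall>m. 0 \<in># m \<longrightarrow> f m = 0) \<and>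
     (\<exists>d. \<forall>m. d < size m \<longrightarrow> f m = 0) \<and>
     (\<forall>m h. 0 \<notin># m \<and> strict_mono_on (set_mset m) h \<and> 0 \<notin> h ` set_mset m
        \<longrightarrow> f (image_mset h m) = f m)"

text \<open>The additive group of QSym, written multiplicatively.\<close>

definition QSym :: "series monoid" where
  "QSym = \<lparr>carrier = {f. quasisymmetric f}, monoid.mult = (\<lambda>f g m. f m + g m), one = (\<lambda>m. 0)\<rparr>"

text \<open>The list \<open>w\<close> is the index sequence \<open>i\<^sub>1 \<le> \<dots> \<le> i\<^sub>n\<close>, shifted to list positions \<open>0..<n\<close>.\<close>

definition fundamental :: "nat list \<Rightarrow> series" where
  "fundamental \<alpha> m = int (card {w. length w = sum_list \<alpha> \<and> set w \<subseteq> {1..} \<and> sorted w \<and>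
     (\<forall>j\<in>comp_set \<alpha>. w ! (j - 1) < w ! j) \<and> mset w = m})"

definition ssyt :: "nat list \<Rightarrow> (nat \<times> nat \<Rightarrow> nat) set" where
  "ssyt lam = {T \<in> diagram lam [] \<rightarrow>\<^sub>E {1..}.
     (\<forall>i j j'. (i, j) \<in> diagram lam [] \<and> (i, j') \<in> diagram lam [] \<and> j < j' \<longrightarrow> T (i, j) \<le> T (i, j')) \<and>
     (\<forall>i i' j. (i, j) \<in> diagram lam [] \<and> (i', j) \<in> diagram lam [] \<and> i < i' \<longrightarrow> T (i, j) < T (i', j))}"

definition schur :: "nat list \<Rightarrow> series" where
  "schur lam m = int (card {T \<in> ssyt lam. image_mset T (mset_set (diagram lam [])) = m})"

definition schur_functions :: "nat \<Rightarrow> series set" where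
  "schur_functions n = {schur lam | lam. is_partition lam \<and> sum_list lam = n}"


section \<open>Modules over the 0-Hecke algebra\<close>

text \<open>
  A left \<open>H\<^sub>n(0)\<close>-module is a complex vector space with endomorphisms \<open>\<pi>\<^sub>1, \<dots>, \<pi>\<^bsub>n-1\<^esub>\<close>
  satisfying the defining relations of \<open>H\<^sub>n(0)\<close>; \<open>act M i\<close> is the action of \<open>\<pi>\<^sub>i\<close>.
  The fields \<open>mult\<close> and \<open>one\<close> inherited from the ring record play no role.
\<close>

record 'v hecke_module = "(complex, 'v) module" +
  act :: "nat \<Rightarrow> 'v \<Rightarrow> 'v"

abbreviation complex_ring :: "complex ring" where
  "complex_ring \<equiv> ring_of_type_algebra"

definition is_hecke_module :: "nat \<Rightarrow> 'v hecke_module \<Rightarrow> bool" where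
  "is_hecke_module n M \<longleftrightarrow>
     Module.module complex_ring M \<and>
     (\<forall>i\<in>{1..<n}. act M i \<in> hom (add_monoid M) (add_monoid M) \<and>
        (\<forall>c. \<forall>x\<in>carrier M. act M i (c \<odot>\<^bsub>M\<^esub> x) = c \<odot>\<^bsub>M\<^esub> act M i x)) \<and>
     (\<forall>i\<in>{1..<n}. \<forall>x\<in>carrier M. act M i (act M i x) = act M i x) \<and>
     (\<forall>i. 1 \<le> i \<and> i + 1 < n \<longrightarrow> (\<forall>x\<in>carrier M.
        act M i (act M (i + 1) (act M i x)) = act M (i + 1) (act M i (act M (i + 1) x)))) \<and>
     (\<forall>i\<in>{1..<n}. \<forall>j\<in>{1..<n}. i + 2 \<le> j \<longrightarrow> (\<forall>x\<in>carrier M.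
        act M i (act M j x) = act M j (act M i x)))"

definition is_fd_hecke_module :: "nat \<Rightarrow> 'v hecke_module \<Rightarrow> bool" where
  "is_fd_hecke_module n M \<longleftrightarrow> is_hecke_module n M \<and>
     (\<exists>B. finite B \<and> B \<subseteq> carrier M \<and>
        (\<forall>x\<in>carrier M. \<exists>c. x = finsum M (\<lambda>b. c b \<odot>\<^bsub>M\<^esub> b) B))"

definition is_hecke_submodule :: "nat \<Rightarrow> 'v hecke_module \<Rightarrow> 'v set \<Rightarrow> bool" where
  "is_hecke_submodule n M N \<longleftrightarrow> submodule N complex_ring M \<and>
     (\<forall>i\<in>{1..<n}. \<forall>x\<in>N. act M i x \<in> N)"

definition quotient_module :: "'v hecke_module \<Rightarrow> 'v set \<Rightarrow> 'v set hecke_module" where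
  "quotient_module M N = \<lparr>carrier = a_rcosets\<^bsub>M\<^esub> N, monoid.mult = undefined, one = undefined,
     zero = N, add = (\<lambda>U V. U <+>\<^bsub>M\<^esub> V),
     module.smult = (\<lambda>c U. \<Union>x\<in>U. N +>\<^bsub>M\<^esub> (c \<odot>\<^bsub>M\<^esub> x)),
     act = (\<lambda>i U. \<Union>x\<in>U. N +>\<^bsub>M\<^esub> act M i x)\<rparr>"

definition hecke_hom :: "nat \<Rightarrow> 'v hecke_module \<Rightarrow> 'w hecke_module \<Rightarrow> ('v \<Rightarrow> 'w) set" where
  "hecke_hom n M N = {f \<in> hom (add_monoid M) (add_monoid N).
     (\<forall>c. \<forall>x\<in>carrier M. f (c \<odot>\<^bsub>M\<^esub> x) = c \<odot>\<^bsub>N\<^esub> f x) \<and>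
     (\<forall>i\<in>{1..<n}. \<forall>x\<in>carrier M. f (act M i x) = act N i (f x))}"

definition short_exact :: "nat \<Rightarrow> 'v hecke_module \<Rightarrow> 'v hecke_module \<Rightarrow> 'v hecke_module \<Rightarrow> bool" where
  "short_exact n A B C \<longleftrightarrow> (\<exists>f \<in> hecke_hom n A B. \<exists>g \<in> hecke_hom n B C.
     inj_on f (carrier A) \<and> f ` carrier A = a_kernel B C g \<and> g ` carrier B = carrier C)"

text \<open>The module \<open>M\<close> is (a copy of) the irreducible module \<open>\<^bold>F\<^sub>\<alpha>\<close>.\<close>

definition is_irr_module :: "nat \<Rightarrow> nat list \<Rightarrow> 'v hecke_module \<Rightarrow> bool" where
  "is_irr_module n \<alpha> M \<longleftrightarrow> is_hecke_module n M \<and>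
     (\<exists>v\<in>carrier M. v \<noteq> \<zero>\<^bsub>M\<^esub> \<and> carrier M = {c \<odot>\<^bsub>M\<^esub> v | c. True} \<and>
        (\<forall>i\<in>{1..<n}. act M i v = (if i \<in> comp_set \<alpha> then \<zero>\<^bsub>M\<^esub> else v)))"


section \<open>The quasisymmetric characteristic\<close>

text \<open>
  The Grothendieck group is formed from the finite-dimensional modules whose carrier is a set of
  elements of the type \<open>'v\<close>. Such modules are closed, up to isomorphism, under submodules
  and quotients (a quotient is isomorphic to a vector space complement with the transported action).
\<close>

definition ses_relations :: "nat \<Rightarrow> ('v hecke_module \<Rightarrow>\<^sub>0 int) set" where
  "ses_relations n = {frag_of B - frag_of A - frag_of C | A B C.
     is_fd_hecke_module n A \<and> is_fd_hecke_module n B \<and> is_fd_hecke_module n C \<and>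
     short_exact n A B C}"

definition free_module_group :: "nat \<Rightarrow> ('v hecke_module \<Rightarrow>\<^sub>0 int) monoid" where
  "free_module_group n = free_Abelian_group {M. is_fd_hecke_module n M}"

definition grothendieck_group :: "nat \<Rightarrow> ('v hecke_module \<Rightarrow>\<^sub>0 int) set monoid" where
  "grothendieck_group n = free_module_group n Mod generate (free_module_group n) (ses_relations n)"

definition module_class :: "nat \<Rightarrow> 'v hecke_module \<Rightarrow> ('v hecke_module \<Rightarrow>\<^sub>0 int) set" where
  "module_class n M =
     generate (free_module_group n) (ses_relations n) #>\<^bsub>free_module_group n\<^esub> frag_of M"

definition is_qs_characteristic ::
    "nat \<Rightarrow> (('v hecke_module \<Rightarrow>\<^sub>0 int) set \<Rightarrow> series) \<Rightarrow> bool" where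
  "is_qs_characteristic n ch \<longleftrightarrow> ch \<in> hom (grothendieck_group n) QSym \<and>
     (\<forall>\<alpha> M. composition_of n \<alpha> \<and> is_irr_module n \<alpha> M \<longrightarrow> ch (module_class n M) = fundamental \<alpha>)"

text \<open>
  The additive map \<open>ch\<close> exists, and its values on the Grothendieck group are unique because the
  classes of the irreducible modules generate this group; so the choice operator leaves only the
  values outside the carrier unspecified.
\<close>

definition qs_char :: "nat \<Rightarrow> ('v hecke_module \<Rightarrow>\<^sub>0 int) set \<Rightarrow> series" where
  "qs_char n = (SOME ch. is_qs_characteristic n ch)"

definition distinguished_filtration ::
    "nat \<Rightarrow> 'v hecke_module \<Rightarrow> series set \<Rightarrow> nat \<Rightarrow> (nat \<Rightarrow> 'v set) \<Rightarrow> bool" where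
  "distinguished_filtration n M \<B> l Ms \<longleftrightarrow>
     is_fd_hecke_module n M \<and>
     Ms 0 = {\<zero>\<^bsub>M\<^esub>} \<and> Ms l = carrier M \<and>
     (\<forall>k\<le>l. is_hecke_submodule n M (Ms k)) \<and>
     (\<forall>k\<in>{1..l}. Ms (k - 1) \<subset> Ms k \<and>
        qs_char n (module_class n (quotient_module (M\<lparr>carrier := Ms k\<rparr>) (Ms (k - 1)))) \<in> \<B>)"


section \<open>Schur labeled skew shape posets\<close>

definition basic_skew_partition :: "nat list \<Rightarrow> nat list \<Rightarrow> bool" where
  "basic_skew_partition lam \<mu> \<longleftrightarrow> is_partition lam \<and> is_partition \<mu> \<and>
     (\<forall>i\<ge>1. part \<mu> i \<le> part lam i) \<and>
     (\<forall>i\<in>{1..length lam}. \<exists>j. (i, j) \<in> diagram lam \<mu>) \<and>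
     (\<forall>j\<in>{1..part lam 1}. \<exists>i. (i, j) \<in> diagram lam \<mu>)"

definition schur_labeling :: "nat \<Rightarrow> nat list \<Rightarrow> nat list \<Rightarrow> (nat \<times> nat \<Rightarrow> nat) \<Rightarrow> bool" where
  "schur_labeling n lam \<mu> \<tau> \<longleftrightarrow> bij_betw \<tau> (diagram lam \<mu>) {1..n} \<and>
     (\<forall>i j j'. (i, j) \<in> diagram lam \<mu> \<and> (i, j') \<in> diagram lam \<mu> \<and> j < j' \<longrightarrow> \<tau> (i, j) > \<tau> (i, j')) \<and>
     (\<forall>i i' j. (i, j) \<in> diagram lam \<mu> \<and> (i', j) \<in> diagram lam \<mu> \<and> i < i' \<longrightarrow> \<tau> (i, j) < \<tau> (i', j))"

text \<open>A poset \<open>P\<close> on \<open>{1..n}\<close> is given by its order relation: \<open>(x, y) \<in> P\<close> means \<open>x \<preceq>\<^sub>P y\<close>.\<close>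

definition labeling_poset :: "nat list \<Rightarrow> nat list \<Rightarrow> (nat \<times> nat \<Rightarrow> nat) \<Rightarrow> nat rel" where
  "labeling_poset lam \<mu> \<tau> = {(\<tau> (i, j), \<tau> (i', j')) | i j i' j'.
     (i, j) \<in> diagram lam \<mu> \<and> (i', j') \<in> diagram lam \<mu> \<and> i \<le> i' \<and> j \<le> j'}"

definition SP :: "nat \<Rightarrow> nat rel set" where
  "SP n = {labeling_poset lam \<mu> \<tau> | lam \<mu> \<tau>. basic_skew_partition lam \<mu> \<and>
     sum_list lam - sum_list \<mu> = n \<and> schur_labeling n lam \<mu> \<tau>}"

definition regular_poset :: "nat \<Rightarrow> nat rel \<Rightarrow> bool" where
  "regular_poset n P \<longleftrightarrow> partial_order_on {1..n} P \<and>
     (\<forall>x\<in>{1..n}. \<forall>y\<in>{1..n}. \<forall>z\<in>{1..n}. (x, z) \<in> P \<and> (x < y \<and> y < z \<or> z < y \<and> y < x)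
        \<longrightarrow> (x, y) \<in> P \<or> (y, z) \<in> P)"

definition RSP :: "nat \<Rightarrow> nat rel set" where
  "RSP n = {P \<in> SP n. regular_poset n P}"

definition Sigma_L :: "nat \<Rightarrow> nat rel \<Rightarrow> (nat \<Rightarrow> nat) set" where
  "Sigma_L n P = {\<sigma>. \<sigma> permutes {1..n} \<and> (\<forall>(i, j)\<in>P. \<sigma> i \<le> \<sigma> j)}"

text \<open>
  Vectors of \<open>M\<^sub>P\<close> are the functions supported on \<open>\<Sigma>\<^sub>L(P)\<close>; \<open>poset_act n P i \<gamma>\<close> is
  \<open>\<pi>\<^sub>i \<cdot> \<gamma>\<close> for a basis element \<open>\<gamma>\<close>, and the action is extended linearly.
\<close>

definition basis_vec :: "'a \<Rightarrow> 'a \<Rightarrow> complex" where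
  "basis_vec \<gamma> = (\<lambda>\<delta>. if \<delta> = \<gamma> then 1 else 0)"

definition poset_act :: "nat \<Rightarrow> nat rel \<Rightarrow> nat \<Rightarrow> (nat \<Rightarrow> nat) \<Rightarrow> (nat \<Rightarrow> nat) \<Rightarrow> complex" where
  "poset_act n P i \<gamma> =
     (if i \<in> Des_L n \<gamma> then basis_vec \<gamma>
      else if simple_transp i \<circ> \<gamma> \<notin> Sigma_L n P then (\<lambda>\<delta>. 0)
      else basis_vec (simple_transp i \<circ> \<gamma>))"

definition poset_module :: "nat \<Rightarrow> nat rel \<Rightarrow> ((nat \<Rightarrow> nat) \<Rightarrow> complex) hecke_module" where
  "poset_module n P = \<lparr>carrier = {f. \<forall>\<gamma>. \<gamma> \<notin> Sigma_L n P \<longrightarrow> f \<gamma> = 0},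
     monoid.mult = undefined, one = undefined,
     zero = (\<lambda>\<gamma>. 0), add = (\<lambda>f g \<gamma>. f \<gamma> + g \<gamma>), module.smult = (\<lambda>c f \<gamma>. c * f \<gamma>),
     act = (\<lambda>i f \<delta>. \<Sum>\<gamma>\<in>Sigma_L n P. f \<gamma> * poset_act n P i \<gamma> \<delta>)\<rparr>"

end

theory Submission
  imports Defs "Jordan_Normal_Form.Missing_VectorSpace" "HOL-Library.Product_Lexorder"
begin

text \<open>
Read a permutation \<open>\<gamma>\<close> in \<open>\<Sigma>\<^sub>L(P)\<close> as the word of the letters \<open>-\<gamma>\<^sup>-\<^sup>1(1), \<dots>, -\<gamma>\<^sup>-\<^sup>1(n)\<close>. Multiplying
\<open>\<gamma>\<close> by \<open>s\<^sub>i\<close> from the left interchanges the letters in the positions \<open>i\<close> and \<open>i + 1\<close>, and \<open>i\<close> is a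
left descent of \<open>\<gamma>\<close> exactly if the word ascends there. So \<open>\<pi>\<^sub>i\<close> turns descents of words into ascents.
The filtration comes from sorting the words by their Schensted insertion tableaux. Four facts
make this work.

First, for regular \<open>P\<close> the words of \<open>\<Sigma>\<^sub>L(P)\<close> form a union of Knuth classes (\<open>knuth_class_Sigma_L\<close>).
A Knuth relation interchanges two neighbouring letters next to a third one of intermediate size. If it
led out of \<open>\<Sigma>\<^sub>L(P)\<close>, the two letters would be comparable in \<open>P\<close>; they would then occupy adjacent boxes
of the skew diagram, regularity would make the third one comparable to one of them, and the
convexity of the diagram leaves no box for it that agrees with the monotonicity of a Schur labeling.

Second, a Knuth class consists of all words with a fixed insertion tableau \<open>T\<close>, and the
fundamental quasisymmetric functions of the descent sets of these words add up to the Schur function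
of the shape of \<open>T\<close> (\<open>sum_qs_fund_eq_schur\<close>). The recording tableaux, viewed as linear
extensions of the shape, turn this into the standardization of semistandard tableaux.

Third, \<open>\<pi>\<^sub>i\<close> moves basis elements between classes in one direction only. By Greene's theorem
(\<open>greene_key_P_tab\<close>), the number of entries at most \<open>j\<close> in the first \<open>k\<close> rows of the insertion tableau
is the largest size of a set of letters at most \<open>j\<close> in which no decreasing subsequence has more than
\<open>k\<close> letters. Turning descents into ascents can only enlarge these numbers, and they determine the
tableau, so their sum, the weight, grows strictly whenever the class changes (\<open>weight_less\<close>). If
the tableaux are listed by decreasing weight, the classes of the first \<open>k\<close> tableaux therefore span a
submodule for every \<open>k\<close>. These submodules are the filtration, and each quotient has one class as a
basis.

Fourth, each class is convex in the left weak order, and the characteristic of the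
module on such a set is the sum of the fundamental functions of its elements
(\<open>qch_conv_module\<close>): an element with the largest number of inversions spans a one-dimensional
submodule, which is split off. This uses that the characteristic is well defined
(\<open>ex_qs_characteristic\<close>). For a set \<open>I\<close> of generators, the longest word in them acts on every module
as an idempotent. Its rank is additive on short exact sequences, and on \<open>\<^bold>F\<^sub>\<alpha>\<close> it is 1 or 0 according
to whether \<open>I\<close> avoids \<open>set(\<alpha>)\<close>. Moebius inversion over the subsets of the generators turns
these ranks into a combination of fundamental functions, which is the characteristic.
\<close>

section \<open>Row insertion\<close>

definition ins_pos :: "'a::linorder \<Rightarrow> 'a list \<Rightarrow> nat" where
  "ins_pos x R = length (takeWhile (\<lambda>y. y < x) R)"

text \<open>
Schensted row insertion: \<open>x\<close> replaces the first entry of the top row that is not smaller, and the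
replaced entry is inserted into the remaining rows.
\<close>

fun row_ins :: "'a::linorder \<Rightarrow> 'a list list \<Rightarrow> 'a list list" where
  "row_ins x [] = [[x]]"
| "row_ins x (R # T) = (if ins_pos x R < length R
     then R[ins_pos x R := x] # row_ins (R ! ins_pos x R) T else (R @ [x]) # T)"

text \<open>
The box, counted from \<open>(1, 1)\<close>, by which the insertion of \<open>x\<close> enlarges the shape.
\<close>

fun new_box :: "'a::linorder \<Rightarrow> 'a list list \<Rightarrow> nat \<times> nat" where
  "new_box x [] = (1, 1)"
| "new_box x (R # T) = (if ins_pos x R < length R
     then apfst Suc (new_box (R ! ins_pos x R) T) else (1, Suc (length R)))"

text \<open>
Only the top row of \<open>T\<close> is compared with \<open>R\<close>; the recursion in \<open>tableau\<close> covers the other rows.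
\<close>

fun above :: "'a::linorder list \<Rightarrow> 'a list list \<Rightarrow> bool" where
  "above R [] = True"
| "above R (S # T) = (length S \<le> length R \<and> (\<forall>j<length S. R ! j < S ! j))"

fun tableau :: "'a::linorder list list \<Rightarrow> bool" where
  "tableau [] = True"
| "tableau (R # T) = (R \<noteq> [] \<and> sorted_wrt (<) R \<and> above R T \<and> tableau T)"

fun cells :: "'a list list \<Rightarrow> (nat \<times> nat) set" where
  "cells [] = {}"
| "cells (R # T) = Pair 1 ` {1..length R} \<union> apfst Suc ` cells T"

lemma ins_pos_le: "ins_pos x R \<le> length R"
  by (simp add: ins_pos_def length_takeWhile_le)

lemma ins_pos_less: "j < ins_pos x R \<Longrightarrow> R ! j < x"
  unfolding ins_pos_def
  by (metis (mono_tags, lifting) nth_mem set_takeWhileD takeWhile_nth)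

lemma ins_pos_ge:
  assumes "sorted_wrt (<) R" "ins_pos x R \<le> j" "j < length R"
  shows "x \<le> R ! j"
proof -
  have "x \<le> R ! ins_pos x R"
    using assms(2,3) nth_length_takeWhile[of "\<lambda>y. y < x" R] unfolding ins_pos_def by force
  moreover have "R ! ins_pos x R \<le> R ! j"
    using assms sorted_wrt_nth_less[OF assms(1), of "ins_pos x R" j]
    by (cases "ins_pos x R = j") auto
  ultimately show ?thesis by simp
qed

lemma ins_pos_gt:
  assumes "sorted_wrt (<) R" "x \<notin> set R" "ins_pos x R \<le> j" "j < length R"
  shows "x < R ! j"
  using ins_pos_ge[OF assms(1,3,4)] assms(2,4) by (metis nth_mem order_le_imp_less_or_eq)

lemma ins_pos_eqI:
  assumes "p \<le> length R" "\<And>j. j < p \<Longrightarrow> R ! j < x" "p < length R \<Longrightarrow> \<not> R ! p < x"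
  shows "ins_pos x R = p"
  unfolding ins_pos_def
proof (cases "p < length R")
  case True
  then show "length (takeWhile (\<lambda>y. y < x) R) = p"
    using takeWhile_eq_take_P_nth[of p R "\<lambda>y. y < x"] assms by simp
next
  case False
  show "length (takeWhile (\<lambda>y. y < x) R) = p"
    proof -
    have "p = length R" using False assms(1) by simp
    then have "takeWhile (\<lambda>y. y < x) R = R"
      using assms(2) unfolding takeWhile_eq_all_conv by (auto simp: in_set_conv_nth)
    then show ?thesis using \<open>p = length R\<close> by (simp only:)
  qed
qed

lemma ins_pos_leI: "sorted_wrt (<) R \<Longrightarrow> p \<le> length R \<Longrightarrow> (p < length R \<Longrightarrow> x \<le> R ! p) \<Longrightarrow> ins_pos x R \<le> p"
  by (metis ins_pos_le ins_pos_less leD le_eq_less_or_eq linorder_not_less order_trans)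

text \<open>
Columns increase downwards, so an entry that leaves its row is inserted weakly to the left of its old
column. Everything about the columns of new boxes rests on this.
\<close>

lemma ins_pos_below:
  assumes "sorted_wrt (<) S" "length S \<le> length R" "\<forall>j<length S. R ! j < S ! j" "p < length R"
  shows "ins_pos (R ! p) S \<le> p"
proof (cases "p < length S")
  case True
  then show ?thesis using assms by (intro ins_pos_leI[OF assms(1)]) (auto simp: less_imp_le)
next
  case False
  then show ?thesis using ins_pos_le[of "R ! p" S] by simp
qed

lemma nth_hd_notin:
  "distinct (concat (R # T)) \<Longrightarrow> p < length R \<Longrightarrow> R ! p \<notin> set (concat T)"
  by (metis IntI concat.simps(2) distinct_append empty_iff nth_mem)

lemma sorted_list_update:
  assumes "sorted_wrt (<) R" "p < length R" "\<And>j. j < p \<Longrightarrow> R ! j < x"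
    "\<And>j. p < j \<Longrightarrow> j < length R \<Longrightarrow> x < R ! j"
  shows "sorted_wrt (<) (R[p := x])"
  using assms unfolding sorted_wrt_iff_nth_less
  by (auto simp: nth_list_update)

lemma mset_row_ins: "mset (concat (row_ins x T)) = add_mset x (mset (concat T))"
proof (induction x T rule: row_ins.induct)
  case (2 x R T)
  then show ?case
    using insert_DiffM[of "R ! ins_pos x R" "mset R"] by (auto simp: mset_update)
qed simp

lemma set_row_ins: "set (concat (row_ins x T)) = insert x (set (concat T))"
  by (metis mset_row_ins set_mset_add_mset_insert set_mset_mset)

lemma distinct_row_ins:
  "distinct (concat (row_ins x T)) \<longleftrightarrow> x \<notin> set (concat T) \<and> distinct (concat T)"
  by (metis distinct.simps(2) mset.simps(2) mset_eq_imp_distinct_iff mset_row_ins)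

text \<open>
After the bump, columns could only fail to increase where the bumped entry lands and where \<open>x\<close>
takes its place. The bumped entry lands weakly to the left of column \<open>p\<close>, hence below a smaller entry of
the new row, and \<open>x\<close> is smaller than what it replaces.
\<close>

lemma above_row_ins:
  assumes "p < length R" "x < R ! p" "above R T" "tableau T"
    "R ! p \<notin> set (concat T)" "sorted_wrt (<) R"
  shows "above (R[p := x]) (row_ins (R ! p) T)"
proof (cases T)
  case Nil
  then show ?thesis using assms sorted_wrt_nth_less[OF assms(6), of 0 p]
    by (cases "p = 0") (auto simp: nth_list_update Suc_le_eq)
next
  case (Cons S T')
  define q where "q = ins_pos (R ! p) S"
  have S: "sorted_wrt (<) S" "length S \<le> length R" "\<And>j. j < length S \<Longrightarrow> R ! j < S ! j"
    using assms Cons by auto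
  have qp: "q \<le> p"
    unfolding q_def using S assms(1) by (intro ins_pos_below) auto
  have le: "R[p := x] ! j \<le> R ! j" if "j < length R" for j
    using assms that by (auto simp: nth_list_update)
  have q: "R[p := x] ! q < R ! p"
    using qp assms sorted_wrt_nth_less[OF assms(6), of q p]
    by (cases "q = p") (auto)
  have lt: "R[p := x] ! j < S ! j" if "j < length S" for j
    using order.strict_trans1[OF le[of j] S(3)[OF that]] S(2) that by simp
  show ?thesis
  proof (cases "q < length S")
    case True
    have "R[p := x] ! j < S[q := R ! p] ! j" if "j < length S" for j
      using lt[OF that] q that by (cases "j = q") (simp_all add: nth_list_update_neq[of q j S])
    then show ?thesis using S(2) Cons True by (simp add: q_def)
  next
    case False
    then have eq: "q = length S" using ins_pos_le[of "R ! p" S] by (simp add: q_def)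
    moreover have "q < length R" using qp assms by simp
    moreover have "R[p := x] ! j < (S @ [R ! p]) ! j" if "j < Suc (length S)" for j
      using lt[of j] q that eq by (cases "j = q") (simp_all add: nth_append)
    ultimately show ?thesis using Cons False by (simp add: q_def)
  qed
qed

lemma tableau_row_ins:
  "tableau T \<Longrightarrow> distinct (concat T) \<Longrightarrow> x \<notin> set (concat T) \<Longrightarrow> tableau (row_ins x T)"
proof (induction x T rule: row_ins.induct)
  case (2 x R T)
  let ?p = "ins_pos x R"
  have R: "R \<noteq> []" "sorted_wrt (<) R" "above R T" "tableau T" "x \<notin> set R" using "2.prems" by auto
  show ?case
  proof (cases "?p < length R")
    case True
    have nin: "R ! ?p \<notin> set (concat T)" using nth_hd_notin[OF "2.prems"(2) True] .
    have "x < R ! ?p" using ins_pos_gt[OF R(2,5) _ True] by simp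
    moreover have "sorted_wrt (<) (R[?p := x])"
      using True R by (intro sorted_list_update) (auto intro: ins_pos_less ins_pos_gt)
    moreover have "tableau (row_ins (R ! ?p) T)" using "2.IH" True nin "2.prems" by auto
    ultimately show ?thesis using True R above_row_ins[of ?p R x T] nin by simp
  next
    case False
    then have "\<forall>y\<in>set R. y < x"
      using ins_pos_less[of _ x R] by (auto simp: in_set_conv_nth)
    moreover have "above (R @ [x]) T" using R(3) by (cases T) (auto simp: nth_append)
    ultimately show ?thesis using False R by (auto simp: sorted_wrt_append)
  qed
qed auto

lemma finite_cells: "finite (cells T)" by (induction T) auto

lemma cells_pos: "(i, j) \<in> cells T \<Longrightarrow> 1 \<le> i \<and> 1 \<le> j"
  by (induction T arbitrary: i) auto

lemma new_box_pos: "1 \<le> fst (new_box x T)" "1 \<le> snd (new_box x T)"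
  by (induction x T rule: new_box.induct) auto

lemma apfst_Suc_inj: "inj (apfst Suc)" by (auto simp: inj_def)

lemma cells_row_ins:
  "cells (row_ins x T) = insert (new_box x T) (cells T) \<and> new_box x T \<notin> cells T"
proof (induction x T rule: row_ins.induct)
  case (2 x R T)
  show ?case
  proof (cases "ins_pos x R < length R")
    case True
    obtain r c where rc: "new_box (R ! ins_pos x R) T = (r, c)" by fastforce
    with True 2 show ?thesis
      using new_box_pos[of "R ! ins_pos x R" T] by (auto simp: image_iff)
  next
    case False
    then show ?thesis using cells_pos by (fastforce simp: image_iff)
  qed
qed auto

text \<open>
The bumping path moves weakly to the left as it goes down.
\<close>

lemma new_box_col_le:
  assumes "tableau T" "case T of [] \<Rightarrow> True | S # _ \<Rightarrow> ins_pos y S \<le> p"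
    "y \<notin> set (concat T)" "distinct (concat T)"
  shows "snd (new_box y T) \<le> Suc p"
  using assms
proof (induction y T arbitrary: p rule: row_ins.induct)
  case (2 y S T)
  show ?case
  proof (cases "ins_pos y S < length S")
    case True
    let ?q = "ins_pos y S"
    have "case T of [] \<Rightarrow> True | S' # _ \<Rightarrow> ins_pos (S ! ?q) S' \<le> ?q"
    proof (cases T)
      case (Cons S' T')
      with 2 have "sorted_wrt (<) S'" "length S' \<le> length S" "\<forall>j<length S'. S ! j < S' ! j" by auto
      then show ?thesis using Cons True by (simp add: ins_pos_below)
    qed simp
    moreover have "S ! ?q \<notin> set (concat T)" using nth_hd_notin[OF "2.prems"(4) True] .
    ultimately have "snd (new_box (S ! ?q) T) \<le> Suc ?q"
      using "2.IH" True "2.prems" by auto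
    then show ?thesis using True "2.prems"(2) by simp
  next
    case False
    then show ?thesis using "2.prems"(2) ins_pos_le[of y S] by simp
  qed
qed simp

lemma bump_col_le:
  assumes "tableau (R # T)" "distinct (concat (R # T))" "p < length R"
  shows "snd (new_box (R ! p) T) \<le> Suc p"
proof (rule new_box_col_le)
  show "case T of [] \<Rightarrow> True | S # _ \<Rightarrow> ins_pos (R ! p) S \<le> p"
  proof (cases T)
    case (Cons S T')
    with assms have "sorted_wrt (<) S" "length S \<le> length R" "\<forall>j<length S. R ! j < S ! j" by auto
    then show ?thesis using Cons assms by (simp add: ins_pos_below)
  qed simp
  show "R ! p \<notin> set (concat T)" by (rule nth_hd_notin[OF assms(2,3)])
qed (use assms in auto)

text \<open>
Row bumping: if a larger letter follows, its bumping path runs strictly to the right of the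
first one. Together with \<open>new_box_col_ge\<close> this makes ascents of a word visible in the columns of its
recorded boxes.
\<close>

lemma new_box_col_less:
  assumes "tableau T" "distinct (concat T)" "x \<notin> set (concat T)" "x' \<notin> set (concat T)" "x < x'"
  shows "snd (new_box x T) < snd (new_box x' (row_ins x T))"
  using assms
proof (induction x T arbitrary: x' rule: row_ins.induct)
  case (1 x)
  then have "ins_pos x' [x] = 1" by (simp add: ins_pos_def)
  then show ?case by simp
next
  case (2 x R T)
  let ?p = "ins_pos x R"
  have R: "sorted_wrt (<) R" "x \<notin> set R" "x' \<notin> set R" using "2.prems" by auto
  show ?case
  proof (cases "?p < length R")
    case True
    let ?R = "R[?p := x]" let ?p' = "ins_pos x' ?R"
    have sR: "sorted_wrt (<) ?R"
      using True R by (intro sorted_list_update) (auto intro: ins_pos_less ins_pos_gt)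
    have pp: "?p < ?p'"
    proof (rule ccontr)
      assume "\<not> ?p < ?p'"
      then have "x' \<le> ?R ! ?p" using ins_pos_ge[OF sR, of x' ?p] True by simp
      then show False using True "2.prems" by simp
    qed
    have colp: "snd (new_box (R ! ?p) T) \<le> Suc ?p" using bump_col_le "2.prems" True by blast
    show ?thesis
    proof (cases "?p' < length R")
      case True': True
      have "R ! ?p < R ! ?p'" using pp True' R(1) by (simp add: sorted_wrt_iff_nth_less)
      moreover have "R ! ?p \<notin> set (concat T)" "R ! ?p' \<notin> set (concat T)"
        using nth_hd_notin[OF "2.prems"(2)] True True' by auto
      ultimately show ?thesis using "2.IH"[OF True, of "R ! ?p'"] "2.prems" True True' pp by auto
    next
      case False
      then show ?thesis using True colp by simp
    qed
  next
    case False
    then have eq: "?p = length R" using ins_pos_le[of x R] by simp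
    have "ins_pos x' (R @ [x]) = Suc (length R)"
    proof (rule ins_pos_eqI)
      show "(R @ [x]) ! j < x'" if "j < Suc (length R)" for j
        using that ins_pos_less[of j x R] eq \<open>x < x'\<close> by (auto simp: nth_append less_Suc_eq)
    qed auto
    then show ?thesis using False by simp
  qed
qed

text \<open>
Row bumping for a smaller letter: its path runs weakly to the left of the first one.
\<close>

lemma new_box_col_ge:
  assumes "tableau T" "distinct (concat T)" "x \<notin> set (concat T)" "x' \<notin> set (concat T)" "x' < x"
  shows "snd (new_box x' (row_ins x T)) \<le> snd (new_box x T)"
  using assms
proof (induction x T arbitrary: x' rule: row_ins.induct)
  case (1 x)
  then have "ins_pos x' [x] = 0" by (simp add: ins_pos_def)
  then show ?case by simp
next
  case (2 x R T)
  let ?p = "ins_pos x R"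
  have R: "sorted_wrt (<) R" "x \<notin> set R" "x' \<notin> set R" using "2.prems" by auto
  show ?case
  proof (cases "?p < length R")
    case True
    let ?R = "R[?p := x]" let ?p' = "ins_pos x' ?R"
    have sR: "sorted_wrt (<) ?R"
      using True R by (intro sorted_list_update) (auto intro: ins_pos_less ins_pos_gt)
    have pp: "?p' \<le> ?p" using True \<open>x' < x\<close> by (intro ins_pos_leI[OF sR]) auto
    have xp: "x < R ! ?p" using ins_pos_gt[OF R(1,2) _ True] by simp
    have y: "?R ! ?p' < R ! ?p"
      using pp True xp R(1) by (cases "?p' = ?p") (auto simp: sorted_wrt_iff_nth_less)
    have "R ! ?p \<notin> set (concat T)" using nth_hd_notin[OF "2.prems"(2) True] .
    moreover have "?R ! ?p' \<notin> set (concat T)"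
    proof (cases "?p' = ?p")
      case False
      then have "?R ! ?p' \<in> set R" using pp True by simp
      then show ?thesis using "2.prems"(2) by auto
    qed (use True "2.prems" in auto)
    ultimately show ?thesis using "2.IH"[OF True, of "?R ! ?p'"] "2.prems" True pp y by auto
  next
    case False
    then have eq: "?p = length R" using ins_pos_le[of x R] by simp
    let ?p' = "ins_pos x' (R @ [x])"
    have tab: "tableau ((R @ [x]) # T)" "distinct (concat ((R @ [x]) # T))"
      using tableau_row_ins[OF "2.prems"(1-3)] distinct_row_ins[of x "R # T"] "2.prems" False by auto
    have p': "?p' \<le> length R" using tab \<open>x' < x\<close> by (intro ins_pos_leI) (auto simp: nth_append)
    then have "snd (new_box ((R @ [x]) ! ?p') T) \<le> Suc ?p'" using bump_col_le[OF tab, of ?p'] by simp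
    then show ?thesis using False p' by simp
  qed
qed

lemma tableau_hd_less:
  "tableau (R # T) \<Longrightarrow> y \<in> set (concat T) \<Longrightarrow> R ! 0 < y"
proof (induction T arbitrary: R)
  case (Cons S T)
  have "R ! 0 < S ! 0" using Cons.prems(1) by (cases S) auto
  moreover have "S ! 0 \<le> y"
  proof (cases "y \<in> set S")
    case True
    then obtain j where "j < length S" "S ! j = y" by (auto simp: in_set_conv_nth)
    then show ?thesis using Cons.prems(1) sorted_wrt_nth_less[of "(<)" S 0 j] by (cases j) auto
  next
    case False
    then have "S ! 0 < y" using Cons.IH[of S] Cons.prems by simp
    then show ?thesis by simp
  qed
  ultimately show ?case by simp
qed simp

text \<open>
Reverse bumping from a corner box: by induction the lower rows yield the entry \<open>y\<close> that was bumped
into them, and \<open>y\<close> returns to the top row in place of the largest smaller entry, which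
leaves.
\<close>

lemma row_ins_surj:
  assumes "tableau T'" "distinct (concat T')" "(r, c) \<in> cells T'" "(Suc r, c) \<notin> cells T'" "(r, Suc c) \<notin> cells T'"
  shows "\<exists>T x. tableau T \<and> row_ins x T = T' \<and> new_box x T = (r, c)"
  using assms
proof (induction T' arbitrary: r c)
  case (Cons R Ts)
  have R: "R \<noteq> []" "sorted_wrt (<) R" "above R Ts" "tableau Ts" using Cons.prems by auto
  show ?case
  proof (cases "r = 1")
    case True
    then have c: "c = length R" using Cons.prems(3,5) cells_pos[of 0 c Ts] by auto
    obtain R0 x where Rx: "R = R0 @ [x]" using R(1) by (meson rev_exhaust)
    have nc: "(1, c) \<notin> cells Ts" using Cons.prems(4) True by (auto simp: image_iff)
    have short: "length S < length R" if "Ts = S # T'" for S T'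
      using that nc c R(1,3) by (cases "length S = length R") (auto simp: Suc_le_eq)
    show ?thesis
    proof (cases "R0 = []")
      case True
      then have "Ts = []" using short R(4) Rx by (cases Ts) auto
      then have "tableau [] \<and> row_ins x [] = R # Ts \<and> new_box x [] = (r, c)"
        using True Rx c \<open>r = 1\<close> by simp
      then show ?thesis by blast
    next
      case False
      have "ins_pos x R0 = length R0"
        using R(2) Rx by (intro ins_pos_eqI) (auto simp: sorted_wrt_append)
      moreover have "above R0 Ts" using R(3) short Rx by (cases Ts) (auto simp: nth_append split: if_splits)
      ultimately have "tableau (R0 # Ts) \<and> row_ins x (R0 # Ts) = R # Ts \<and> new_box x (R0 # Ts) = (r, c)"
        using False R Rx c \<open>r = 1\<close> by (simp add: sorted_wrt_append)
      then show ?thesis by blast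
    qed
  next
    case False
    then obtain r' where r': "r = Suc r'" "(r', c) \<in> cells Ts" using Cons.prems(3) by auto
    then have "(Suc r', c) \<notin> cells Ts" "(r', Suc c) \<notin> cells Ts" using Cons.prems(4,5) by (auto simp: image_iff)
    moreover have "distinct (concat Ts)" using Cons.prems(2) by simp
    ultimately obtain T1 y where T1: "tableau T1" "row_ins y T1 = Ts" "new_box y T1 = (r', c)"
      using Cons.IH[OF R(4) _ r'(2)] by blast
    have dT1: "y \<notin> set (concat T1)" "distinct (concat T1)"
      using distinct_row_ins[of y T1] T1 Cons.prems(2) by auto
    have yTs: "y \<in> set (concat Ts)" using T1(2) set_row_ins[of y T1] by auto
    have ynR: "y \<notin> set R" using yTs Cons.prems(2) by auto
    have "R ! 0 < y" using tableau_hd_less Cons.prems(1) yTs by blast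
    then have pos: "0 < ins_pos y R"
      using ins_pos_ge[OF R(2), of y 0] R(1) by (cases "ins_pos y R") auto
    define p where "p = ins_pos y R - 1"
    have p: "Suc p = ins_pos y R" using pos p_def by simp
    have pl: "p < length R" using p ins_pos_le[of y R] by simp
    have xy: "R ! p < y" using ins_pos_less[of p y R] p by simp
    define R1 where "R1 = R[p := y]"
    have sR1: "sorted_wrt (<) R1"
      unfolding R1_def using pl R(2) ynR p
      by (intro sorted_list_update) (auto intro: ins_pos_less ins_pos_gt)
    have ip: "ins_pos (R ! p) R1 = p"
      using pl xy R(2) by (intro ins_pos_eqI) (auto simp: R1_def sorted_wrt_iff_nth_less)
    have ab: "above R1 T1"
    proof (cases T1)
      case (Cons S T2)
      define q where "q = ins_pos y S"
      have S: "sorted_wrt (<) S" "y \<notin> set S" using Cons T1(1) dT1 by auto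
      have ge: "R ! j < (if j = q \<and> j < length S then y else S ! j)" "length S \<le> length R" if "j < length S" for j
        using R(3) that Cons T1(2)[symmetric]
        by (cases "q < length S"; fastforce simp: q_def nth_append nth_list_update split: if_splits)+
      have qp: "q \<le> p" if "p < length S"
      proof (rule ccontr)
        assume "\<not> q \<le> p"
        have Rq: "q < length S \<Longrightarrow> R ! q < y" using ge(1)[of q] by simp
        have Rq': "q = length S \<Longrightarrow> q < length R \<and> R ! q < y"
          using R(3) Cons T1(2)[symmetric] by (auto simp: q_def)
        have "q \<le> length S" using ins_pos_le[of y S] q_def by simp
        then have "q < length R \<and> R ! q < y" using Rq Rq' ge(2) by force
        moreover have "y < R ! q" if "q < length R"
          using ins_pos_gt[OF R(2) ynR, of q] that \<open>\<not> q \<le> p\<close> p by simp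
        ultimately show False by auto
      qed
      have "R1 ! j < S ! j" if j: "j < length S" for j
      proof (cases "j = p")
        case True
        then have "y < S ! j" using ins_pos_gt[OF S, of j] qp j by (simp add: q_def)
        then show ?thesis using True pl by (simp add: R1_def)
      next
        case False
        show ?thesis
        proof (cases "j = q")
          case True
          then have "R ! j < y" "y < S ! j" using ge(1)[of j] j ins_pos_gt[OF S, of j] by (auto simp: q_def)
          then show ?thesis using False by (simp add: R1_def)
        qed (use ge(1)[of j] j False in \<open>simp add: R1_def\<close>)
      qed
      moreover have "length S \<le> length R"
      proof (cases S)
        case (Cons a list)
        then show ?thesis using ge(2)[of 0] by simp
      qed simp
      ultimately show ?thesis using Cons by (simp add: R1_def)
    qed simp
    have "tableau (R1 # T1) \<and> row_ins (R ! p) (R1 # T1) = R # Ts \<and> new_box (R ! p) (R1 # T1) = (r, c)"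
      using ab sR1 T1 R(1) ip pl r'(1) by (simp add: R1_def)
    then show ?thesis by blast
  qed
qed simp

lemma new_box_row_1_iff: "fst (new_box x (R # T)) = 1 \<longleftrightarrow> \<not> ins_pos x R < length R"
  using new_box_pos(1)[of "R ! ins_pos x R" T] by (auto simp: Suc_le_eq)

lemma new_box_Cons_neq: "R \<noteq> [] \<Longrightarrow> new_box x (R # T) \<noteq> (1, 1)"
proof
  assume "R \<noteq> []" and eq: "new_box x (R # T) = (1, 1)"
  then have "\<not> ins_pos x R < length R" using new_box_row_1_iff[of x R T] by (metis fst_conv)
  then show False using eq \<open>R \<noteq> []\<close> by simp
qed

text \<open>
The new box tells whether the top row was bumped or extended. If it was bumped, the lower rows
determine the bumped entry, and this entry determines its old place: that of the largest smaller
entry.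
\<close>

lemma row_ins_inj:
  assumes "tableau T1" "tableau T2" "row_ins x1 T1 = row_ins x2 T2" "new_box x1 T1 = new_box x2 T2"
    "distinct (concat (row_ins x1 T1))"
  shows "x1 = x2 \<and> T1 = T2"
  using assms
proof (induction T1 arbitrary: x1 x2 T2)
  case Nil
  then show ?case
    using new_box_Cons_neq by (cases T2) (fastforce simp del: new_box.simps(2))+
next
  case (Cons R1 S1)
  show ?case
  proof (cases T2)
    case Nil
    then show ?thesis using Cons.prems(1,4) new_box_Cons_neq[of R1 x1 S1] by (simp del: new_box.simps(2))
  next
    case T2: (Cons R2 S2)
    let ?p1 = "ins_pos x1 R1" let ?p2 = "ins_pos x2 R2"
    show ?thesis
    proof (cases "?p1 < length R1")
      case False
      then have "\<not> ?p2 < length R2"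
        using Cons.prems(4) T2 new_box_row_1_iff[of x1 R1 S1] new_box_row_1_iff[of x2 R2 S2] by metis
      then show ?thesis using Cons.prems False T2 by simp
    next
      case p1: True
      then have p2: "?p2 < length R2"
        using Cons.prems(4) T2 new_box_row_1_iff[of x1 R1 S1] new_box_row_1_iff[of x2 R2 S2] by metis
      have e: "R1[?p1 := x1] = R2[?p2 := x2]" "row_ins (R1 ! ?p1) S1 = row_ins (R2 ! ?p2) S2"
        using Cons.prems(3) T2 p1 p2 by auto
      have nb: "new_box (R1 ! ?p1) S1 = new_box (R2 ! ?p2) S2"
        using Cons.prems(4) T2 p1 p2 by (simp add: prod_eq_iff)
      have tabs: "tableau S1" "tableau S2" "sorted_wrt (<) R1" "sorted_wrt (<) R2"
        using Cons.prems T2 by auto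
      have d: "distinct (concat (row_ins (R1 ! ?p1) S1))"
        using Cons.prems(5) p1 by simp
      have y: "R1 ! ?p1 = R2 ! ?p2" "S1 = S2"
        using Cons.IH[OF tabs(1,2) e(2) nb d] by auto
      have len: "length R1 = length R2" using e(1) by (metis length_list_update)
      have nth: "R1[?p1 := x1] ! j = R2[?p2 := x2] ! j" for j using e(1) by simp
      have aux: "False" if *: "p < p'" "p < length R" "p' < length R'" "sorted_wrt (<) R"
          "R[p := x] = R'[p' := x']" "R ! p = R' ! p'" "length R = length R'"
          "x' \<le> R' ! p'" for R R' :: "'a list" and p p' x x'
      proof -
        have "R[p := x] ! p' = R'[p' := x'] ! p'" using *(5) by (simp only:)
        then have "R ! p' = x'" using *(1,3) by simp
        moreover have "R ! p < R ! p'" using sorted_wrt_nth_less[OF *(4,1)] *(3,7) by simp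
        ultimately show False using *(6,8) by simp
      qed
      have "?p1 = ?p2"
      proof (rule ccontr)
        assume "?p1 \<noteq> ?p2"
        then consider "?p1 < ?p2" | "?p2 < ?p1" by linarith
        then show False
        proof cases
          case 1
          show False by (rule aux[OF 1 p1 p2 tabs(3) e(1) y(1) len])
              (use ins_pos_ge[OF tabs(4) _ p2, of x2] in simp)
        next
          case 2
          show False by (rule aux[OF 2 p2 p1 tabs(4) e(1)[symmetric] y(1)[symmetric] len[symmetric]])
              (use ins_pos_ge[OF tabs(3) _ p1, of x1] in simp)
        qed
      qed
      then have pp: "?p2 = ?p1" by simp
      have "x1 = x2" using nth[of ?p1] p1 p2 unfolding pp by simp
      moreover have "R1 = R2"
      proof -
        have "R1 = (R1[?p1 := x1])[?p1 := R1 ! ?p1]" by (simp only: list_update_overwrite list_update_id)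
        also have "\<dots> = (R2[?p1 := x2])[?p1 := R2 ! ?p1]" using e(1) y(1) unfolding pp by (simp only:)
        also have "\<dots> = R2" by (simp only: list_update_overwrite list_update_id)
        finally show ?thesis .
      qed
      ultimately show ?thesis using T2 y by simp
    qed
  qed
qed

section \<open>Insertion tableaux and recorded boxes\<close>

definition P_tab :: "'a::linorder list \<Rightarrow> 'a list list" where
  "P_tab w = foldl (\<lambda>T x. row_ins x T) [] w"

lemma P_tab_Nil [simp]: "P_tab [] = []"
  and P_tab_snoc [simp]: "P_tab (w @ [x]) = row_ins x (P_tab w)"
  by (simp_all add: P_tab_def)

text \<open>
Recursion on the reversed word, because insertion processes a word from the left and the last letter
contributes the last box.
\<close>

fun rec_rev :: "'a::linorder list \<Rightarrow> (nat \<times> nat) list" where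
  "rec_rev [] = []"
| "rec_rev (x # xs) = rec_rev xs @ [new_box x (P_tab (rev xs))]"

definition rec_boxes :: "'a::linorder list \<Rightarrow> (nat \<times> nat) list" where
  "rec_boxes w = rec_rev (rev w)"

lemma rec_boxes_Nil [simp]: "rec_boxes [] = []"
  and rec_boxes_snoc [simp]: "rec_boxes (w @ [x]) = rec_boxes w @ [new_box x (P_tab w)]"
  by (simp_all add: rec_boxes_def)

lemma length_rec_boxes [simp]: "length (rec_boxes w) = length w"
  by (induction w rule: rev_induct) auto

lemma mset_P_tab: "mset (concat (P_tab w)) = mset w"
  by (induction w rule: rev_induct) (auto simp: mset_row_ins simp del: mset_concat)

lemma set_P_tab: "set (concat (P_tab w)) = set w"
  by (metis mset_P_tab set_mset_mset)

lemma distinct_P_tab: "distinct (concat (P_tab w)) = distinct w"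
  by (metis mset_P_tab mset_eq_imp_distinct_iff)

lemma tableau_P_tab: "distinct w \<Longrightarrow> tableau (P_tab w)"
  by (induction w rule: rev_induct)
    (auto simp del: set_concat simp: tableau_row_ins set_P_tab distinct_P_tab)

lemma cells_P_tab_snoc:
  "cells (P_tab (w @ [x])) = insert (new_box x (P_tab w)) (cells (P_tab w))"
  "new_box x (P_tab w) \<notin> cells (P_tab w)"
  using cells_row_ins[of x "P_tab w"] by auto

lemma cells_eq:
  "cells T = {(i, j). 1 \<le> i \<and> i \<le> length T \<and> 1 \<le> j \<and> j \<le> length (T ! (i - 1))}"
proof (induction T)
  case (Cons R T)
  have "(i, j) \<in> cells (R # T) \<longleftrightarrow> 1 \<le> i \<and> i \<le> length (R # T) \<and> 1 \<le> j \<and> j \<le> length ((R # T) ! (i - 1))" for i j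
  proof (cases i)
    case (Suc k)
    then show ?thesis using Cons by (cases k) (auto simp: image_iff)
  qed (auto simp: image_iff)
  then show ?case by auto
qed simp

lemma tableau_lengths: "tableau T \<Longrightarrow> sorted_wrt (\<ge>) (map length T)"
proof (induction T)
  case (Cons R T)
  then show ?case by (cases T) (auto intro: order.trans)
qed simp

lemma tableau_nonempty: "tableau T \<Longrightarrow> [] \<notin> set T"
  by (induction T) auto

lemma cells_down:
  assumes "tableau T" "(i, j) \<in> cells T" "1 \<le> i'" "i' \<le> i" "1 \<le> j'" "j' \<le> j"
  shows "(i', j') \<in> cells T"
proof -
  have "length (T ! (i - 1)) \<le> length (T ! (i' - 1))"
    using sorted_wrt_nth_less[OF tableau_lengths[OF assms(1)], of "i' - 1" "i - 1"] assms(2-4)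
    by (cases "i' = i") (auto simp: cells_eq)
  then show ?thesis using assms(2-) by (auto simp: cells_eq)
qed

text \<open>
The linear extensions of a shape \<open>\<Lambda>\<close> are its standard tableaux, given as the
sequence in which the boxes are filled.
\<close>

definition lin_ext :: "(nat \<times> nat) list \<Rightarrow> (nat \<times> nat) set \<Rightarrow> bool" where
  "lin_ext b \<Lambda> \<longleftrightarrow> distinct b \<and> set b = \<Lambda> \<and> (\<forall>k<length b. \<forall>k'<length b.
     fst (b ! k') \<le> fst (b ! k) \<and> snd (b ! k') \<le> snd (b ! k) \<longrightarrow> k' \<le> k)"

lemma lin_ext_snoc:
  "lin_ext (b @ [z]) \<Lambda> \<longleftrightarrow> z \<in> \<Lambda> \<and> lin_ext b (\<Lambda> - {z}) \<and>
     (\<forall>y\<in>\<Lambda> - {z}. \<not> (fst z \<le> fst y \<and> snd z \<le> snd y))"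
proof -
  have A: "(\<forall>k<length (b @ [z]). \<forall>k'<length (b @ [z]).
      fst ((b @ [z]) ! k') \<le> fst ((b @ [z]) ! k) \<and> snd ((b @ [z]) ! k') \<le> snd ((b @ [z]) ! k) \<longrightarrow> k' \<le> k)
    \<longleftrightarrow> (\<forall>k<length b. \<forall>k'<length b. fst (b ! k') \<le> fst (b ! k) \<and> snd (b ! k') \<le> snd (b ! k) \<longrightarrow> k' \<le> k)
      \<and> (\<forall>k<length b. \<not> (fst z \<le> fst (b ! k) \<and> snd z \<le> snd (b ! k)))"
    by (auto simp: nth_append All_less_Suc)
  have B: "(\<forall>k<length b. \<not> (fst z \<le> fst (b ! k) \<and> snd z \<le> snd (b ! k))) \<longleftrightarrow>
      (\<forall>y\<in>set b. \<not> (fst z \<le> fst y \<and> snd z \<le> snd y))"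
    unfolding all_set_conv_all_nth ..
  have C: "distinct (b @ [z]) \<and> set (b @ [z]) = \<Lambda> \<longleftrightarrow> z \<in> \<Lambda> \<and> distinct b \<and> set b = \<Lambda> - {z}"
    by auto
  show ?thesis
    unfolding lin_ext_def A B using C by blast
qed

lemma lin_ext_rec_boxes: "distinct w \<Longrightarrow> lin_ext (rec_boxes w) (cells (P_tab w))"
proof (induction w rule: rev_induct)
  case Nil
  then show ?case by (simp add: lin_ext_def)
next
  case (snoc x w)
  let ?z = "new_box x (P_tab w)"
  have w: "distinct w" using snoc.prems by simp
  have "\<not> (fst ?z \<le> fst y \<and> snd ?z \<le> snd y)" if "y \<in> cells (P_tab w)" for y
    using that cells_down[OF tableau_P_tab[OF w], of "fst y" "snd y" "fst ?z" "snd ?z"]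
      new_box_pos[of x "P_tab w"] cells_P_tab_snoc(2)[of x w] by auto
  then show ?case
    using snoc.IH[OF w] cells_P_tab_snoc(1)[of w x] cells_P_tab_snoc(2)[of x w] by (auto simp: lin_ext_snoc)
qed

text \<open>
The last box of a linear extension is a corner, so it can be removed by reverse bumping; the letter that
leaves is the last letter of the word.
\<close>

lemma rec_boxes_surj:
  assumes "tableau T" "distinct (concat T)" "lin_ext b (cells T)"
  shows "\<exists>w. distinct w \<and> P_tab w = T \<and> rec_boxes w = b"
  using assms
proof (induction b arbitrary: T rule: rev_induct)
  case Nil
  then have "T = []" by (cases T) (auto simp: lin_ext_def Suc_le_eq)
  then show ?case by (intro exI[of _ "[]"]) simp
next
  case (snoc z b)
  obtain r c where z: "z = (r, c)" by fastforce
  have "(r, c) \<in> cells T" "(Suc r, c) \<notin> cells T" "(r, Suc c) \<notin> cells T"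
    using snoc.prems(3) z by (force simp: lin_ext_snoc)+
  then obtain T1 x where T1: "tableau T1" "row_ins x T1 = T" "new_box x T1 = z"
    using row_ins_surj[OF snoc.prems(1,2)] z by blast
  have d: "x \<notin> set (concat T1)" "distinct (concat T1)"
    using distinct_row_ins[of x T1] T1(2) snoc.prems(2) by auto
  have "cells T - {z} = cells T1" using cells_row_ins[of x T1] T1 by auto
  then have "lin_ext b (cells T1)" using snoc.prems(3) by (simp add: lin_ext_snoc)
  from snoc.IH[OF T1(1) d(2) this] obtain w where
    w: "distinct w" "P_tab w = T1" "rec_boxes w = b" by blast
  moreover have "x \<notin> set w" using d(1) set_P_tab[of w] unfolding w(2) by blast
  ultimately show ?case using T1 by (intro exI[of _ "w @ [x]"]) simp
qed

lemma rec_boxes_inj: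
  assumes "distinct w" "distinct w'" "P_tab w = P_tab w'" "rec_boxes w = rec_boxes w'"
  shows "w = w'"
  using assms
proof (induction w arbitrary: w' rule: rev_induct)
  case Nil
  then show ?case by (metis length_0_conv length_rec_boxes)
next
  case (snoc x w)
  from snoc.prems(4) have "w' \<noteq> []" by (metis Nil_is_append_conv list.distinct(1) rec_boxes_Nil rec_boxes_snoc)
  then obtain v y where w': "w' = v @ [y]" by (meson rev_exhaust)
  have r: "rec_boxes w = rec_boxes v" "new_box x (P_tab w) = new_box y (P_tab v)"
    using snoc.prems(4) w' by auto
  have "x = y \<and> P_tab w = P_tab v"
  proof (rule row_ins_inj)
    show "distinct (concat (row_ins x (P_tab w)))"
      using distinct_P_tab[of "w @ [x]"] snoc.prems(1) by simp
  qed (use snoc.prems w' r tableau_P_tab[of w] tableau_P_tab[of v] in auto)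
  moreover have "w = v" using snoc.IH[of v] snoc.prems(1,2) w' r(1) calculation by auto
  ultimately show ?case using w' by simp
qed

lemma rec_boxes_nth: "k < length w \<Longrightarrow> rec_boxes w ! k = new_box (w ! k) (P_tab (take k w))"
proof (induction w rule: rev_induct)
  case (snoc x w)
  then show ?case by (cases "k < length w") (auto simp: nth_append less_Suc_eq)
qed simp

lemma nth_notin_take:
  assumes "distinct w" "k \<le> j" "j < length w" shows "w ! j \<notin> set (take k w)"
proof
  assume "w ! j \<in> set (take k w)"
  then obtain i where "i < k" "i < length w" "w ! i = w ! j" by (auto simp: in_set_conv_nth)
  then show False using assms nth_eq_iff_index_eq[OF assms(1), of i j] by simp
qed

lemma rec_boxes_ascent:
  assumes "distinct w" "Suc k < length w"
  shows "snd (rec_boxes w ! k) < snd (rec_boxes w ! Suc k) \<longleftrightarrow> w ! k < w ! Suc k"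
proof -
  let ?T = "P_tab (take k w)"
  have T: "tableau ?T" "distinct (concat ?T)"
    using assms(1) by (simp_all only: tableau_P_tab distinct_P_tab distinct_take)
  have nin: "w ! k \<notin> set (concat ?T)" "w ! Suc k \<notin> set (concat ?T)"
    unfolding set_P_tab using nth_notin_take[OF assms(1), of k] assms(2) by auto
  have "take (Suc k) w = take k w @ [w ! k]" using assms(2) by (simp add: take_Suc_conv_app_nth)
  then have S: "rec_boxes w ! Suc k = new_box (w ! Suc k) (row_ins (w ! k) ?T)"
    using rec_boxes_nth[OF assms(2)] by simp
  have N: "rec_boxes w ! k = new_box (w ! k) ?T" using rec_boxes_nth[of k w] assms(2) by simp
  have neq: "w ! k \<noteq> w ! Suc k" using nth_eq_iff_index_eq[OF assms(1), of k "Suc k"] assms(2) by simp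
  show ?thesis
  proof (cases "w ! k < w ! Suc k")
    case True
    then show ?thesis unfolding S N using new_box_col_less[OF T nin True] by blast
  next
    case False
    then have "w ! Suc k < w ! k" using neq by simp
    then show ?thesis unfolding S N using new_box_col_ge[OF T nin] False by (simp add: not_less)
  qed
qed

text \<open>
The Robinson-Schensted correspondence for a fixed insertion tableau. The positions \<open>k\<close> with \<open>Q k\<close>
are those at which an ascent is demanded; in the recorded boxes an ascent is a move to a
column further right.
\<close>

lemma card_words_eq_card_lin_exts:
  assumes "tableau T" "distinct (concat T)"
  shows "card {w. distinct w \<and> P_tab w = T \<and>
             (\<forall>k. Suc k < length w \<longrightarrow> Q k \<longrightarrow> w ! k < w ! Suc k)}
       = card {b. lin_ext b (cells T) \<and>
             (\<forall>k. Suc k < length b \<longrightarrow> Q k \<longrightarrow> snd (b ! k) < snd (b ! Suc k))}"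
  (is "card ?A = card ?B")
proof (rule bij_betw_same_card[of rec_boxes])
  show "bij_betw rec_boxes ?A ?B"
    unfolding bij_betw_def
  proof
    show "inj_on rec_boxes ?A" by (auto intro!: inj_onI rec_boxes_inj)
    have "rec_boxes w \<in> ?B" if "w \<in> ?A" for w
      using that lin_ext_rec_boxes[of w] by (auto simp: rec_boxes_ascent)
    moreover have "b \<in> rec_boxes ` ?A" if "b \<in> ?B" for b
    proof -
      obtain w where w: "distinct w" "P_tab w = T" "rec_boxes w = b"
        using rec_boxes_surj[OF assms, of b] \<open>b \<in> ?B\<close> by blast
      then have "\<forall>k. Suc k < length w \<longrightarrow> Q k \<longrightarrow> w ! k < w ! Suc k"
        using \<open>b \<in> ?B\<close> rec_boxes_ascent[OF w(1)] unfolding w(3)[symmetric] by simp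
      then show ?thesis using w by blast
    qed
    ultimately show "rec_boxes ` ?A = ?B" by blast
  qed
qed

section \<open>Greene invariants and Knuth relations\<close>

text \<open>
The letters are the elements of a linear order and \<open>p\<close> gives their positions in a word, so \<open>C\<close> is the
set of letters of a decreasing subsequence.
\<close>

definition dec_chain :: "('a::linorder \<Rightarrow> nat) \<Rightarrow> 'a set \<Rightarrow> bool" where
  "dec_chain p C \<longleftrightarrow> (\<forall>x\<in>C. \<forall>y\<in>C. x < y \<longrightarrow> p y < p x)"

definition k_good :: "('a::linorder \<Rightarrow> nat) \<Rightarrow> nat \<Rightarrow> 'a set \<Rightarrow> bool" where
  "k_good p k S \<longleftrightarrow> (\<forall>C\<subseteq>S. dec_chain p C \<longrightarrow> card C \<le> k)"

text \<open>
By Dilworth's theorem this is the largest size of a union of \<open>k\<close> increasing subsequences. Sets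
without long decreasing subsequences are the more convenient form: a single chain witnesses that a set
is not \<open>k\<close>-good.
\<close>

definition greene :: "('a::linorder \<Rightarrow> nat) \<Rightarrow> 'a set \<Rightarrow> nat \<Rightarrow> nat" where
  "greene p A k = Max (card ` {S. S \<subseteq> A \<and> k_good p k S})"

lemma k_good_empty: "k_good p k {}"
  by (auto simp: k_good_def)

lemma greene_leI:
  assumes "finite A" "\<And>S. S \<subseteq> A \<Longrightarrow> k_good p k S \<Longrightarrow> card S \<le> m"
  shows "greene p A k \<le> m"
  unfolding greene_def
  by (rule Max.boundedI) (use assms k_good_empty[of p k] in auto)

lemma greene_geI:
  assumes "finite A" "S \<subseteq> A" "k_good p k S"
  shows "card S \<le> greene p A k"
  unfolding greene_def by (rule Max_ge) (use assms in auto)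

lemma greene_mono:
  assumes "finite A" "\<And>x y. x \<in> A \<Longrightarrow> y \<in> A \<Longrightarrow> x < y \<Longrightarrow> p' y < p' x \<Longrightarrow> p y < p x"
  shows "greene p A k \<le> greene p' A k"
proof (rule greene_leI[OF assms(1)])
  fix S assume S: "S \<subseteq> A" "k_good p k S"
  then have "k_good p' k S"
    using assms(2) unfolding k_good_def dec_chain_def by (meson subsetD)
  then show "card S \<le> greene p' A k" by (rule greene_geI[OF assms(1) S(1)])
qed

lemma card_Un_filters:
  assumes "finite A" "finite B" "\<And>z. \<not> (P z \<and> Q z)"
  shows "card ({z \<in> A. P z} \<union> {z \<in> B. Q z}) = card {z \<in> A. P z} + card {z \<in> B. Q z}"
  by (rule card_Un_disjoint) (use assms in auto)

text \<open>
The core of the Knuth invariance. The letters \<open>a < b < c\<close> stand in three adjacent positions, with \<open>b\<close> at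
one end, and passing from \<open>p\<close> to \<open>p'\<close> turns the increasing pair \<open>a, c\<close> into a decreasing one. If this
destroys the goodness of \<open>S\<close>, then goodness is restored by replacing one of \<open>a\<close> and \<open>c\<close> by \<open>b\<close>,
which does not change the size of \<open>S\<close>.
\<close>

lemma k_good_exchange:
  fixes a b c :: "'a::linorder" and p p' :: "'a \<Rightarrow> nat"
  assumes S: "finite S" "k_good p k S" "S \<subseteq> L" and ord: "a < b" "b < c"
    and abc: "p ` {a, b, c} \<subseteq> {i..i+2}" "p' ` {a, b, c} \<subseteq> {i..i+2}"
    and other: "\<And>x. x \<in> L \<Longrightarrow> x \<notin> {a, b, c} \<Longrightarrow> p' x = p x \<and> (p x < i \<or> i + 2 < p x)"
    and swap: "p a < p c" "p' c < p' a"
    and b: "p b < p a \<and> p' b < p' c \<or> p c < p b \<and> p' a < p' b"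
  shows "k_good p' k S \<or> a \<in> S \<and> c \<in> S \<and> b \<notin> S \<and> (\<exists>d\<in>{a, c}. k_good p' k (insert b (S - {d})))"
proof (cases "k_good p' k S")
  case False
  then obtain C where C: "C \<subseteq> S" "dec_chain p' C" "k < card C"
    by (auto simp: k_good_def not_le)
  have dC: "p' y < p' x" if "x \<in> C" "y \<in> C" "x < y" for x y
    using C(2) that by (auto simp: dec_chain_def)
  have CL: "x \<in> L" if "x \<in> C" for x using C(1) S(3) that by auto
  have same: "p y < p x" if "x \<in> insert b L" "y \<in> insert b L" "\<not> (x = a \<and> y = c)" "p' y < p' x" for x y
    using that other[of x] other[of y] abc b swap
    by (cases "x \<in> {a, b, c}"; cases "y \<in> {a, b, c}") auto
  have sg: "card D \<le> k" if "D \<subseteq> S" "dec_chain p D" for D using S(2) that by (auto simp: k_good_def)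
  have ac: "a \<in> C \<and> c \<in> C"
  proof (rule ccontr)
    assume "\<not> (a \<in> C \<and> c \<in> C)"
    then have "dec_chain p C" unfolding dec_chain_def using dC same CL by blast
    then show False using sg[OF C(1)] C(3) by simp
  qed
  have bC: "b \<notin> C" using dC[of b c] dC[of a b] ac ord b swap by auto
  \<comment> \<open>The chain \<open>C\<close> runs from large letters left of the three places through \<open>c\<close> and \<open>a\<close> to small letters right of them; so its letters above \<open>c\<close> precede and its letters below \<open>a\<close> follow.\<close>
  have shape: "z < a \<and> i + 2 < p z \<or> c < z \<and> p z < i" if z: "z \<in> C" "z \<noteq> a" "z \<noteq> c" for z
  proof -
    have zo: "p' z = p z" "p z < i \<or> i + 2 < p z" using other[of z] CL z bC by auto
    have acC: "a \<in> C" "c \<in> C" using ac by auto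
    consider "z < a" | "a < z" "z < c" | "c < z" using z(2,3) by (meson linorder_neqE)
    then show ?thesis
      using dC[of z a] dC[of a z] dC[of z c] dC[of c z] z zo abc acC ord by cases auto
  qed
  have bS: "b \<notin> S"
  proof
    assume bS: "b \<in> S"
    \<comment> \<open>If \<open>b\<close> belonged to \<open>S\<close>, it could replace the one of \<open>a\<close> and \<open>c\<close> with which it is not in decreasing order, and \<open>S\<close> would contain a long decreasing chain for \<open>p\<close> already.\<close>
    define e where "e = (if p b < p a then c else a)"
    have e: "e \<in> C" "e = a \<or> e = c" using ac by (auto simp: e_def)
    have b': "p b < p a \<and> p b < p c \<and> p' b < p' c \<and> e = c \<or> p c < p b \<and> p a < p b \<and> p' a < p' b \<and> e = a"
      using b swap by (auto simp: e_def)
    let ?D = "insert b (C - {e})"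
    have "dec_chain p ?D"
      unfolding dec_chain_def
    proof (intro ballI impI)
      fix x y assume xy: "x \<in> ?D" "y \<in> ?D" "x < y"
      consider "x = b" | "y = b" | "x \<noteq> b" "y \<noteq> b" by blast
      then show "p y < p x"
      proof cases
        case 1
        then have "y \<in> C" "y \<noteq> e" "b < y" using xy by auto
        then show ?thesis using 1 shape[of y] b' ord abc by (cases "y = c"; cases "y = a") auto
      next
        case 2
        then have "x \<in> C" "x \<noteq> e" "x < b" using xy by auto
        then show ?thesis using 2 shape[of x] b' ord abc by (cases "x = a"; cases "x = c") auto
      next
        case 3
        then have "x \<in> C" "y \<in> C" "\<not> (x = a \<and> y = c)" using xy e(2) by auto
        then show ?thesis using same[of x y] dC[of x y] CL xy(3) by auto
      qed
    qed
    moreover have "card ?D = card C" using e(1) bC finite_subset[OF C(1) S(1)] card_Suc_Diff1[of C e] by simp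
    ultimately show False using sg[of ?D] C bS by auto
  qed
  \<comment> \<open>Remove the letter that now forms a decreasing pair with \<open>b\<close>.\<close>
  define d where "d = (if p b < p a then a else c)"
  have d: "d \<in> {a, c}" by (simp add: d_def)
  have "k_good p' k (insert b (S - {d}))"
    unfolding k_good_def
  proof (intro allI impI)
    fix C2 assume C2: "C2 \<subseteq> insert b (S - {d})" "dec_chain p' C2"
    have dC2: "p' y < p' x" if "x \<in> C2" "y \<in> C2" "x < y" for x y
      using C2(2) that by (auto simp: dec_chain_def)
    have C2L: "x \<in> insert b L" if "x \<in> C2" for x using C2(1) S(3) that by auto
    have not_ac: "\<not> (a \<in> C2 \<and> c \<in> C2)" using C2(1) d ord by auto
    have dp: "dec_chain p C2" unfolding dec_chain_def
    proof (intro ballI impI)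
      fix x y assume "x \<in> C2" "y \<in> C2" "x < y"
      then show "p y < p x" using same[of x y] C2L[of x] C2L[of y] dC2[of x y] not_ac by blast
    qed
    show "card C2 \<le> k"
    proof (cases "b \<in> C2")
      case False
      then show ?thesis using sg[of C2] C2(1) dp by auto
    next
      case True
      have nac: "a \<notin> C2" "c \<notin> C2"
        using dC2[of b c] dC2[of a b] True C2(1) ord b swap by (auto simp: d_def split: if_splits)
      have shape2: "z < b \<and> i + 2 < p z \<or> b < z \<and> p z < i" if z: "z \<in> C2" "z \<noteq> b" for z
      proof -
        have "z \<notin> {a, b, c}" "z \<in> L" using nac z C2L[of z] by auto
        then show ?thesis
          using dC2[of z b] dC2[of b z] z True abc other[of z] by (cases z b rule: linorder_cases) auto
      qed
      have fin: "finite C" "finite C2"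
        using finite_subset[OF C(1) S(1)] finite_subset[OF C2(1)] S(1) by auto
      \<comment> \<open>Both chains change over at the three places, \<open>C\<close> through \<open>c\<close> and \<open>a\<close>, \<open>C2\<close> through \<open>b\<close>. Exchanging their lower parts gives two chains in \<open>S\<close> for the old positions, with one letter less in total.\<close>
      define X1 X2 where "X1 = {z \<in> C. c \<le> z} \<union> {z \<in> C2. z < b}" and "X2 = {z \<in> C2. b < z} \<union> {z \<in> C. z \<le> a}"
      have "dec_chain p X1"
        unfolding dec_chain_def
      proof (intro ballI impI)
        fix x y assume xy: "x \<in> X1" "y \<in> X1" "x < y"
        consider "x \<in> C" "y \<in> C" "c \<le> x" | "x \<in> C2" "y \<in> C2" | "x \<in> C2" "x < b" "y \<in> C" "c \<le> y"
          using xy ord by (auto simp: X1_def)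
        then show "p y < p x"
        proof cases
          case 1
          then have "\<not> (x = a \<and> y = c)" using ord by auto
          then show ?thesis using same[of x y] dC[of x y] CL[of x] CL[of y] xy(3) 1 by blast
        next
          case 2
          then show ?thesis using dp xy(3) by (auto simp: dec_chain_def)
        next
          case 3
          then have "i + 2 < p x" using shape2[of x] by force
          moreover have "p y \<le> i + 2" using shape[of y] 3 abc ord by (cases "y = c"; cases "y = a") auto
          ultimately show ?thesis by simp
        qed
      qed
      moreover have "dec_chain p X2"
        unfolding dec_chain_def
      proof (intro ballI impI)
        fix x y assume xy: "x \<in> X2" "y \<in> X2" "x < y"
        consider "x \<in> C" "y \<in> C" "y \<le> a" | "x \<in> C2" "y \<in> C2" | "x \<in> C" "x \<le> a" "y \<in> C2" "b < y"
          using xy ord by (auto simp: X2_def)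
        then show "p y < p x"
        proof cases
          case 1
          then have "\<not> (x = a \<and> y = c)" using ord by auto
          then show ?thesis using same[of x y] dC[of x y] CL[of x] CL[of y] xy(3) 1 by blast
        next
          case 2
          then show ?thesis using dp xy(3) by (auto simp: dec_chain_def)
        next
          case 3
          then have "p y < i" using shape2[of y] by force
          moreover have "i \<le> p x" using shape[of x] 3 abc ord by (cases "x = a"; cases "x = c") auto
          ultimately show ?thesis by simp
        qed
      qed
      moreover have "X1 \<subseteq> S" "X2 \<subseteq> S" using C(1) C2(1) ord by (auto simp: X1_def X2_def)
      ultimately have le: "card X1 \<le> k" "card X2 \<le> k" using sg by auto
      have eqC: "C = {z \<in> C. c \<le> z} \<union> {z \<in> C. z \<le> a}"
        using shape by (force simp: less_imp_le)
      have cC: "card C = card ({z \<in> C. c \<le> z} \<union> {z \<in> C. z \<le> a})"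
        by (rule arg_cong[OF eqC])
      have 1: "\<not> (c \<le> z \<and> z \<le> a)" for z
        using ord by (auto dest: order.strict_trans1 order.strict_trans2 order.strict_trans order.trans)
      have 2: "\<not> (c \<le> z \<and> z < b)" for z
        using ord by (auto dest: order.strict_trans1 order.strict_trans2 order.strict_trans order.trans)
      have 3: "\<not> (b < z \<and> z \<le> a)" for z
        using ord by (auto dest: order.strict_trans1 order.strict_trans2 order.strict_trans order.trans)
      have 4: "\<not> (z < b \<and> b < z)" for z by auto
      have "card ({z \<in> C. c \<le> z} \<union> {z \<in> C. z \<le> a}) = card {z \<in> C. c \<le> z} + card {z \<in> C. z \<le> a}"
        using fin(1) fin(1) 1 by (rule card_Un_filters)
      with cC have c1: "card C = card {z \<in> C. c \<le> z} + card {z \<in> C. z \<le> a}" by (rule trans)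
      have "C2 - {b} = {z \<in> C2. z < b} \<union> {z \<in> C2. b < z}" by auto
      then have "card C2 = Suc (card ({z \<in> C2. z < b} \<union> {z \<in> C2. b < z}))"
        using card_Suc_Diff1[OF fin(2) True] by simp
      also have "card ({z \<in> C2. z < b} \<union> {z \<in> C2. b < z}) = card {z \<in> C2. z < b} + card {z \<in> C2. b < z}"
        using fin(2) fin(2) 4 by (rule card_Un_filters)
      finally have c2: "card C2 = Suc (card {z \<in> C2. z < b} + card {z \<in> C2. b < z})" .
      have "card X1 = card {z \<in> C. c \<le> z} + card {z \<in> C2. z < b}"
        unfolding X1_def using fin(1) fin(2) 2 by (rule card_Un_filters)
      moreover have "card X2 = card {z \<in> C2. b < z} + card {z \<in> C. z \<le> a}"
        unfolding X2_def using fin(2) fin(1) 3 by (rule card_Un_filters)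
      ultimately show ?thesis using c1 c2 le C(3) by linarith
    qed
  qed
  then show ?thesis using d ac bS C(1) by blast
qed simp

text \<open>
One direction is monotonicity, as the only pair of letters whose order changes is \<open>a, c\<close>; the other
one is the exchange of a letter in an optimal set. Cutting off the letters above \<open>j\<close> is harmless
because \<open>b\<close> lies below \<open>c\<close>, so that the exchanged letter survives if \<open>c\<close> does.
\<close>

lemma greene_exchange:
  fixes a b c :: "'a::linorder" and p p' :: "'a \<Rightarrow> nat"
  assumes L: "finite L" "a \<in> L" "b \<in> L" "c \<in> L" and ord: "a < b" "b < c"
    and abc: "p ` {a, b, c} \<subseteq> {i..i+2}" "p' ` {a, b, c} \<subseteq> {i..i+2}"
    and other: "\<And>x. x \<in> L \<Longrightarrow> x \<notin> {a, b, c} \<Longrightarrow> p' x = p x \<and> (p x < i \<or> i + 2 < p x)"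
    and swap: "p a < p c" "p' c < p' a"
    and b: "p b < p a \<and> p' b < p' c \<or> p c < p b \<and> p' a < p' b"
  shows "greene p (L \<inter> {..j}) k = greene p' (L \<inter> {..j}) k"
proof (rule antisym)
  let ?A = "L \<inter> {..j}"
  have fin: "finite ?A" using L by simp
  show "greene p ?A k \<le> greene p' ?A k"
  proof (rule greene_leI[OF fin])
    fix S assume S: "S \<subseteq> ?A" "k_good p k S"
    have fS: "finite S" using S(1) fin by (rule finite_subset)
    have "k_good p' k S \<or> a \<in> S \<and> c \<in> S \<and> b \<notin> S \<and> (\<exists>d\<in>{a, c}. k_good p' k (insert b (S - {d})))"
      by (rule k_good_exchange[OF fS S(2) _ ord abc other swap b]) (use S(1) in auto)
    then show "card S \<le> greene p' ?A k"
    proof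
      assume "k_good p' k S"
      then show ?thesis by (rule greene_geI[OF fin S(1)])
    next
      assume *: "a \<in> S \<and> c \<in> S \<and> b \<notin> S \<and> (\<exists>d\<in>{a, c}. k_good p' k (insert b (S - {d})))"
      then obtain d where d: "d \<in> S" "k_good p' k (insert b (S - {d}))" by blast
      have "card (insert b (S - {d})) = card S" using * d(1) fS card_Suc_Diff1[of S d] by simp
      moreover have "insert b (S - {d}) \<subseteq> ?A" using S(1) * L(3) ord(2) by auto
      ultimately show ?thesis using greene_geI[OF fin _ d(2)] by metis
    qed
  qed
  show "greene p' ?A k \<le> greene p ?A k"
  proof (rule greene_mono[OF fin])
    fix x y assume xy: "x \<in> ?A" "y \<in> ?A" "x < y" "p y < p x"
    then show "p' y < p' x"
      using other[of x] other[of y] abc b swap ord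
      by (cases "x \<in> {a, b, c}"; cases "y \<in> {a, b, c}") auto
  qed
qed

definition pos :: "'a list \<Rightarrow> 'a \<Rightarrow> nat" where
  "pos w x = length (takeWhile (\<lambda>y. y \<noteq> x) w)"

lemma pos_nth: "distinct w \<Longrightarrow> i < length w \<Longrightarrow> pos w (w ! i) = i"
  unfolding pos_def
  by (subst takeWhile_eq_take_P_nth[of i]) (auto simp: nth_eq_iff_index_eq)

lemma pos_append: "pos (u @ v) x = (if x \<in> set u then pos u x else length u + pos v x)"
  by (auto simp: pos_def takeWhile_append)

lemma pos_less: "x \<in> set w \<Longrightarrow> pos w x < length w"
  by (induction w) (auto simp: pos_def)

lemma nth_pos: "x \<in> set w \<Longrightarrow> w ! pos w x = x"
  by (induction w) (auto simp: pos_def)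

inductive knuth_step :: "'a::linorder list \<Rightarrow> 'a list \<Rightarrow> bool" where
  bac: "a < b \<Longrightarrow> b < c \<Longrightarrow> knuth_step (u @ [b, a, c] @ v) (u @ [b, c, a] @ v)"
| acb: "a < b \<Longrightarrow> b < c \<Longrightarrow> knuth_step (u @ [a, c, b] @ v) (u @ [c, a, b] @ v)"

lemma knuth_step_mset: "knuth_step w w' \<Longrightarrow> mset w' = mset w"
  by (induction rule: knuth_step.induct) auto

lemma pos_triple:
  assumes "distinct (u @ [x, y, z] @ v)"
  shows "pos (u @ [x, y, z] @ v) x = length u" "pos (u @ [x, y, z] @ v) y = length u + 1"
    "pos (u @ [x, y, z] @ v) z = length u + 2"
    "t \<in> set (u @ [x, y, z] @ v) \<Longrightarrow> t \<notin> {x, y, z} \<Longrightarrow> pos (u @ [x, y, z] @ v) t =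
       (if t \<in> set u then pos u t else length u + 3 + pos v t)"
  using assms by (auto simp: pos_append pos_def takeWhile_append)

lemma knuth_step_greene:
  assumes "knuth_step w w'" "distinct w"
  shows "greene (pos w) (set w \<inter> {..j}) k = greene (pos w') (set w' \<inter> {..j}) k"
  using assms
proof (induction rule: knuth_step.induct)
  case (bac a b c u v)
  have d': "distinct (u @ [b, c, a] @ v)" using bac.prems by auto
  note P = pos_triple[OF bac.prems] pos_triple[OF d']
  have s: "set (u @ [b, c, a] @ v) = set (u @ [b, a, c] @ v)" by auto
  show ?case unfolding s
  proof (rule greene_exchange[of _ a b c _ "length u"])
    fix t assume "t \<in> set (u @ [b, a, c] @ v)" "t \<notin> {a, b, c}"
    then show "pos (u @ [b, c, a] @ v) t = pos (u @ [b, a, c] @ v) t \<and>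
        (pos (u @ [b, a, c] @ v) t < length u \<or> length u + 2 < pos (u @ [b, a, c] @ v) t)"
      using P(4)[of t] P(8)[of t] pos_less[of t u] by auto
  qed (use bac P(1-3) P(5-7) in auto)
next
  case (acb a b c u v)
  have d': "distinct (u @ [c, a, b] @ v)" using acb.prems by auto
  note P = pos_triple[OF acb.prems] pos_triple[OF d']
  have s: "set (u @ [c, a, b] @ v) = set (u @ [a, c, b] @ v)" by auto
  show ?case unfolding s
  proof (rule greene_exchange[of _ a b c _ "length u"])
    fix t assume "t \<in> set (u @ [a, c, b] @ v)" "t \<notin> {a, b, c}"
    then show "pos (u @ [c, a, b] @ v) t = pos (u @ [a, c, b] @ v) t \<and>
        (pos (u @ [a, c, b] @ v) t < length u \<or> length u + 2 < pos (u @ [a, c, b] @ v) t)"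
      using P(4)[of t] P(8)[of t] pos_less[of t u] by auto
  qed (use acb P(1-3) P(5-7) in auto)
qed

abbreviation knuth_eq :: "'a::linorder list \<Rightarrow> 'a list \<Rightarrow> bool" where
  "knuth_eq \<equiv> equivclp knuth_step"

lemma knuth_eq_invariant:
  assumes "knuth_eq w w'" "\<And>u v. knuth_step u v \<Longrightarrow> Q u \<longleftrightarrow> Q v"
  shows "Q w \<longleftrightarrow> Q w'"
  using assms(1) by (induction rule: equivclp_induct) (use assms(2) in blast)+

lemma knuth_eq_mset: "knuth_eq w w' \<Longrightarrow> mset w' = mset w"
  by (induction rule: equivclp_induct) (auto dest: knuth_step_mset)

lemma knuth_eq_greene:
  assumes "knuth_eq w w'" "distinct w"
  shows "greene (pos w) (set w \<inter> {..j}) k = greene (pos w') (set w' \<inter> {..j}) k"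
  using assms
proof (induction rule: equivclp_induct)
  case (step y z)
  have "distinct y" "distinct z"
    using step knuth_eq_mset[of w y] knuth_step_mset[of y z] knuth_step_mset[of z y]
    by (metis mset_eq_imp_distinct_iff)+
  then show ?case using step knuth_step_greene[of y z j k] knuth_step_greene[of z y j k] by auto
qed simp

lemma knuth_step_append: "knuth_step w w' \<Longrightarrow> knuth_step (x @ w @ y) (x @ w' @ y)"
proof (induction rule: knuth_step.induct)
  case (bac a b c u v)
  then show ?case using knuth_step.bac[of a b c "x @ u" "v @ y"] by simp
next
  case (acb a b c u v)
  then show ?case using knuth_step.acb[of a b c "x @ u" "v @ y"] by simp
qed

lemma knuth_eq_append: "knuth_eq w w' \<Longrightarrow> knuth_eq (x @ w @ y) (x @ w' @ y)"
proof (induction rule: equivclp_induct)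
  case (step z z')
  then have "knuth_eq (x @ z @ y) (x @ z' @ y)"
    using knuth_step_append by (metis r_into_equivclp equivclp_sym)
  then show ?case using step equivclp_trans by metis
qed simp

lemma knuth_eq_trans [trans]: "knuth_eq u v \<Longrightarrow> knuth_eq v w \<Longrightarrow> knuth_eq u w"
  by (rule equivclp_trans)

text \<open>
The small letter passes the letters of \<open>B\<close> one by one: next to \<open>b\<close> in \<open>B\<close> stands a smaller letter
\<open>m\<close>, and \<open>x < m < b\<close> allows the relation between \<open>m x b\<close> and \<open>m b x\<close>.
\<close>

lemma knuth_move_left:
  "x < y \<Longrightarrow> sorted_wrt (<) (y # B) \<Longrightarrow> knuth_eq (y # B @ [x]) (y # x # B)"
proof (induction B rule: rev_induct)
  case (snoc b B)
  obtain u m where m: "y # B = u @ [m]" by (metis append_butlast_last_id list.distinct(1))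
  have "m \<in> set (y # B)" unfolding m by simp
  then have "x < m" "m < b" using snoc.prems by (auto simp: sorted_wrt_append)
  then have "knuth_step (u @ [m, x, b]) (u @ [m, b, x])" using knuth_step.bac[of x m b u "[]"] by simp
  then have "knuth_eq ((y # B) @ [b, x]) ((y # B) @ [x, b])"
    unfolding m by (simp add: r_into_equivclp equivclp_sym)
  also have "knuth_eq ((y # B) @ [x, b]) ((y # x # B) @ [b])"
    using knuth_eq_append[of "y # B @ [x]" "y # x # B" "[]" "[b]"] snoc by (simp add: sorted_wrt_append)
  finally show ?case by simp
qed simp

text \<open>
The large letter passes the letters of \<open>A\<close> one by one, with the respective right neighbour \<open>x\<close> as
the letter of intermediate size.
\<close>

lemma knuth_move_front:
  "sorted_wrt (<) (A @ [x]) \<Longrightarrow> x < y \<Longrightarrow> knuth_eq (A @ [y, x]) (y # A @ [x])"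
proof (induction A arbitrary: x rule: rev_induct)
  case (snoc a A)
  then have ax: "a < x" "sorted_wrt (<) (A @ [a])" by (auto simp: sorted_wrt_append)
  then have "knuth_step (A @ [a, y, x]) (A @ [y, a, x])" using snoc.prems knuth_step.acb[of a x y A "[]"] by simp
  then have "knuth_eq ((A @ [a]) @ [y, x]) ((A @ [y, a]) @ [x])" by (simp add: r_into_equivclp)
  also have "knuth_eq ((A @ [y, a]) @ [x]) ((y # A @ [a]) @ [x])"
    using knuth_eq_append[OF snoc.IH[OF ax(2)], of "[]" "[x]"] snoc.prems(2) ax(1) by simp
  finally show ?case by simp
qed simp

lemma knuth_eq_bump:
  assumes "sorted_wrt (<) R" "x \<notin> set R" "ins_pos x R < length R"
  shows "knuth_eq (R @ [x]) (R ! ins_pos x R # R[ins_pos x R := x])"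
proof -
  define p where "p = ins_pos x R"
  have p: "p < length R" using assms by (simp add: p_def)
  define A y B where "A = take p R" and "y = R ! p" and "B = drop (Suc p) R"
  have R: "R = A @ y # B" unfolding A_def y_def B_def using p by (rule id_take_nth_drop)
  have xy: "x < y" using ins_pos_gt[OF assms(1,2) _ assms(3)] by (simp add: y_def p_def)
  have Ax: "a < x" if "a \<in> set A" for a
    using that ins_pos_less[of _ x R] p by (auto simp: A_def in_set_conv_nth p_def)
  have lA: "length A = p" using p by (simp add: A_def)
  have s: "sorted_wrt (<) (y # B)" "sorted_wrt (<) (A @ [x])"
    using assms(1) Ax unfolding R by (auto simp: sorted_wrt_append)
  have "knuth_eq (A @ (y # B @ [x])) (A @ (y # x # B))"
    using knuth_eq_append[OF knuth_move_left[OF xy s(1)], of A "[]"] by simp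
  also have "knuth_eq (A @ (y # x # B)) (y # A @ x # B)"
    using knuth_eq_append[OF knuth_move_front[OF s(2) xy], of "[]" B] by simp
  finally have "knuth_eq (R @ [x]) (y # A @ x # B)" by (simp add: R)
  moreover have "R[p := x] = A @ x # B" using lA by (simp add: R list_update_append)
  ultimately show ?thesis by (simp add: p_def y_def)
qed

text \<open>
The row reading word: the rows from bottom to top.
\<close>

definition reading :: "'a list list \<Rightarrow> 'a list" where
  "reading T = concat (rev T)"

lemma reading_Nil [simp]: "reading [] = []"
  and reading_Cons [simp]: "reading (R # T) = reading T @ R"
  by (simp_all add: reading_def)

text \<open>
One bump is a sequence of Knuth relations on the row concerned; the bumped letter then stands directly
behind the reading word of the lower rows, which is where the insertion goes on.
\<close>

lemma knuth_eq_row_ins: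
  "tableau T \<Longrightarrow> distinct (concat T) \<Longrightarrow> x \<notin> set (concat T) \<Longrightarrow>
   knuth_eq (reading T @ [x]) (reading (row_ins x T))"
proof (induction x T rule: row_ins.induct)
  case (2 x R T)
  show ?case
  proof (cases "ins_pos x R < length R")
    case True
    let ?p = "ins_pos x R"
    have R: "sorted_wrt (<) R" "x \<notin> set R" using "2.prems" by auto
    have y: "R ! ?p \<notin> set (concat T)" using nth_hd_notin[OF "2.prems"(2) True] .
    have "knuth_eq (reading T @ (R @ [x])) ((reading T @ [R ! ?p]) @ R[?p := x])"
      using knuth_eq_append[OF knuth_eq_bump[OF R True], of "reading T" "[]"] by simp
    also have "knuth_eq ((reading T @ [R ! ?p]) @ R[?p := x]) (reading (row_ins (R ! ?p) T) @ R[?p := x])"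
      using knuth_eq_append[OF "2.IH"[OF True _ _ y], of "[]" "R[?p := x]"] "2.prems" by simp
    finally show ?thesis using True by simp
  qed simp
qed simp

lemma knuth_eq_reading_P_tab: "distinct w \<Longrightarrow> knuth_eq w (reading (P_tab w))"
proof (induction w rule: rev_induct)
  case (snoc x w)
  then have "knuth_eq (w @ [x]) (reading (P_tab w) @ [x])"
    using knuth_eq_append[of w "reading (P_tab w)" "[]" "[x]"] by simp
  also have "knuth_eq (reading (P_tab w) @ [x]) (reading (row_ins x (P_tab w)))"
    using snoc.prems set_P_tab[of w]
    by (intro knuth_eq_row_ins) (simp_all only: tableau_P_tab distinct_P_tab distinct_append, auto)
  finally show ?case by simp
qed simp

lemma P_tab_eq_imp_knuth_eq:
  assumes "distinct w" "distinct w'" "P_tab w = P_tab w'"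
  shows "knuth_eq w w'"
  using knuth_eq_reading_P_tab[OF assms(1)] knuth_eq_reading_P_tab[OF assms(2)] assms(3)
  by (metis equivclp_sym equivclp_trans)

section \<open>Greene invariants of insertion tableaux\<close>

lemma tableau_col:
  "tableau T \<Longrightarrow> i < i' \<Longrightarrow> i' < length T \<Longrightarrow> c < length (T ! i') \<Longrightarrow>
   c < length (T ! i) \<and> T ! i ! c < T ! i' ! c"
proof (induction T arbitrary: i i')
  case (Cons R T)
  obtain m where m: "i' = Suc m" using Cons.prems(2) by (cases i') auto
  have R: "c < length R \<and> R ! c < T ! 0 ! c" if "c < length (T ! 0)" "T \<noteq> []"
    using Cons.prems(1) that by (cases T) auto
  have T: "tableau T" using Cons.prems(1) by simp
  show ?case
  proof (cases i)
    case (Suc l)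
    then show ?thesis using Cons.IH[OF T, of l m] Cons.prems m by simp
  next
    case 0
    show ?thesis
    proof (cases m)
      case 0
      then show ?thesis using R Cons.prems m \<open>i = 0\<close> by auto
    next
      case (Suc l)
      then have "c < length (T ! 0) \<and> T ! 0 ! c < T ! m ! c"
        using Cons.IH[OF T, of 0 m] Cons.prems m by simp
      moreover have "T \<noteq> []" using Cons.prems m by auto
      ultimately show ?thesis using R m 0 by auto
    qed
  qed
qed simp

lemma tableau_row: "tableau T \<Longrightarrow> i < length T \<Longrightarrow> sorted_wrt (<) (T ! i)"
  by (induction T arbitrary: i) (auto simp: nth_Cons split: nat.splits)

lemma set_reading: "set (reading T) = set (concat T)"
  by (induction T) auto

lemma mset_reading: "mset (reading T) = mset (concat T)"
  by (induction T) auto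

lemma nth_nth_in_concat: "i < length T \<Longrightarrow> c < length (T ! i) \<Longrightarrow> T ! i ! c \<in> set (concat T)"
  by (induction T arbitrary: i) (auto simp: nth_Cons split: nat.splits)

text \<open>
Reading order: lower rows come first, and a row is read from the left.
\<close>

lemma pos_reading:
  assumes "distinct (concat T)" "i < length T" "c < length (T ! i)" "i' < length T" "c' < length (T ! i')"
    "i < i' \<or> i = i' \<and> c' < c"
  shows "pos (reading T) (T ! i' ! c') < pos (reading T) (T ! i ! c)"
  using assms
proof (induction T arbitrary: i i')
  case (Cons R T)
  have hd: "pos (reading (R # T)) (R ! c) = length (reading T) + c" if "c < length R" for c
  proof -
    have "R ! c \<notin> set (reading T)" using nth_hd_notin[OF Cons.prems(1) that] set_reading[of T] by blast
    then show ?thesis using that Cons.prems(1) by (simp add: pos_append pos_nth)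
  qed
  have tl: "pos (reading (R # T)) (T ! i ! c) = pos (reading T) (T ! i ! c) \<and>
      pos (reading T) (T ! i ! c) < length (reading T)" if "i < length T" "c < length (T ! i)" for i c
  proof -
    have "T ! i ! c \<in> set (reading T)" using nth_nth_in_concat[OF that] set_reading[of T] by blast
    then show ?thesis by (simp add: pos_append pos_less)
  qed
  have d: "distinct (concat T)" using Cons.prems(1) by simp
  show ?case
  proof (cases i)
    case 0
    show ?thesis
    proof (cases i')
      case 0
      then show ?thesis using hd[of c] hd[of c'] Cons.prems \<open>i = 0\<close> by auto
    next
      case (Suc m)
      then show ?thesis using hd[of c] tl[of m c'] Cons.prems 0 by simp
    qed
  next
    case (Suc l)
    then obtain m where "i' = Suc m" using Cons.prems(6) by (cases i') auto
    then show ?thesis using Cons.IH[OF d, of l m] tl[of l c] tl[of m c'] Cons.prems Suc by simp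
  qed
qed simp

definition entries :: "'a list list \<Rightarrow> (nat \<times> nat) set" where
  "entries T = {(i, c). i < length T \<and> c < length (T ! i)}"

lemma finite_entries: "finite (entries T)"
proof -
  have "entries T = Sigma {..<length T} (\<lambda>i. {..<length (T ! i)})" by (auto simp: entries_def)
  then show ?thesis by simp
qed

lemma inj_on_entries:
  assumes "distinct (concat T)"
  shows "inj_on (\<lambda>(i, c). T ! i ! c) (entries T)"
proof (rule inj_onI, clarify)
  fix i c i' c'
  assume *: "(i, c) \<in> entries T" "(i', c') \<in> entries T" "T ! i ! c = T ! i' ! c'"
  show "i = i' \<and> c = c'"
  proof (rule ccontr)
    assume "\<not> (i = i' \<and> c = c')"
    then consider "i < i' \<or> i = i' \<and> c' < c" | "i' < i \<or> i' = i \<and> c < c'" by linarith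
    then show False
      by cases (use pos_reading[OF assms, of i c i' c'] pos_reading[OF assms, of i' c' i c] * in
        \<open>auto simp: entries_def\<close>)
  qed
qed

lemma set_concat_take:
  "set (concat (take k T)) = (\<lambda>(i, c). T ! i ! c) ` {v \<in> entries T. fst v < k}"
proof
  show "set (concat (take k T)) \<subseteq> (\<lambda>(i, c). T ! i ! c) ` {v \<in> entries T. fst v < k}"
  proof
    fix x assume "x \<in> set (concat (take k T))"
    then obtain R where "R \<in> set (take k T)" "x \<in> set R" by auto
    then obtain i c where "i < length T" "i < k" "c < length (T ! i)" "x = T ! i ! c"
      by (auto simp: in_set_conv_nth)
    then show "x \<in> (\<lambda>(i, c). T ! i ! c) ` {v \<in> entries T. fst v < k}"
      by (intro image_eqI[of _ _ "(i, c)"]) (auto simp: entries_def)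
  qed
  show "(\<lambda>(i, c). T ! i ! c) ` {v \<in> entries T. fst v < k} \<subseteq> set (concat (take k T))"
  proof clarify
    fix i c assume "(i, c) \<in> entries T" "fst (i, c) < k"
    then have i: "i < length T" "c < length (T ! i)" "i < k" by (auto simp: entries_def)
    have "T ! i \<in> set (take k T)" unfolding in_set_conv_nth using i by (intro exI[of _ i]) simp
    moreover have "T ! i ! c \<in> set (T ! i)" using i by simp
    ultimately show "T ! i ! c \<in> set (concat (take k T))" by auto
  qed
qed

lemma set_concat_entries: "set (concat T) = (\<lambda>(i, c). T ! i ! c) ` entries T"
proof -
  have "{v \<in> entries T. fst v < length T} = entries T" by (auto simp: entries_def)
  then show ?thesis using set_concat_take[of "length T" T] by simp
qed

lemma finite_column: "finite B \<Longrightarrow> finite {i. (i, c) \<in> B}"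
  by (rule finite_subset[of _ "fst ` B"]) (auto intro: rev_image_eqI)

lemma card_columns:
  assumes "finite B"
  shows "card B = (\<Sum>c\<in>snd ` B. card {i. (i, c) \<in> B})"
proof -
  have "B = prod.swap ` Sigma (snd ` B) (\<lambda>c. {i. (i, c) \<in> B})" by force
  then have "card B = card (Sigma (snd ` B) (\<lambda>c. {i. (i, c) \<in> B}))"
    by (metis card_image inj_on_subset inj_swap subset_UNIV)
  also have "\<dots> = (\<Sum>c\<in>snd ` B. card {i. (i, c) \<in> B})"
    using assms by (intro card_SigmaI) (auto intro: finite_column)
  finally show ?thesis .
qed

text \<open>
Greene's theorem for a reading word. A column is read upwards and hence is a decreasing subsequence, so a
good set has at most \<open>k\<close> letters in each column and can be pushed up into the first \<open>k\<close> rows.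
Conversely, the first \<open>k\<close> rows are increasing subsequences, and a decreasing one meets each
of them at most once.
\<close>

lemma greene_reading:
  assumes T: "tableau T" "distinct (concat T)"
  shows "greene (pos (reading T)) (set (concat T) \<inter> {..j}) k = card {x \<in> set (concat (take k T)). x \<le> j}"
proof (rule antisym)
  let ?p = "pos (reading T)" let ?A = "set (concat T) \<inter> {..j}"
  let ?e = "\<lambda>(i, c). T ! i ! c"
  note inj = inj_on_entries[OF T(2)]
  define Y where "Y = {v \<in> entries T. fst v < k \<and> ?e v \<le> j}"
  have Y: "{x \<in> set (concat (take k T)). x \<le> j} = ?e ` Y"
    unfolding set_concat_take Y_def by auto
  have finY: "finite Y" unfolding Y_def by (rule finite_subset[OF _ finite_entries[of T]]) auto
  have cardY: "card {x \<in> set (concat (take k T)). x \<le> j} = card Y"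
    unfolding Y by (rule card_image) (rule inj_on_subset[OF inj], auto simp: Y_def)
  show "greene ?p ?A k \<le> card {x \<in> set (concat (take k T)). x \<le> j}"
    unfolding cardY
  proof (rule greene_leI)
    fix S assume S: "S \<subseteq> ?A" "k_good ?p k S"
    define B where "B = {v \<in> entries T. ?e v \<in> S}"
    have XE: "B \<subseteq> entries T" by (auto simp: B_def)
    have finB: "finite B" using XE finite_entries by (rule finite_subset)
    have "S = ?e ` B" using S(1) set_concat_entries[of T] by (auto simp: B_def)
    then have "card S = card B" using card_image[OF inj_on_subset[OF inj XE]] by simp
    also have "card B = (\<Sum>c\<in>snd ` B. card {i. (i, c) \<in> B})" by (rule card_columns[OF finB])
    also have "\<dots> \<le> (\<Sum>c\<in>snd ` B. card {i. (i, c) \<in> Y})"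
    proof (rule sum_mono)
      fix c
      let ?B = "{i. (i, c) \<in> B}" let ?Y = "{i. (i, c) \<in> Y}"
      have finYc: "finite ?Y" using finY by (rule finite_column)
      have finBc: "finite ?B" using finB by (rule finite_column)
      \<comment> \<open>Either the letters of \<open>S\<close> in this column lie in the first \<open>k\<close> rows, or one of them stands lower and the first \<open>k\<close> entries above it are all at most \<open>j\<close>.\<close>
      show "card ?B \<le> card ?Y"
      proof (cases "?B \<subseteq> {..<k}")
        case True
        then have "?B \<subseteq> ?Y" using S(1) by (auto simp: B_def Y_def)
        then show ?thesis by (rule card_mono[OF finYc])
      next
        case False
        then obtain i0 where i0: "(i0, c) \<in> B" "k \<le> i0" unfolding subset_iff lessThan_iff mem_Collect_eq not_all not_imp not_less by blast
        have "{..<k} \<subseteq> ?Y"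
        proof
          fix i assume "i \<in> {..<k}"
          then have "i < i0" using i0 by simp
          moreover have "T ! i0 ! c \<le> j" using i0 S(1) by (auto simp: B_def)
          ultimately show "i \<in> ?Y"
            using tableau_col[OF T(1), of i i0 c] i0 \<open>i \<in> {..<k}\<close> by (auto simp: B_def Y_def entries_def)
        qed
        then have "k \<le> card ?Y" using card_mono[OF finYc, of "{..<k}"] by simp
        moreover have "card ?B \<le> k"
        proof -
          have injc: "inj_on (\<lambda>i. T ! i ! c) ?B"
          proof (rule inj_onI)
            fix i i' assume "i \<in> ?B" "i' \<in> ?B" "T ! i ! c = T ! i' ! c"
            then show "i = i'" using inj_onD[OF inj, of "(i, c)" "(i', c)"] XE by auto
          qed
          have "dec_chain ?p ((\<lambda>i. T ! i ! c) ` ?B)"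
            unfolding dec_chain_def
          proof (clarify)
            fix i i' assume ii: "(i, c) \<in> B" "(i', c) \<in> B" "T ! i ! c < T ! i' ! c"
            then have "i < i'"
              using tableau_col[OF T(1), of i' i c] by (cases i i' rule: linorder_cases) (auto simp: B_def entries_def)
            then show "?p (T ! i' ! c) < ?p (T ! i ! c)"
              using pos_reading[OF T(2), of i c i' c] ii by (auto simp: B_def entries_def)
          qed
          moreover have "(\<lambda>i. T ! i ! c) ` ?B \<subseteq> S" by (auto simp: B_def)
          ultimately have "card ((\<lambda>i. T ! i ! c) ` ?B) \<le> k" using S(2) by (simp add: k_good_def)
          then show ?thesis using card_image[OF injc] by simp
        qed
        ultimately show ?thesis by simp
      qed
    qed
    also have "\<dots> \<le> (\<Sum>c\<in>snd ` (B \<union> Y). card {i. (i, c) \<in> Y})"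
      by (rule sum_mono2) (use finB finY in auto)
    also have "\<dots> = (\<Sum>c\<in>snd ` Y. card {i. (i, c) \<in> Y})"
    proof (rule sum.mono_neutral_right)
      show "\<forall>c\<in>snd ` (B \<union> Y) - snd ` Y. card {i. (i, c) \<in> Y} = 0"
      proof
        fix c assume "c \<in> snd ` (B \<union> Y) - snd ` Y"
        then have "{i. (i, c) \<in> Y} = {}" by force
        then show "card {i. (i, c) \<in> Y} = 0" by simp
      qed
    qed (use finB finY in auto)
    also have "\<dots> = card Y" by (rule card_columns[OF finY, symmetric])
    finally show "card S \<le> card Y" .
  qed simp
  show "card {x \<in> set (concat (take k T)). x \<le> j} \<le> greene ?p ?A k"
  proof (rule greene_geI)
    show "k_good ?p k {x \<in> set (concat (take k T)). x \<le> j}"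
      unfolding k_good_def Y
    proof (intro allI impI)
      fix C assume C: "C \<subseteq> ?e ` Y" "dec_chain ?p C"
      then obtain D where D: "D \<subseteq> Y" "C = ?e ` D" by (auto simp: subset_image_iff)
      have DE: "D \<subseteq> entries T" using D(1) by (auto simp: Y_def)
      \<comment> \<open>A decreasing chain contains at most one letter of each row.\<close>
      have "inj_on fst D"
      proof (rule inj_onI, rule ccontr)
        fix v v' assume v: "v \<in> D" "v' \<in> D" "fst v = fst v'" "v \<noteq> v'"
        have bad: False if "(i, c) \<in> D" "(i, c') \<in> D" "c < c'" for i c c'
        proof -
          have i: "i < length T" "c < length (T ! i)" "c' < length (T ! i)" using that DE by (auto simp: entries_def)
          have "T ! i ! c < T ! i ! c'" using tableau_row[OF T(1) i(1)] that(3) i(3) by (simp add: sorted_wrt_iff_nth_less)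
          then have "?p (T ! i ! c') < ?p (T ! i ! c)"
            using C(2) D(2) that unfolding dec_chain_def by force
          moreover have "?p (T ! i ! c) < ?p (T ! i ! c')" using pos_reading[OF T(2), of i c' i c] i that(3) by simp
          ultimately show False by simp
        qed
        show False using v bad[of "fst v" "snd v" "snd v'"] bad[of "fst v" "snd v'" "snd v"]
          by (metis linorder_neqE_nat prod.collapse)
      qed
      moreover have "fst ` D \<subseteq> {..<k}" using D(1) by (auto simp: Y_def)
      ultimately have "card D \<le> k" by (metis card_image card_lessThan card_mono finite_lessThan)
      then show "card C \<le> k" using D(2) card_image[OF inj_on_subset[OF inj DE]] by simp
    qed
    show "{x \<in> set (concat (take k T)). x \<le> j} \<subseteq> ?A"
      using set_concat_take[of k T] set_concat_entries[of T] by auto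
  qed simp
qed

text \<open>
Total in \<open>r\<close>, so that tableaux can be compared row by row before their numbers of rows are known to
agree.
\<close>

definition row_set :: "'a list list \<Rightarrow> nat \<Rightarrow> 'a set" where
  "row_set T r = (if r < length T then set (T ! r) else {})"

lemma card_take_Suc:
  assumes "distinct (concat T)"
  shows "card {x \<in> set (concat (take (Suc r) T)). Q x}
       = card {x \<in> set (concat (take r T)). Q x} + card {x \<in> row_set T r. Q x}"
proof (cases "r < length T")
  case True
  have "distinct (concat (take (Suc r) T))"
    using assms by (metis append_take_drop_id concat_append distinct_append)
  then have "set (concat (take r T)) \<inter> set (T ! r) = {}"
    using True by (simp add: take_Suc_conv_app_nth)
  moreover have "{x \<in> set (concat (take (Suc r) T)). Q x} = {x \<in> set (concat (take r T)). Q x} \<union> {x \<in> set (T ! r). Q x}"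
    using True by (auto simp: take_Suc_conv_app_nth)
  ultimately show ?thesis using True
    by (simp add: row_set_def) (rule card_Un_disjoint, auto)
next
  case False
  then show ?thesis by (simp add: row_set_def)
qed

lemma finite_row_set: "finite (row_set T r)"
  by (simp add: row_set_def)

lemma row_set_nonempty: "tableau T \<Longrightarrow> row_set T r \<noteq> {} \<longleftrightarrow> r < length T"
  using tableau_nonempty[of T] by (auto simp: row_set_def dest: nth_mem)

lemma tableau_eqI:
  assumes "tableau T" "tableau T'" "\<And>r. row_set T r = row_set T' r"
  shows "T = T'"
proof (rule nth_equalityI)
  have "r < length T \<longleftrightarrow> r < length T'" for r
    using row_set_nonempty[OF assms(1)] row_set_nonempty[OF assms(2)] assms(3) by metis
  then show len: "length T = length T'" by (metis linorder_neqE_nat order_less_irrefl)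
  fix r assume r: "r < length T"
  then have "set (T ! r) = set (T' ! r)" using assms(3)[of r] len by (simp add: row_set_def)
  moreover have "sorted_wrt (<) (T ! r)" "sorted_wrt (<) (T' ! r)"
    using tableau_row[OF assms(1)] tableau_row[OF assms(2)] r len by auto
  ultimately show "T ! r = T' ! r" by (metis strict_sorted_equal)
qed

lemma length_tableau_le: "tableau T \<Longrightarrow> length T \<le> length (concat T)"
proof (induction T)
  case (Cons R T)
  then show ?case by (cases R) auto
qed simp

text \<open>
Consecutive values of \<open>k\<close> give the number of entries at most \<open>j\<close> in each single row. If two tableaux
had different rows, the smallest letter in which these differ would be counted differently.
\<close>

lemma tableau_determined:
  assumes T: "tableau T" "distinct (concat T)" and T': "tableau T'" "distinct (concat T')"
    and L: "set (concat T) = L" "set (concat T') = L"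
    and eq: "\<And>j k. j \<in> L \<Longrightarrow> k \<le> card L \<Longrightarrow>
      card {x \<in> set (concat (take k T)). x \<le> j} = card {x \<in> set (concat (take k T')). x \<le> j}"
  shows "T = T'"
proof (rule tableau_eqI[OF T(1) T'(1)])
  fix r
  have sub: "row_set U r \<subseteq> set (concat U)" for U :: "'a list list"
    by (auto simp: row_set_def dest: nth_mem)
  show "row_set T r = row_set T' r"
  proof (cases "r < card L")
    case False
    have "length T \<le> card L" "length T' \<le> card L"
      using length_tableau_le[OF T(1)] length_tableau_le[OF T'(1)] L distinct_card[OF T(2)] distinct_card[OF T'(2)] by auto
    then show ?thesis using False by (simp add: row_set_def)
  next
    case True
    have cnt: "card {x \<in> row_set T r. x \<le> j} = card {x \<in> row_set T' r. x \<le> j}" if "j \<in> L" for j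
      using eq[OF that, of r] eq[OF that, of "Suc r"] True
        card_take_Suc[OF T(2), of r "\<lambda>x. x \<le> j"] card_take_Suc[OF T'(2), of r "\<lambda>x. x \<le> j"] by simp
    define D where "D = (row_set T r - row_set T' r) \<union> (row_set T' r - row_set T r)"
    have fD: "finite D" by (simp add: D_def finite_row_set)
    have "D = {}"
    proof (rule ccontr)
      assume "D \<noteq> {}"
      define m where "m = Min D"
      have m: "m \<in> D" "\<And>y. y \<in> D \<Longrightarrow> m \<le> y" using fD \<open>D \<noteq> {}\<close> by (auto simp: m_def)
      have mL: "m \<in> L" using m(1) sub[of T] sub[of T'] L by (auto simp: D_def)
      have lt: "{x \<in> row_set T r. x < m} = {x \<in> row_set T' r. x < m}"
        using m(2) by (force simp: D_def)
      have fin: "finite {x \<in> row_set U r. x < m}" for U using finite_row_set[of U r] by simp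
      have le: "card {x \<in> row_set U r. x \<le> m} =
          (if m \<in> row_set U r then Suc (card {x \<in> row_set U r. x < m}) else card {x \<in> row_set U r. x < m})" for U
      proof (cases "m \<in> row_set U r")
        case True
        then have "{x \<in> row_set U r. x \<le> m} = insert m {x \<in> row_set U r. x < m}" by auto
        then show ?thesis using True fin by simp
      next
        case False
        then have "{x \<in> row_set U r. x \<le> m} = {x \<in> row_set U r. x < m}" by (auto simp: less_le)
        then show ?thesis using False by simp
      qed
      show False using cnt[OF mL] m(1) unfolding le lt by (auto simp: D_def split: if_splits)
    qed
    then show ?thesis by (auto simp: D_def)
  qed
qed

text \<open>
The restriction to letters at most \<open>j\<close> is the refinement of the Greene shape that sees the
entries of the insertion tableau and not only its row lengths.
\<close>

definition greene_key :: "'a::linorder list \<Rightarrow> 'a \<Rightarrow> nat \<Rightarrow> nat" where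
  "greene_key w j k = greene (pos w) (set w \<inter> {..j}) k"

text \<open>
A word is Knuth equivalent to the reading word of its insertion tableau, and Knuth relations preserve the
Greene invariants.
\<close>

lemma greene_key_P_tab:
  assumes "distinct w"
  shows "greene_key w j k = card {x \<in> set (concat (take k (P_tab w))). x \<le> j}"
proof -
  have T: "tableau (P_tab w)" "distinct (concat (P_tab w))"
    using assms by (simp_all only: tableau_P_tab distinct_P_tab)
  have "greene_key w j k = greene (pos (reading (P_tab w))) (set (reading (P_tab w)) \<inter> {..j}) k"
    unfolding greene_key_def by (rule knuth_eq_greene[OF knuth_eq_reading_P_tab[OF assms] assms])
  then show ?thesis using greene_reading[OF T] by (simp only: set_reading)
qed

lemma P_tab_eqI:
  assumes "distinct w" "distinct w'" "set w = L" "set w' = L"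
    "\<And>j k. j \<in> L \<Longrightarrow> k \<le> card L \<Longrightarrow> greene_key w j k = greene_key w' j k"
  shows "P_tab w = P_tab w'"
proof (rule tableau_determined)
  show "tableau (P_tab w)" "tableau (P_tab w')" using assms(1,2) by (simp_all only: tableau_P_tab)
  show "distinct (concat (P_tab w))" "distinct (concat (P_tab w'))"
    using assms(1,2) by (simp_all only: distinct_P_tab)
  show "set (concat (P_tab w)) = L" "set (concat (P_tab w')) = L"
    using assms(3,4) by (simp_all only: set_P_tab)
  show "card {x \<in> set (concat (take k (P_tab w))). x \<le> j} = card {x \<in> set (concat (take k (P_tab w'))). x \<le> j}"
    if "j \<in> L" "k \<le> card L" for j k
    using assms(5)[OF that] unfolding greene_key_P_tab[OF assms(1)] greene_key_P_tab[OF assms(2)] .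
qed

section \<open>Knuth classes and Schur functions\<close>

lemma diagram_shape: "diagram (map length T) [] = cells T"
  by (auto simp: diagram_def part_def cells_eq split: if_splits)

lemma card_cells: "card (cells T) = length (concat T)"
proof (induction T)
  case (Cons R T)
  have "card (cells (R # T)) = card (Pair (1::nat) ` {1..length R}) + card (apfst Suc ` cells T)"
    using cells_pos[of 0 _ T] finite_cells[of T] by (auto intro!: card_Un_disjoint)
  moreover have "card (Pair (1::nat) ` {1..length R}) = length R" by (simp add: card_image inj_on_def)
  moreover have "card (apfst Suc ` cells T) = card (cells T)"
    by (intro card_image inj_on_subset[OF apfst_Suc_inj]) simp
  ultimately show ?case using Cons by simp
qed simp

text \<open>
Extends the condition on neighbouring positions to all pairs of positions on which the sorted
sequence \<open>xs\<close> has the same value.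
\<close>

lemma columns_increase_on_plateau:
  assumes "sorted xs" "\<And>k. Suc k < length b \<Longrightarrow> xs ! k = xs ! Suc k \<Longrightarrow> snd (b ! k) < (snd (b ! Suc k) :: nat)"
    "length xs = length b" "p < q" "q < length b" "xs ! p = xs ! q"
  shows "snd (b ! p) < snd (b ! q)"
  using assms(4-)
proof (induction q)
  case (Suc q)
  have le: "xs ! p \<le> xs ! q" "xs ! q \<le> xs ! Suc q"
    using sorted_nth_mono[OF assms(1), of p q] sorted_nth_mono[OF assms(1), of q "Suc q"] Suc.prems assms(3) by simp_all
  then have eq: "xs ! q = xs ! Suc q" "xs ! p = xs ! q" using Suc.prems(3) by auto
  have s: "snd (b ! q) < snd (b ! Suc q)" using assms(2)[OF _ eq(1)] Suc.prems by simp
  show ?case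
  proof (cases "p = q")
    case False
    then show ?thesis using Suc.IH Suc.prems eq(2) s by simp
  qed (use s in simp)
qed simp

text \<open>
Standardization order of the boxes of a semistandard tableau: by entry, and from left to right among
equal entries. Equal entries lie in different columns, so no two boxes tie.
\<close>

definition std_key :: "(nat \<times> nat \<Rightarrow> nat) \<Rightarrow> nat \<times> nat \<Rightarrow> nat \<times> nat" where
  "std_key F v = (F v, snd v)"

text \<open>
Standardization of semistandard tableaux with content \<open>xs\<close>. A sequence \<open>b\<close> of boxes becomes a
filling by writing \<open>xs ! k\<close> into the box \<open>b ! k\<close>; conversely a semistandard tableau orders its boxes by
\<open>std_key\<close>. The condition on equal neighbours of \<open>xs\<close> says that equal entries are filled
in from left to right, which is what keeps them out of a common column.
\<close>

lemma card_lin_exts_eq_card_ssyt: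
  assumes T: "tableau T" and xs: "sorted xs" "0 \<notin> set xs" "length xs = length (concat T)"
  shows "card {b. lin_ext b (cells T) \<and>
             (\<forall>k. Suc k < length b \<longrightarrow> xs ! k = xs ! Suc k \<longrightarrow> snd (b ! k) < snd (b ! Suc k))}
       = card {F \<in> ssyt (map length T). image_mset F (mset_set (diagram (map length T) [])) = mset xs}"
    (is "card ?B = card ?S")
proof -
  define \<Lambda> where "\<Lambda> = cells T"
  have fin: "finite \<Lambda>" by (simp add: \<Lambda>_def finite_cells)
  have len: "length b = length xs" if "lin_ext b \<Lambda>" for b
    using that xs(3) card_cells[of T] distinct_card[of b] by (simp add: lin_ext_def \<Lambda>_def)
  define \<Phi> where "\<Phi> b = restrict (\<lambda>v. xs ! pos b v) \<Lambda>" for b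
  have key_sorted: "sorted_wrt (<) (map (std_key (\<Phi> b)) b)" if b: "b \<in> ?B" for b
  proof (rule iffD2[OF sorted_wrt_map], rule iffD2[OF sorted_wrt_iff_nth_less], intro allI impI)
    fix p q assume pq: "p < q" "q < length b"
    have lb: "lin_ext b \<Lambda>" using b by (simp add: \<Lambda>_def)
    have d: "distinct b" "set b = \<Lambda>" using lb by (auto simp: lin_ext_def)
    have \<Phi>: "\<Phi> b (b ! k) = xs ! k" if "k < length b" for k
      using that d by (auto simp: \<Phi>_def pos_nth)
    have "xs ! p \<le> xs ! q" using pq len[OF lb] xs(1) by (auto intro!: sorted_nth_mono)
    moreover have "snd (b ! p) < snd (b ! q)" if "xs ! p = xs ! q"
      by (rule columns_increase_on_plateau[OF xs(1) _ len[OF lb, symmetric] pq that]) (use b in auto)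
    ultimately have "xs ! p < xs ! q \<or> xs ! p = xs ! q \<and> snd (b ! p) < snd (b ! q)" by linarith
    then show "std_key (\<Phi> b) (b ! p) < std_key (\<Phi> b) (b ! q)"
      using \<Phi>[of p] \<Phi>[of q] pq by (auto simp: std_key_def less_prod_def)
  qed
  have "bij_betw \<Phi> ?B ?S"
    unfolding bij_betw_def
  proof
    show "inj_on \<Phi> ?B"
    proof (rule inj_onI)
      fix b b' assume b: "b \<in> ?B" "b' \<in> ?B" and eq: "\<Phi> b = \<Phi> b'"
      have s: "set b = \<Lambda>" "set b' = \<Lambda>" using b by (auto simp: lin_ext_def \<Lambda>_def)
      have m: "map (std_key (\<Phi> b)) b = map (std_key (\<Phi> b)) b'"
        by (rule strict_sorted_equal) (use key_sorted[OF b(1)] key_sorted[OF b(2)] eq s in auto)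
      have "inj_on (std_key (\<Phi> b)) \<Lambda>"
        using key_sorted[OF b(1)] strict_sorted_iff[of "map (std_key (\<Phi> b)) b"] s(1)
        by (simp add: distinct_map)
      then show "b = b'" using m s map_inj_on[of "std_key (\<Phi> b)" b b'] by simp
    qed
    have "\<Phi> b \<in> ?S" if b: "b \<in> ?B" for b
    proof -
      have lb: "lin_ext b \<Lambda>" using b by (simp add: \<Lambda>_def)
      have d: "distinct b" "set b = \<Lambda>" using lb by (auto simp: lin_ext_def)
      have pl: "pos b v < length xs" "b ! pos b v = v" if "v \<in> \<Lambda>" for v
        using that d pos_less[of v b] nth_pos[of v b] len[OF lb] by auto
      have le: "pos b u \<le> pos b v" if "u \<in> \<Lambda>" "v \<in> \<Lambda>" "fst u \<le> fst v" "snd u \<le> snd v" for u v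
        using lb that pl[of u] pl[of v] len[OF lb] unfolding lin_ext_def by (metis (no_types, lifting))
      have mono: "\<Phi> b u \<le> \<Phi> b v" if "u \<in> \<Lambda>" "v \<in> \<Lambda>" "fst u \<le> fst v" "snd u \<le> snd v" for u v
        using le[OF that] pl[of v] that xs(1) by (auto simp: \<Phi>_def intro!: sorted_nth_mono)
      have strict: "\<Phi> b u < \<Phi> b v" if "u \<in> \<Lambda>" "v \<in> \<Lambda>" "fst u < fst v" "snd u = snd v" for u v
      proof (rule ccontr)
        assume "\<not> \<Phi> b u < \<Phi> b v"
        then have eq: "xs ! pos b u = xs ! pos b v" using mono[of u v] that by (simp add: \<Phi>_def)
        have "pos b u \<noteq> pos b v" using pl(2)[OF that(1)] pl(2)[OF that(2)] that(3) by (metis less_irrefl)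
        then have "pos b u < pos b v" using le[of u v] that by simp
        then have "snd (b ! pos b u) < snd (b ! pos b v)"
          using columns_increase_on_plateau[OF xs(1) _ len[OF lb, symmetric] _ _ eq] b pl(1)[OF that(2)] len[OF lb] by simp
        then show False unfolding pl(2)[OF that(1)] pl(2)[OF that(2)] using that(4) by simp
      qed
      have "\<Phi> b \<in> \<Lambda> \<rightarrow>\<^sub>E {1..}"
      proof
        fix v assume "v \<in> \<Lambda>"
        then have "xs ! pos b v \<noteq> 0" using pl(1)[of v] xs(2) nth_mem by metis
        then show "\<Phi> b v \<in> {1..}" using \<open>v \<in> \<Lambda>\<close> by (simp add: \<Phi>_def)
      qed (simp add: \<Phi>_def)
      moreover have "image_mset (\<Phi> b) (mset_set \<Lambda>) = mset xs"
      proof -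
        have "mset_set \<Lambda> = mset b" using d mset_set_set by metis
        moreover have "map (\<Phi> b) b = xs"
          by (rule nth_equalityI) (use d len[OF lb] in \<open>auto simp: \<Phi>_def pos_nth\<close>)
        ultimately show ?thesis by (metis mset_map)
      qed
      ultimately show ?thesis
        using mono strict unfolding ssyt_def diagram_shape \<Lambda>_def[symmetric] by auto
    qed
    moreover have "F \<in> \<Phi> ` ?B" if F: "F \<in> ?S" for F
    proof -
      have F1: "F \<in> \<Lambda> \<rightarrow>\<^sub>E {1..}"
        and Fr: "\<And>i j j'. (i, j) \<in> \<Lambda> \<Longrightarrow> (i, j') \<in> \<Lambda> \<Longrightarrow> j < j' \<Longrightarrow> F (i, j) \<le> F (i, j')"
        and Fc: "\<And>i i' j. (i, j) \<in> \<Lambda> \<Longrightarrow> (i', j) \<in> \<Lambda> \<Longrightarrow> i < i' \<Longrightarrow> F (i, j) < F (i', j)"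
        and Fm: "image_mset F (mset_set \<Lambda>) = mset xs"
        using F unfolding ssyt_def diagram_shape \<Lambda>_def[symmetric] by auto
      have inj: "inj_on (std_key F) \<Lambda>"
      proof (rule inj_onI)
        fix u v assume uv: "u \<in> \<Lambda>" "v \<in> \<Lambda>" "std_key F u = std_key F v"
        obtain i j i' j' where "u = (i, j)" "v = (i', j')" by (metis surj_pair)
        then show "u = v"
          using uv Fc[of i j i'] Fc[of i' j i] by (cases i i' rule: linorder_cases) (auto simp: std_key_def)
      qed
      define K where "K = sorted_list_of_set (std_key F ` \<Lambda>)"
      define b where "b = map (the_inv_into \<Lambda> (std_key F)) K"
      have Kset: "set K = std_key F ` \<Lambda>" using fin by (simp add: K_def)
      have mk: "map (std_key F) b = K"
        unfolding b_def map_map using Kset inj by (intro map_idI) (auto simp: f_the_inv_into_f)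
      have sK: "sorted_wrt (<) K" by (simp add: K_def)
      have setb: "set b = \<Lambda>" unfolding b_def using Kset inj by (auto simp: the_inv_into_f_f image_iff)
      have distb: "distinct b" using sK mk unfolding strict_sorted_iff by (metis distinct_map)
      have klt: "std_key F (b ! p) < std_key F (b ! q)" if "p < q" "q < length b" for p q
        using sK that unfolding mk[symmetric] by (simp add: sorted_wrt_iff_nth_less)
      have lb: "lin_ext b \<Lambda>"
        unfolding lin_ext_def
      proof (intro conjI allI impI)
        fix k k' assume k: "k < length b" "k' < length b" and le: "fst (b ! k') \<le> fst (b ! k) \<and> snd (b ! k') \<le> snd (b ! k)"
        obtain i j where ij: "b ! k = (i, j)" by fastforce
        obtain i' j' where ij': "b ! k' = (i', j')" by fastforce
        have in\<Lambda>: "(i, j) \<in> \<Lambda>" "(i', j') \<in> \<Lambda>" using k nth_mem setb ij ij' by metis+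
        have "1 \<le> i'" "1 \<le> j" using in\<Lambda> cells_pos by (auto simp: \<Lambda>_def)
        \<comment> \<open>The corner \<open>(i', j)\<close> connects the two boxes by a row and a column.\<close>
        then have mid: "(i', j) \<in> \<Lambda>" using cells_down[OF T, of i j i' j] in\<Lambda> le ij ij' by (simp add: \<Lambda>_def)
        have "F (i', j') \<le> F (i', j)" using Fr[OF in\<Lambda>(2) mid] le ij ij' by (cases "j' = j") auto
        also have "F (i', j) \<le> F (i, j)" using Fc[OF mid in\<Lambda>(1)] le ij ij' by (cases "i' = i") auto
        finally have "\<not> std_key F (b ! k) < std_key F (b ! k')"
          using le ij ij' by (auto simp: std_key_def less_prod_def)
        then show "k' \<le> k" using klt[of k k'] k by (meson not_less)
      qed (use distb setb in auto)
      have mF: "map F b = xs"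
      proof -
        have "sorted (map F b)"
          unfolding sorted_wrt_iff_nth_less
        proof (intro allI impI)
          fix p q assume "p < q" "q < length (map F b)"
          then show "map F b ! p \<le> map F b ! q" using klt[of p q] by (auto simp: std_key_def less_prod_def)
        qed
        moreover have "mset (map F b) = mset xs"
          using Fm setb distb mset_set_set by (metis mset_map)
        ultimately show ?thesis using xs(1) properties_for_sort sorted_sort_id by metis
      qed
      have "b \<in> ?B"
      proof -
        have "snd (b ! k) < snd (b ! Suc k)" if "Suc k < length b" "xs ! k = xs ! Suc k" for k
          using klt[of k "Suc k"] that unfolding mF[symmetric] by (auto simp: std_key_def less_prod_def)
        then show ?thesis using lb by (simp add: \<Lambda>_def)
      qed
      moreover have "\<Phi> b = F"
      proof
        fix v show "\<Phi> b v = F v"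
        proof (cases "v \<in> \<Lambda>")
          case True
          then have "pos b v < length b" "b ! pos b v = v" using setb pos_less[of v b] nth_pos[of v b] by auto
          then show ?thesis using True unfolding \<Phi>_def mF[symmetric] by simp
        next
          case False
          then show ?thesis using PiE_arb[OF F1 False] by (simp add: \<Phi>_def)
        qed
      qed
      ultimately show ?thesis by blast
    qed
    ultimately show "\<Phi> ` ?B = ?S" by blast
  qed
  then show ?thesis by (rule bij_betw_same_card)
qed

text \<open>
The fundamental quasisymmetric function of degree \<open>n\<close> for the set \<open>A\<close>. Its coefficients are 0 or
1, since a monomial has only one weakly increasing sequence of indices.
\<close>

definition qs_fund :: "nat \<Rightarrow> nat set \<Rightarrow> series" where
  "qs_fund n A m = (if size m = n \<and> 0 \<notin># m \<and>
     (\<forall>j\<in>A. sorted_list_of_multiset m ! (j - 1) < sorted_list_of_multiset m ! j) then 1 else 0)"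

lemma fundamental_eq_qs_fund: "fundamental \<alpha> = qs_fund (sum_list \<alpha>) (comp_set \<alpha>)"
proof
  fix m :: "nat multiset"
  have *: "sorted w \<and> mset w = m \<longleftrightarrow> w = sorted_list_of_multiset m" for w
    by (metis mset_sorted_list_of_multiset sorted_list_of_multiset_mset sorted_sort sorted_sort_id)
  have "{w. length w = sum_list \<alpha> \<and> set w \<subseteq> {1..} \<and> sorted w \<and>
      (\<forall>j\<in>comp_set \<alpha>. w ! (j - 1) < w ! j) \<and> mset w = m} =
    (if qs_fund (sum_list \<alpha>) (comp_set \<alpha>) m = 1 then {sorted_list_of_multiset m} else {})"
    (is "?L = ?R")
  proof -
    have "length (sorted_list_of_multiset m) = size m" by (metis mset_sorted_list_of_multiset size_mset)
    moreover have "set (sorted_list_of_multiset m) \<subseteq> {1..} \<longleftrightarrow> 0 \<notin># m"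
      by (auto simp: Suc_le_eq) (metis gr0I)
    ultimately have "w \<in> ?L \<longleftrightarrow> w \<in> ?R" for w
      using *[of w] by (auto simp: qs_fund_def)
    then show ?thesis by blast
  qed
  then show "fundamental \<alpha> m = qs_fund (sum_list \<alpha>) (comp_set \<alpha>) m"
    unfolding fundamental_def by (auto simp: qs_fund_def)
qed

text \<open>
Gessel's expansion of a Schur function, here over the Knuth class of \<open>T\<close>. For a fixed monomial with index
sequence \<open>xs\<close> both sides are counted by the linear extensions of the shape that move to the right
wherever \<open>xs\<close> is constant: on the left through the recorded boxes, on the right through
standardization.
\<close>

theorem sum_qs_fund_eq_schur:
  assumes T: "tableau T" "distinct (concat T)"
  defines "n \<equiv> length (concat T)"
  shows "(\<Sum>w | distinct w \<and> P_tab w = T. qs_fund n {j \<in> {1..<n}. \<not> w ! (j - 1) < w ! j} m)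
       = schur (map length T) m"
proof (cases "size m = n \<and> 0 \<notin># m")
  case False
  have E: "{F \<in> ssyt (map length T). image_mset F (mset_set (diagram (map length T) [])) = m} = {}"
  proof (rule ccontr)
    assume "\<not> ?thesis"
    then obtain F where F: "F \<in> ssyt (map length T)" "image_mset F (mset_set (cells T)) = m"
      by (auto simp: diagram_shape)
    have "size m = n" unfolding F(2)[symmetric] by (simp add: n_def card_cells)
    moreover have "F v \<noteq> 0" if "v \<in> cells T" for v
    proof -
      have "F \<in> cells T \<rightarrow>\<^sub>E {1..}" using F(1) unfolding ssyt_def diagram_shape by blast
      then show ?thesis using that by (auto dest: PiE_mem)
    qed
    then have "0 \<notin># m"
      unfolding F(2)[symmetric] set_image_mset finite_set_mset_mset_set[OF finite_cells[of T]]
      by (metis imageE)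
    ultimately show False using False by simp
  qed
  have "qs_fund n A m = 0" for A using False by (auto simp: qs_fund_def)
  then show ?thesis unfolding schur_def E by simp
next
  case True
  define xs where "xs = sorted_list_of_multiset m"
  have xs: "sorted xs" "mset xs = m" by (simp_all add: xs_def)
  have xl: "length xs = n" "0 \<notin> set xs" using True xs(2) by (auto simp flip: size_mset)
  let ?W = "{w. distinct w \<and> P_tab w = T}"
  have lenw: "length w = n" if "w \<in> ?W" for w
  proof -
    have "mset (concat T) = mset w" using mset_P_tab[of w] that by simp
    then show ?thesis using mset_eq_length n_def by metis
  qed
  have finW: "finite ?W"
  proof (rule finite_subset)
    show "?W \<subseteq> {w. set w \<subseteq> set (concat T) \<and> length w = n}"
      using lenw set_P_tab by fastforce
  qed (simp add: finite_lists_length_eq)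
  have "qs_fund n {j \<in> {1..<n}. \<not> w ! (j - 1) < w ! j} m
      = (if \<forall>k. Suc k < length w \<longrightarrow> xs ! k = xs ! Suc k \<longrightarrow> w ! k < w ! Suc k then 1 else 0)"
    if w: "w \<in> ?W" for w
  proof -
    have "(\<forall>j\<in>{j \<in> {1..<n}. \<not> w ! (j - 1) < w ! j}. xs ! (j - 1) < xs ! j) \<longleftrightarrow>
        (\<forall>k. Suc k < length w \<longrightarrow> xs ! k = xs ! Suc k \<longrightarrow> w ! k < w ! Suc k)" (is "?L = ?R")
    proof
      assume L: ?L
      show ?R
      proof (intro allI impI, rule ccontr)
        fix k assume k: "Suc k < length w" "xs ! k = xs ! Suc k" "\<not> w ! k < w ! Suc k"
        then have "Suc k \<in> {j \<in> {1..<n}. \<not> w ! (j - 1) < w ! j}" using lenw[OF w] by simp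
        then show False using L k(2) by fastforce
      qed
    next
      assume R: ?R
      show ?L
      proof
        fix j assume j: "j \<in> {j \<in> {1..<n}. \<not> w ! (j - 1) < w ! j}"
        then obtain k where k: "j = Suc k" by (cases j) auto
        have "xs ! k \<le> xs ! Suc k" using xs(1) j k xl(1) by (auto intro!: sorted_nth_mono)
        moreover have "xs ! k \<noteq> xs ! Suc k" using R j k lenw[OF w] by auto
        ultimately show "xs ! (j - 1) < xs ! j" using k by simp
      qed
    qed
    then show ?thesis using True by (simp add: qs_fund_def xs_def)
  qed
  then have "(\<Sum>w\<in>?W. qs_fund n {j \<in> {1..<n}. \<not> w ! (j - 1) < w ! j} m)
    = (\<Sum>w\<in>?W. if \<forall>k. Suc k < length w \<longrightarrow> xs ! k = xs ! Suc k \<longrightarrow> w ! k < w ! Suc k then 1 else 0)"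
    by (intro sum.cong) auto
  also have "\<dots> = int (card {w \<in> ?W. \<forall>k. Suc k < length w \<longrightarrow> xs ! k = xs ! Suc k \<longrightarrow> w ! k < w ! Suc k})"
    using finW by (simp flip: sum.inter_filter)
  also have "{w \<in> ?W. \<forall>k. Suc k < length w \<longrightarrow> xs ! k = xs ! Suc k \<longrightarrow> w ! k < w ! Suc k}
      = {w. distinct w \<and> P_tab w = T \<and>
             (\<forall>k. Suc k < length w \<longrightarrow> xs ! k = xs ! Suc k \<longrightarrow> w ! k < w ! Suc k)}"
    by auto
  also have "card \<dots> = card {F \<in> ssyt (map length T). image_mset F (mset_set (diagram (map length T) [])) = m}"
    using card_words_eq_card_lin_exts[OF T, of "\<lambda>k. xs ! k = xs ! Suc k"]
      card_lin_exts_eq_card_ssyt[OF T(1) xs(1) xl(2)] xl(1) xs(2) by (simp add: n_def)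
  finally show ?thesis by (simp add: schur_def)
qed

section \<open>Inversions and words of permutations\<close>

abbreviation pinv :: "(nat \<Rightarrow> nat) \<Rightarrow> nat \<Rightarrow> nat" where
  "pinv \<equiv> inv_into UNIV"

text \<open>
Inversions are recorded by places. With this choice the left weak order, in which \<open>s\<^sub>i\<close> acts from the
left, is inclusion of inversion sets.
\<close>

definition Invs :: "nat \<Rightarrow> (nat \<Rightarrow> nat) \<Rightarrow> (nat \<times> nat) set" where
  "Invs n \<sigma> = {(x, y). x \<in> {1..n} \<and> y \<in> {1..n} \<and> x < y \<and> \<sigma> y < \<sigma> x}"

lemma finite_Invs: "finite (Invs n \<sigma>)"
  by (rule finite_subset[of _ "{1..n} \<times> {1..n}"]) (auto simp: Invs_def)

lemma Invs_id: "Invs n (\<lambda>x. x) = {}"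
  by (auto simp: Invs_def)

lemma permutes_simple_transp:
  assumes "\<sigma> permutes {1..n}" "i \<in> {1..<n}"
  shows "simple_transp i \<circ> \<sigma> permutes {1..n}"
  using assms by (intro permutes_compose permutes_swap_id) auto

lemma simple_transp_less_iff:
  "u \<noteq> v \<Longrightarrow> \<not> (u = i \<and> v = Suc i) \<Longrightarrow> \<not> (u = Suc i \<and> v = i) \<Longrightarrow>
   simple_transp i u < simple_transp i v \<longleftrightarrow> u < v"
  by (auto simp: transpose_def)

text \<open>
Interchanging the values \<open>i\<close> and \<open>i + 1\<close> affects the relative order of no other pair of places.
\<close>

lemma Invs_step:
  assumes \<sigma>: "\<sigma> permutes {1..n}" and i: "i \<in> {1..<n}"
  defines "a \<equiv> pinv \<sigma> i" and "b \<equiv> pinv \<sigma> (Suc i)"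
  shows "a < b \<Longrightarrow> Invs n (simple_transp i \<circ> \<sigma>) = insert (a, b) (Invs n \<sigma>) \<and> (a, b) \<notin> Invs n \<sigma>"
    "b < a \<Longrightarrow> Invs n (simple_transp i \<circ> \<sigma>) = Invs n \<sigma> - {(b, a)} \<and> (b, a) \<in> Invs n \<sigma>"
proof -
  have ab: "\<sigma> a = i" "\<sigma> b = Suc i" unfolding a_def b_def using permutes_inverses(1)[OF \<sigma>] by auto
  have in': "a \<in> {1..n}" "b \<in> {1..n}"
    using i permutes_in_image[OF permutes_inv[OF \<sigma>]] unfolding a_def b_def by auto
  have inj: "\<sigma> x = \<sigma> y \<longleftrightarrow> x = y" for x y using permutes_inj[OF \<sigma>] by (auto simp: inj_def)
  have eq: "x = a \<longleftrightarrow> \<sigma> x = i" "x = b \<longleftrightarrow> \<sigma> x = Suc i" for x using inj ab by metis+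
  have same: "(x, y) \<in> Invs n (simple_transp i \<circ> \<sigma>) \<longleftrightarrow> (x, y) \<in> Invs n \<sigma>"
    if "\<not> (x = a \<and> y = b)" "\<not> (x = b \<and> y = a)" for x y
  proof (cases "x = y")
    case False
    then show ?thesis
      using simple_transp_less_iff[of "\<sigma> y" "\<sigma> x" i] inj eq that by (auto simp: Invs_def)
  qed (simp add: Invs_def)
  have sa: "simple_transp i (\<sigma> a) = Suc i" "simple_transp i (\<sigma> b) = i" using ab by auto
  show "Invs n (simple_transp i \<circ> \<sigma>) = insert (a, b) (Invs n \<sigma>) \<and> (a, b) \<notin> Invs n \<sigma>" if "a < b"
  proof -
    have "(a, b) \<in> Invs n (simple_transp i \<circ> \<sigma>)" "(a, b) \<notin> Invs n \<sigma>"
      using in' that sa ab by (auto simp: Invs_def)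
    moreover have "(b, a) \<notin> Invs n f" for f using that by (auto simp: Invs_def)
    ultimately have "v \<in> Invs n (simple_transp i \<circ> \<sigma>) \<longleftrightarrow> v \<in> insert (a, b) (Invs n \<sigma>)" for v
      using same[of "fst v" "snd v"] by (cases v) auto
    then show ?thesis using \<open>(a, b) \<notin> Invs n \<sigma>\<close> by blast
  qed
  show "Invs n (simple_transp i \<circ> \<sigma>) = Invs n \<sigma> - {(b, a)} \<and> (b, a) \<in> Invs n \<sigma>" if "b < a"
  proof -
    have "(b, a) \<notin> Invs n (simple_transp i \<circ> \<sigma>)" "(b, a) \<in> Invs n \<sigma>"
      using in' that sa ab by (auto simp: Invs_def)
    moreover have "(a, b) \<notin> Invs n f" for f using that by (auto simp: Invs_def)
    ultimately have "v \<in> Invs n (simple_transp i \<circ> \<sigma>) \<longleftrightarrow> v \<in> Invs n \<sigma> - {(b, a)}" for v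
      using same[of "fst v" "snd v"] by (cases v) auto
    then show ?thesis using \<open>(b, a) \<in> Invs n \<sigma>\<close> by blast
  qed
qed

lemma inv_values_neq:
  assumes "\<sigma> permutes {1..n}" shows "pinv \<sigma> i \<noteq> pinv \<sigma> (Suc i)"
  using permutes_inverses(1)[OF assms] by (metis n_not_Suc_n)

lemma perm_word_Nil [simp]: "perm_word [] = id"
  and perm_word_Cons [simp]: "perm_word (i # w) = simple_transp i \<circ> perm_word w"
  by (simp_all add: perm_word_def)

lemma perm_word_permutes: "set w \<subseteq> {1..<n} \<Longrightarrow> perm_word w permutes {1..n}"
proof (induction w)
  case (Cons i w)
  then show ?case unfolding perm_word_Cons by (intro permutes_simple_transp) simp_all
qed (simp add: permutes_id)

lemma card_Invs_perm_word: "set w \<subseteq> {1..<n} \<Longrightarrow> card (Invs n (perm_word w)) \<le> length w"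
proof (induction w)
  case Nil
  show ?case by (simp add: id_def Invs_id)
next
  case (Cons i w)
  let ?s = "perm_word w"
  have s: "?s permutes {1..n}" "i \<in> {1..<n}" using Cons.prems perm_word_permutes[of w n] by auto
  have IH: "card (Invs n ?s) \<le> length w" using Cons by simp
  consider "pinv ?s i < pinv ?s (Suc i)" | "pinv ?s (Suc i) < pinv ?s i"
    using inv_values_neq[OF s(1), of i] by linarith
  then show ?case
  proof cases
    case 1
    then have "card (Invs n (simple_transp i \<circ> ?s)) = Suc (card (Invs n ?s))"
      using Invs_step(1)[OF s 1] finite_Invs[of n ?s] by (metis card_insert_disjoint)
    then show ?thesis using IH unfolding perm_word_Cons by (simp only: list.size)
  next
    case 2
    then have "card (Invs n (simple_transp i \<circ> ?s)) \<le> card (Invs n ?s)"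
      using Invs_step(2)[OF s 2] finite_Invs[of n ?s] by (simp add: card_Diff1_le)
    then show ?thesis using IH unfolding perm_word_Cons by (simp only: list.size)
  qed
qed

lemma permutes_no_descent_id:
  assumes \<sigma>: "\<sigma> permutes {1..n}" and "\<And>i. i \<in> {1..<n} \<Longrightarrow> \<sigma> i < \<sigma> (Suc i)"
  shows "\<sigma> = id"
proof
  fix x
  have "sorted_wrt (<) (map \<sigma> [1..<Suc n])"
    using assms(2) by (subst sorted_wrt_iff_nth_Suc_transp) (auto simp: transp_def simp del: upt_Suc)
  moreover have "set (map \<sigma> [1..<Suc n]) = set [1..<Suc n]"
  proof -
    have "set [1..<Suc n] = {1..n}" by auto
    then show ?thesis using permutes_image[OF \<sigma>] by (simp del: upt_Suc)
  qed
  ultimately have "map \<sigma> [1..<Suc n] = [1..<Suc n]"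
    by (intro strict_sorted_equal sorted_wrt_upt)
  then have "map \<sigma> [1..<Suc n] = map id [1..<Suc n]" by simp
  then have "x \<in> {1..n} \<Longrightarrow> \<sigma> x = x" unfolding map_eq_conv by auto
  then show "\<sigma> x = id x" using permutes_not_in[OF \<sigma>] by auto
qed

text \<open>
A permutation that is not the identity has an inversion between places carrying the values \<open>i\<close> and
\<open>i + 1\<close>; removing it by \<open>s\<^sub>i\<close> and iterating takes exactly as many steps as there are inversions.
\<close>

lemma ex_perm_word:
  "\<sigma> permutes {1..n} \<Longrightarrow> \<exists>w. length w = card (Invs n \<sigma>) \<and> set w \<subseteq> {1..<n} \<and> perm_word w = \<sigma>"
proof (induction "card (Invs n \<sigma>)" arbitrary: \<sigma>)
  case 0
  then have "Invs n \<sigma> = {}" using finite_Invs[of n \<sigma>] by simp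
  have "\<sigma> = id"
  proof (rule permutes_no_descent_id[OF "0.prems"])
    fix i assume i: "i \<in> {1..<n}"
    have "\<sigma> i \<noteq> \<sigma> (Suc i)" using permutes_inj[OF "0.prems"] by (metis injD n_not_Suc_n)
    moreover have "(i, Suc i) \<notin> Invs n \<sigma>" using \<open>Invs n \<sigma> = {}\<close> by simp
    ultimately show "\<sigma> i < \<sigma> (Suc i)" using i by (auto simp: Invs_def)
  qed
  then show ?case by (intro exI[of _ "[]"]) (simp add: id_def Invs_id)
next
  case (Suc k)
  have "\<exists>i\<in>{1..<n}. pinv \<sigma> (Suc i) < pinv \<sigma> i"
  proof (rule ccontr)
    assume "\<not> ?thesis"
    then have "pinv \<sigma> i < pinv \<sigma> (Suc i)" if "i \<in> {1..<n}" for i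
      using inv_values_neq[OF Suc.prems, of i] that by force
    then have "pinv \<sigma> = id" by (rule permutes_no_descent_id[OF permutes_inv[OF Suc.prems]])
    then have "\<sigma> = id" by (metis Suc.prems inv_id permutes_inv_inv)
    then have "Invs n \<sigma> = {}" by (auto simp: Invs_def)
    then show False using Suc.hyps(2) by simp
  qed
  then obtain i where i: "i \<in> {1..<n}" "pinv \<sigma> (Suc i) < pinv \<sigma> i" by blast
  let ?s = "simple_transp i \<circ> \<sigma>"
  have "card (Invs n ?s) = k"
    using Invs_step(2)[OF Suc.prems i] Suc.hyps(2) finite_Invs[of n \<sigma>] by simp
  then obtain w where w: "length w = k" "set w \<subseteq> {1..<n}" "perm_word w = ?s"
    using Suc.hyps(1)[of ?s] permutes_simple_transp[OF Suc.prems i(1)] by blast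
  have "perm_word (i # w) = \<sigma>" using w(3) by (auto simp: fun_eq_iff)
  then show ?case using w i(1) Suc.hyps(2) by (intro exI[of _ "i # w"]) simp
qed

lemma perm_length_eq_card_Invs:
  assumes "\<sigma> permutes {1..n}"
  shows "perm_length n \<sigma> = card (Invs n \<sigma>)"
  unfolding perm_length_def
proof (rule Least_equality)
  show "\<exists>w. length w = card (Invs n \<sigma>) \<and> set w \<subseteq> {1..<n} \<and> perm_word w = \<sigma>"
    by (rule ex_perm_word[OF assms])
  show "card (Invs n \<sigma>) \<le> k" if "\<exists>w. length w = k \<and> set w \<subseteq> {1..<n} \<and> perm_word w = \<sigma>" for k
    using that card_Invs_perm_word by blast
qed

lemma Des_L_iff:
  assumes \<sigma>: "\<sigma> permutes {1..n}"
  shows "i \<in> Des_L n \<sigma> \<longleftrightarrow> i \<in> {1..<n} \<and> pinv \<sigma> (Suc i) < pinv \<sigma> i"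
proof (cases "i \<in> {1..<n}")
  case True
  have len: "perm_length n (simple_transp i \<circ> \<sigma>) = card (Invs n (simple_transp i \<circ> \<sigma>))"
    "perm_length n \<sigma> = card (Invs n \<sigma>)"
    using perm_length_eq_card_Invs \<sigma> permutes_simple_transp[OF \<sigma> True] by auto
  consider "pinv \<sigma> i < pinv \<sigma> (Suc i)" | "pinv \<sigma> (Suc i) < pinv \<sigma> i"
    using inv_values_neq[OF \<sigma>, of i] by linarith
  then show ?thesis
  proof cases
    case 1
    then show ?thesis using Invs_step(1)[OF \<sigma> True 1] True finite_Invs[of n \<sigma>] by (simp add: Des_L_def len)
  next
    case 2
    have "card (Invs n \<sigma> - {(pinv \<sigma> (Suc i), pinv \<sigma> i)}) < card (Invs n \<sigma>)"
      using Invs_step(2)[OF \<sigma> True 2] finite_Invs[of n \<sigma>] by (intro card_Diff1_less) auto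
    then show ?thesis using Invs_step(2)[OF \<sigma> True 2] True 2 by (simp add: Des_L_def len)
  qed
qed (auto simp: Des_L_def)

text \<open>
The sign makes left descents correspond to ascents of the word, so that the descent set of
the word is the complement of \<open>Des_L\<close>; the irreducible module of a basis element is indexed by this
complement.
\<close>

definition word_of :: "nat \<Rightarrow> (nat \<Rightarrow> nat) \<Rightarrow> int list" where
  "word_of n \<sigma> = map (\<lambda>v. - int (pinv \<sigma> v)) [1..<Suc n]"

lemma length_word_of [simp]: "length (word_of n \<sigma>) = n"
  by (simp add: word_of_def)

lemma word_of_nth: "k < n \<Longrightarrow> word_of n \<sigma> ! k = - int (pinv \<sigma> (Suc k))"
  unfolding word_of_def by (subst nth_map) (simp_all del: upt_Suc)

lemma set_word_of:
  assumes "\<sigma> permutes {1..n}" shows "set (word_of n \<sigma>) = (\<lambda>x. - int x) ` {1..n}"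
proof -
  have "set [1..<Suc n] = {1..n}" by auto
  then have "set (word_of n \<sigma>) = (\<lambda>x. - int x) ` (pinv \<sigma> ` {1..n})"
    by (simp add: word_of_def image_image del: upt_Suc)
  then show ?thesis using permutes_image[OF permutes_inv[OF assms]] by simp
qed

lemma distinct_word_of:
  assumes "\<sigma> permutes {1..n}" shows "distinct (word_of n \<sigma>)"
proof -
  have "inj_on (\<lambda>v. - int (pinv \<sigma> v)) (set [1..<Suc n])"
  proof (rule inj_onI)
    fix u v assume "- int (pinv \<sigma> u) = - int (pinv \<sigma> v)"
    then show "u = v" using injD[OF permutes_inj[OF permutes_inv[OF assms]]] by simp
  qed
  then show ?thesis unfolding word_of_def distinct_map using distinct_upt by blast
qed

lemma pos_word_of:
  assumes "\<sigma> permutes {1..n}" "x \<in> {1..n}"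
  shows "pos (word_of n \<sigma>) (- int x) = \<sigma> x - 1"
proof -
  have "\<sigma> x \<in> {1..n}" using permutes_in_image[OF assms(1)] assms(2) by simp
  then obtain k where k: "\<sigma> x = Suc k" "k < n" by (cases "\<sigma> x") auto
  have "pinv \<sigma> (Suc k) = x" using permutes_inverses(2)[OF assms(1), of x] k(1) by simp
  then have "word_of n \<sigma> ! k = - int x" using word_of_nth[OF k(2), of \<sigma>] by simp
  then show ?thesis using pos_nth[OF distinct_word_of[OF assms(1)], of k] k by simp
qed

lemma word_of_inj:
  assumes "\<sigma> permutes {1..n}" "\<sigma>' permutes {1..n}" "word_of n \<sigma> = word_of n \<sigma>'"
  shows "\<sigma> = \<sigma>'"
proof
  fix x show "\<sigma> x = \<sigma>' x"
  proof (cases "x \<in> {1..n}")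
    case True
    then have "\<sigma> x \<in> {1..n}" "\<sigma>' x \<in> {1..n}"
      using permutes_in_image[OF assms(1)] permutes_in_image[OF assms(2)] by simp_all
    moreover have "\<sigma> x - 1 = \<sigma>' x - 1"
      using pos_word_of[OF assms(1) True] pos_word_of[OF assms(2) True] assms(3) by simp
    ultimately show ?thesis by auto
  next
    case False
    then show ?thesis using permutes_not_in[OF assms(1)] permutes_not_in[OF assms(2)] by simp
  qed
qed

lemma Des_L_word_of:
  assumes "\<sigma> permutes {1..n}" "j \<in> {1..<n}"
  shows "j \<in> Des_L n \<sigma> \<longleftrightarrow> word_of n \<sigma> ! (j - 1) < word_of n \<sigma> ! j"
  using assms(2) by (subst Des_L_iff[OF assms(1)]) (auto simp: word_of_nth)

lemma inv_simple_transp_comp: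
  assumes "\<sigma> permutes {1..n}"
  shows "pinv (simple_transp i \<circ> \<sigma>) v = pinv \<sigma> (simple_transp i v)"
proof -
  have "pinv (simple_transp i \<circ> \<sigma>) = pinv \<sigma> \<circ> pinv (simple_transp i)"
    by (intro o_inv_distrib) (use assms permutes_bij in auto)
  then show ?thesis by simp
qed

lemma word_of_simple_transp:
  assumes \<sigma>: "\<sigma> permutes {1..n}" and w: "word_of n \<sigma> = u @ [a, c] @ v"
  shows "word_of n (simple_transp (Suc (length u)) \<circ> \<sigma>) = u @ [c, a] @ v"
proof (rule nth_equalityI)
  have n: "n = length u + 2 + length v" using arg_cong[OF w, of length] by simp
  then show "length (word_of n (simple_transp (Suc (length u)) \<circ> \<sigma>)) = length (u @ [c, a] @ v)" by simp
  fix k assume "k < length (word_of n (simple_transp (Suc (length u)) \<circ> \<sigma>))"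
  then have k: "k < n" by simp
  have old: "- int (pinv \<sigma> (Suc j)) = (u @ [a, c] @ v) ! j" if "j < n" for j
    using word_of_nth[OF that, of \<sigma>] w by simp
  have new: "word_of n (simple_transp (Suc (length u)) \<circ> \<sigma>) ! k
      = - int (pinv \<sigma> (simple_transp (Suc (length u)) (Suc k)))"
    using k by (simp only: word_of_nth inv_simple_transp_comp[OF \<sigma>])
  consider "k = length u" | "k = Suc (length u)" | "k < length u" | "Suc (length u) < k" by linarith
  then show "word_of n (simple_transp (Suc (length u)) \<circ> \<sigma>) ! k = (u @ [c, a] @ v) ! k"
  proof cases
    case 1
    then show ?thesis unfolding new using old[of "Suc k"] n by (simp add: nth_append)
  next
    case 2
    then show ?thesis unfolding new using old[of "length u"] n by (simp add: nth_append)
  next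
    case 3
    then show ?thesis unfolding new using old[OF k] by (simp add: nth_append transpose_def)
  next
    case 4
    then show ?thesis unfolding new using old[OF k] by (simp add: nth_append transpose_def nth_Cons split: nat.splits)
  qed
qed

section \<open>Knuth relations on the linear extensions of a regular poset\<close>

lemma part_antimono:
  assumes "is_partition lam" "1 \<le> i" "i \<le> i'" shows "part lam i' \<le> part lam i"
proof (cases "i' \<le> length lam")
  case True
  then have "lam ! (i' - 1) \<le> lam ! (i - 1)"
    using assms sorted_wrt_nth_less[of "(\<ge>)" lam "i - 1" "i' - 1"] by (cases "i = i'") (auto simp: is_partition_def)
  then show ?thesis using assms True by (simp add: part_def)
qed (simp add: part_def)

text \<open>
A skew diagram contains the whole rectangle between two of its boxes.
\<close>

lemma diagram_convex:
  assumes "is_partition lam" "is_partition \<mu>" "(i, j) \<in> diagram lam \<mu>" "(i', j') \<in> diagram lam \<mu>"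
    "i \<le> r" "r \<le> i'" "j \<le> c" "c \<le> j'"
  shows "(r, c) \<in> diagram lam \<mu>"
proof -
  have "1 \<le> i" "part \<mu> i < j" "j' \<le> part lam i'" using assms(3,4) by (auto simp: diagram_def)
  moreover have "part lam i' \<le> part lam r" "part \<mu> r \<le> part \<mu> i"
    using part_antimono[OF assms(1), of r i'] part_antimono[OF assms(2), of i r] assms(5,6) \<open>1 \<le> i\<close> by auto
  ultimately show ?thesis using assms(5-8) by (simp add: diagram_def)
qed

text \<open>
This is where regularity enters. Suppose \<open>x\<close> lies below \<open>y\<close> in \<open>P\<close>. As the values of \<open>\<sigma>\<close> at \<open>x\<close> and
\<open>y\<close> are consecutive, no element lies strictly between them, so their boxes are neighbours in a
row or a column. By regularity \<open>z\<close> is above \<open>x\<close> or below \<open>y\<close>, and since the value of \<open>\<sigma>\<close> at \<open>z\<close> is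
adjacent as well, the rectangle between \<open>z\<close> and the farther one of \<open>x\<close> and \<open>y\<close> contains no further
box. If \<open>z\<close> is on the line through \<open>x\<close> and \<open>y\<close>, it cannot have a label between theirs, because labels are
monotone along this line. Otherwise a corner of the rectangle coincides with the box of \<open>z\<close>, and then
the label of \<open>z\<close> is on the wrong side of that of its neighbour.
\<close>

lemma Sigma_L_adjacent_incomparable:
  assumes P: "P \<in> RSP n" and \<sigma>: "\<sigma> \<in> Sigma_L n P"
    and xyz: "x \<in> {1..n}" "y \<in> {1..n}" "z \<in> {1..n}"
    and s: "\<sigma> y = Suc (\<sigma> x)" "Suc (\<sigma> z) = \<sigma> x \<or> \<sigma> z = Suc (\<sigma> y)"
    and between: "x < z \<and> z < y \<or> y < z \<and> z < x"
  shows "(x, y) \<notin> P"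
proof
  assume xy: "(x, y) \<in> P"
  obtain lam \<mu> \<tau> where lm: "is_partition lam" "is_partition \<mu>"
    and \<tau>: "schur_labeling n lam \<mu> \<tau>" and PP: "P = labeling_poset lam \<mu> \<tau>"
    and reg: "regular_poset n P"
    using P by (auto simp: RSP_def SP_def basic_skew_partition_def)
  let ?D = "diagram lam \<mu>"
  have bij: "bij_betw \<tau> ?D {1..n}"
    and row: "\<And>i j j'. (i, j) \<in> ?D \<Longrightarrow> (i, j') \<in> ?D \<Longrightarrow> j < j' \<Longrightarrow> \<tau> (i, j') < \<tau> (i, j)"
    and col: "\<And>i i' j. (i, j) \<in> ?D \<Longrightarrow> (i', j) \<in> ?D \<Longrightarrow> i < i' \<Longrightarrow> \<tau> (i, j) < \<tau> (i', j)"
    using \<tau> by (auto simp: schur_labeling_def)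
  have inj: "\<tau> u = \<tau> v \<longleftrightarrow> u = v" if "u \<in> ?D" "v \<in> ?D" for u v
    using bij that by (auto simp: bij_betw_def inj_on_def)
  have leP: "(\<tau> (i, j), \<tau> (i', j')) \<in> P \<longleftrightarrow> i \<le> i' \<and> j \<le> j'" if "(i, j) \<in> ?D" "(i', j') \<in> ?D" for i j i' j'
    using that inj unfolding PP labeling_poset_def by auto
  have \<sigma>P: "\<sigma> u \<le> \<sigma> v" if "(u, v) \<in> P" for u v using \<sigma> that by (auto simp: Sigma_L_def)
  have \<sigma>inj: "\<sigma> u = \<sigma> v \<longleftrightarrow> u = v" for u v
    using \<sigma> permutes_inj by (auto simp: Sigma_L_def inj_def)
  have "x \<in> \<tau> ` ?D" "y \<in> \<tau> ` ?D" "z \<in> \<tau> ` ?D" using xyz bij by (auto simp: bij_betw_def)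
  then obtain rx cx ry cy rz cz where x: "x = \<tau> (rx, cx)" "(rx, cx) \<in> ?D"
    and y: "y = \<tau> (ry, cy)" "(ry, cy) \<in> ?D" and z: "z = \<tau> (rz, cz)" "(rz, cz) \<in> ?D"
    by auto
  have xy': "rx \<le> ry" "cx \<le> cy" using leP[OF x(2) y(2)] xy x(1) y(1) by auto
  \<comment> \<open>The values of \<open>\<sigma>\<close> leave no room between \<open>x\<close> and \<open>y\<close>.\<close>
  have mid: "t = (rx, cx) \<or> t = (ry, cy)" if t: "t \<in> ?D" "rx \<le> fst t" "fst t \<le> ry" "cx \<le> snd t" "snd t \<le> cy" for t
  proof -
    have "(x, \<tau> t) \<in> P" "(\<tau> t, y) \<in> P"
      using leP[OF x(2), of "fst t" "snd t"] leP[OF _ y(2), of "fst t" "snd t"] t x(1) y(1) by auto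
    then have "\<sigma> (\<tau> t) = \<sigma> x \<or> \<sigma> (\<tau> t) = \<sigma> y" using \<sigma>P[of x "\<tau> t"] \<sigma>P[of "\<tau> t" y] s(1) by linarith
    then show ?thesis using \<sigma>inj inj[OF t(1)] x y by auto
  qed
  have nz: "z \<noteq> x" "z \<noteq> y" using between by auto
  \<comment> \<open>Otherwise a corner of the rectangle spanned by \<open>x\<close> and \<open>y\<close> would lie strictly between them.\<close>
  have line: "rx = ry \<and> cx < cy \<or> cx = cy \<and> rx < ry"
  proof (rule ccontr)
    assume "\<not> ?thesis"
    moreover have "(rx, cx) \<noteq> (ry, cy)" using x y s(1) by auto
    ultimately have lt: "rx < ry" "cx < cy" using xy' by auto
    have "(rx, cy) \<in> ?D" by (rule diagram_convex[OF lm x(2) y(2)]) (use lt in auto)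
    then show False using mid[of "(rx, cy)"] lt by auto
  qed
  have regz: "(x, z) \<in> P \<or> (z, y) \<in> P"
    using reg xyz xy between unfolding regular_poset_def by blast
  from s(2) show False
  proof
    assume sz: "Suc (\<sigma> z) = \<sigma> x"
    then have "(z, y) \<in> P" using regz \<sigma>P[of x z] by auto
    then have zy: "rz \<le> ry" "cz \<le> cy" using leP[OF z(2) y(2)] z(1) y(1) by auto
    have mid2: "t = (rz, cz) \<or> t = (rx, cx) \<or> t = (ry, cy)"
      if t: "t \<in> ?D" "rz \<le> fst t" "fst t \<le> ry" "cz \<le> snd t" "snd t \<le> cy" for t
    proof -
      have "(z, \<tau> t) \<in> P" "(\<tau> t, y) \<in> P"
        using leP[OF z(2), of "fst t" "snd t"] leP[OF _ y(2), of "fst t" "snd t"] t z(1) y(1) by auto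
      then have "\<sigma> (\<tau> t) = \<sigma> z \<or> \<sigma> (\<tau> t) = \<sigma> x \<or> \<sigma> (\<tau> t) = \<sigma> y"
        using \<sigma>P[of z "\<tau> t"] \<sigma>P[of "\<tau> t" y] s(1) sz by linarith
      then show ?thesis using \<sigma>inj inj[OF t(1)] x y z by auto
    qed
    from line show False
    proof
      assume l: "rx = ry \<and> cx < cy"
      then have "y < x" using row x y by auto
      then have b: "y < z" "z < x" using between by auto
      show False
      proof (cases "rz = ry")
        case True
        consider "cz < cx" | "cz = cx" | "cx < cz" by linarith
        then show False
        proof cases
          case 1
          then show False using row[of rx cz cx] x z l True b by auto
        next
          case 2
          then show False using nz x z l True by auto
        next
          case 3
          then show False using mid[of "(rz, cz)"] x y z l True nz zy by auto
        qed
      next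
        case False
        have t: "(rz, cy) \<in> ?D" by (rule diagram_convex[OF lm z(2) y(2)]) (use zy in auto)
        then have "(rz, cy) = (rz, cz)" using mid2[OF t] zy False l by auto
        then show False using col[of rz cy ry] z y t zy False b by auto
      qed
    next
      assume l: "cx = cy \<and> rx < ry"
      then have "x < y" using col x y by auto
      then have b: "x < z" "z < y" using between by auto
      show False
      proof (cases "cz = cy")
        case True
        consider "rz < rx" | "rz = rx" | "rx < rz" by linarith
        then show False
        proof cases
          case 1
          then show False using col[of rz cx rx] x z l True b by auto
        next
          case 2
          then show False using nz x z l True by auto
        next
          case 3
          then show False using mid[of "(rz, cz)"] x y z l True nz zy by auto
        qed
      next
        case False
        have t: "(ry, cz) \<in> ?D" by (rule diagram_convex[OF lm z(2) y(2)]) (use zy in auto)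
        then have "(ry, cz) = (rz, cz)" using mid2[OF t] zy False l by auto
        then show False using row[of ry cz cy] z y t zy False b by auto
      qed
    qed
  next
    assume sz: "\<sigma> z = Suc (\<sigma> y)"
    then have "(x, z) \<in> P" using regz \<sigma>P[of z y] by auto
    then have zx: "rx \<le> rz" "cx \<le> cz" using leP[OF x(2) z(2)] z(1) x(1) by auto
    have mid2: "t = (rz, cz) \<or> t = (rx, cx) \<or> t = (ry, cy)"
      if t: "t \<in> ?D" "rx \<le> fst t" "fst t \<le> rz" "cx \<le> snd t" "snd t \<le> cz" for t
    proof -
      have "(x, \<tau> t) \<in> P" "(\<tau> t, z) \<in> P"
        using leP[OF x(2), of "fst t" "snd t"] leP[OF _ z(2), of "fst t" "snd t"] t z(1) x(1) by auto
      then have "\<sigma> (\<tau> t) = \<sigma> z \<or> \<sigma> (\<tau> t) = \<sigma> x \<or> \<sigma> (\<tau> t) = \<sigma> y"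
        using \<sigma>P[of x "\<tau> t"] \<sigma>P[of "\<tau> t" z] s(1) sz by linarith
      then show ?thesis using \<sigma>inj inj[OF t(1)] x y z by auto
    qed
    from line show False
    proof
      assume l: "rx = ry \<and> cx < cy"
      then have "y < x" using row x y by auto
      then have b: "y < z" "z < x" using between by auto
      show False
      proof (cases "rz = rx")
        case True
        consider "cz < cy" | "cz = cy" | "cy < cz" by linarith
        then show False
        proof cases
          case 1
          then show False using mid[of "(rz, cz)"] x y z l True nz zx by auto
        next
          case 2
          then show False using nz y z l True by auto
        next
          case 3
          then show False using row[of ry cy cz] y z l True b by auto
        qed
      next
        case False
        have t: "(rz, cx) \<in> ?D" by (rule diagram_convex[OF lm x(2) z(2)]) (use zx in auto)
        then have "(rz, cx) = (rz, cz)" using mid2[OF t] zx False l by auto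
        then show False using col[of rx cx rz] z x t zx False b by auto
      qed
    next
      assume l: "cx = cy \<and> rx < ry"
      then have "x < y" using col x y by auto
      then have b: "x < z" "z < y" using between by auto
      show False
      proof (cases "cz = cx")
        case True
        consider "rz < ry" | "rz = ry" | "ry < rz" by linarith
        then show False
        proof cases
          case 1
          then show False using mid[of "(rz, cz)"] x y z l True nz zx by auto
        next
          case 2
          then show False using nz y z l True by auto
        next
          case 3
          then show False using col[of ry cy rz] y z l True b by auto
        qed
      next
        case False
        have t: "(rx, cz) \<in> ?D" by (rule diagram_convex[OF lm x(2) z(2)]) (use zx in auto)
        then have "(rx, cz) = (rz, cz)" using mid2[OF t] zx False l by auto
        then show False using row[of rx cx cz] z x t zx False b by auto
      qed
    qed
  qed
qed

text \<open>
Interchanging two consecutive values only affects the relation between the elements that carry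
them.
\<close>

lemma simple_transp_Sigma_L:
  assumes \<sigma>: "\<sigma> \<in> Sigma_L n P" and i: "i \<in> {1..<n}" and nP: "(pinv \<sigma> i, pinv \<sigma> (Suc i)) \<notin> P"
  shows "simple_transp i \<circ> \<sigma> \<in> Sigma_L n P"
proof -
  have p: "\<sigma> permutes {1..n}" using \<sigma> by (simp add: Sigma_L_def)
  have "(simple_transp i \<circ> \<sigma>) u \<le> (simple_transp i \<circ> \<sigma>) v" if uv: "(u, v) \<in> P" for u v
  proof -
    have le: "\<sigma> u \<le> \<sigma> v" using \<sigma> uv by (auto simp: Sigma_L_def)
    have "\<not> (\<sigma> u = i \<and> \<sigma> v = Suc i)" using nP uv permutes_inverses(2)[OF p] by metis
    then show ?thesis using le by (auto simp: transpose_def)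
  qed
  then show ?thesis using permutes_simple_transp[OF p i] by (auto simp: Sigma_L_def)
qed

text \<open>
The letter \<open>b\<close> next to the interchanged letters plays the part of \<open>z\<close> in
\<open>Sigma_L_adjacent_incomparable\<close>.
\<close>

lemma knuth_step_Sigma_L:
  assumes P: "P \<in> RSP n" and \<sigma>: "\<sigma> \<in> Sigma_L n P"
    and w: "word_of n \<sigma> = u @ [a, c] @ v"
    and b: "(\<exists>u'. u = u' @ [b]) \<or> (\<exists>v'. v = b # v')"
    and between: "a < b \<and> b < c \<or> c < b \<and> b < a"
  shows "u @ [c, a] @ v \<in> word_of n ` Sigma_L n P"
proof -
  have p: "\<sigma> permutes {1..n}" using \<sigma> by (simp add: Sigma_L_def)
  have n: "n = length u + 2 + length v" using arg_cong[OF w, of length] by simp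
  have val: "- int (pinv \<sigma> (Suc j)) = (u @ [a, c] @ v) ! j" if "j < n" for j
    using word_of_nth[OF that, of \<sigma>] w by simp
  have rng: "pinv \<sigma> (Suc j) \<in> {1..n}" if "j < n" for j
    using permutes_in_image[OF permutes_inv[OF p]] that by simp
  define i where "i = Suc (length u)"
  have i: "i \<in> {1..<n}" using n by (simp add: i_def)
  have ac: "- int (pinv \<sigma> i) = a" "- int (pinv \<sigma> (Suc i)) = c"
    using val[of "length u"] val[of "Suc (length u)"] n by (auto simp: i_def nth_append)
  obtain j where j: "j < n" "- int (pinv \<sigma> (Suc j)) = b" "Suc (Suc j) = i \<or> Suc j = Suc (Suc i)"
    using b
  proof
    assume "\<exists>u'. u = u' @ [b]"
    then obtain u' where u: "u = u' @ [b]" by blast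
    then show ?thesis using that[of "length u'"] val[of "length u'"] n by (simp add: i_def nth_append)
  next
    assume "\<exists>v'. v = b # v'"
    then obtain v' where v: "v = b # v'" by blast
    then show ?thesis using that[of "length u + 2"] val[of "length u + 2"] n by (simp add: i_def nth_append)
  qed
  have "(pinv \<sigma> i, pinv \<sigma> (Suc i)) \<notin> P"
  proof (rule Sigma_L_adjacent_incomparable[OF P \<sigma>, of _ _ "pinv \<sigma> (Suc j)"])
    show "pinv \<sigma> i \<in> {1..n}" "pinv \<sigma> (Suc i) \<in> {1..n}" "pinv \<sigma> (Suc j) \<in> {1..n}"
      using rng[of "length u"] rng[of "Suc (length u)"] rng[OF j(1)] n by (auto simp: i_def)
    show "\<sigma> (pinv \<sigma> (Suc i)) = Suc (\<sigma> (pinv \<sigma> i))"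
      using permutes_inverses(1)[OF p] by simp
    show "Suc (\<sigma> (pinv \<sigma> (Suc j))) = \<sigma> (pinv \<sigma> i) \<or> \<sigma> (pinv \<sigma> (Suc j)) = Suc (\<sigma> (pinv \<sigma> (Suc i)))"
      using permutes_inverses(1)[OF p] j(3) by simp
    show "pinv \<sigma> i < pinv \<sigma> (Suc j) \<and> pinv \<sigma> (Suc j) < pinv \<sigma> (Suc i) \<or>
        pinv \<sigma> (Suc i) < pinv \<sigma> (Suc j) \<and> pinv \<sigma> (Suc j) < pinv \<sigma> i"
      using between ac j(2) by linarith
  qed
  then have "simple_transp i \<circ> \<sigma> \<in> Sigma_L n P" by (rule simple_transp_Sigma_L[OF \<sigma> i])
  moreover have "word_of n (simple_transp i \<circ> \<sigma>) = u @ [c, a] @ v"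
    unfolding i_def by (rule word_of_simple_transp[OF p w])
  ultimately show ?thesis by (metis imageI)
qed

lemma knuth_class_Sigma_L:
  assumes P: "P \<in> RSP n" and "knuth_eq w w'"
  shows "w \<in> word_of n ` Sigma_L n P \<longleftrightarrow> w' \<in> word_of n ` Sigma_L n P"
proof (rule knuth_eq_invariant[OF assms(2)])
  fix w w' :: "int list"
  assume "knuth_step w w'"
  then show "w \<in> word_of n ` Sigma_L n P \<longleftrightarrow> w' \<in> word_of n ` Sigma_L n P"
  proof cases
    case (bac a b c u v)
    show ?thesis
    proof
      assume "w \<in> word_of n ` Sigma_L n P"
      then obtain \<sigma> where "\<sigma> \<in> Sigma_L n P" "word_of n \<sigma> = (u @ [b]) @ [a, c] @ v" using bac by auto
      from knuth_step_Sigma_L[OF P this, of b] show "w' \<in> word_of n ` Sigma_L n P" using bac by simp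
    next
      assume "w' \<in> word_of n ` Sigma_L n P"
      then obtain \<sigma> where "\<sigma> \<in> Sigma_L n P" "word_of n \<sigma> = (u @ [b]) @ [c, a] @ v" using bac by auto
      from knuth_step_Sigma_L[OF P this, of b] show "w \<in> word_of n ` Sigma_L n P" using bac by simp
    qed
  next
    case (acb a b c u v)
    show ?thesis
    proof
      assume "w \<in> word_of n ` Sigma_L n P"
      then obtain \<sigma> where \<sigma>: "\<sigma> \<in> Sigma_L n P" "word_of n \<sigma> = u @ [a, c] @ (b # v)" using acb by auto
      show "w' \<in> word_of n ` Sigma_L n P"
        using knuth_step_Sigma_L[OF P \<sigma>, of b] acb by simp
    next
      assume "w' \<in> word_of n ` Sigma_L n P"
      then obtain \<sigma> where \<sigma>: "\<sigma> \<in> Sigma_L n P" "word_of n \<sigma> = u @ [c, a] @ (b # v)" using acb by auto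
      show "w \<in> word_of n ` Sigma_L n P"
        using knuth_step_Sigma_L[OF P \<sigma>, of b] acb by simp
    qed
  qed
qed

section \<open>The group of quasisymmetric functions\<close>

lemma quasisymmetric_qs_fund:
  assumes "A \<subseteq> {1..<n}" shows "quasisymmetric (qs_fund n A)"
  unfolding quasisymmetric_def
proof (intro conjI allI impI)
  show "\<exists>d. \<forall>m. d < size m \<longrightarrow> qs_fund n A m = 0" by (intro exI[of _ n]) (simp add: qs_fund_def)
  fix m and h :: "nat \<Rightarrow> nat"
  assume h: "0 \<notin># m \<and> strict_mono_on (set_mset m) h \<and> 0 \<notin> h ` set_mset m"
  let ?xs = "sorted_list_of_multiset m"
  have len: "length ?xs = size m" by (metis mset_sorted_list_of_multiset size_mset)
  have mono: "h u < h v \<longleftrightarrow> u < v" if "u \<in># m" "v \<in># m" for u v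
    using h that strict_mono_on_less by blast
  have "sorted (map h ?xs)"
    unfolding sorted_wrt_iff_nth_less
  proof (intro allI impI)
    fix i j assume ij: "i < j" "j < length (map h ?xs)"
    have "?xs ! i \<in># m" "?xs ! j \<in># m"
      using ij nth_mem[of i ?xs] nth_mem[of j ?xs] by auto
    moreover have "?xs ! i \<le> ?xs ! j" using ij by (intro sorted_nth_mono) auto
    ultimately show "map h ?xs ! i \<le> map h ?xs ! j"
      using ij mono[of "?xs ! j" "?xs ! i"] by (simp add: not_less[symmetric])
  qed
  moreover have "mset (map h ?xs) = image_mset h m" by simp
  ultimately have eq: "sorted_list_of_multiset (image_mset h m) = map h ?xs"
    by (metis sorted_list_of_multiset_mset sorted_sort_id)
  have "(map h ?xs ! (j - 1) < map h ?xs ! j) \<longleftrightarrow> (?xs ! (j - 1) < ?xs ! j)" if "j \<in> A" "size m = n" for j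
  proof -
    have "j \<in> {1..<n}" using that assms by blast
    then have j: "j - 1 < length ?xs" "j < length ?xs" using that len by auto
    then have "?xs ! (j - 1) \<in># m" "?xs ! j \<in># m" using nth_mem[OF j(1)] nth_mem[OF j(2)] by auto
    then show ?thesis using mono j by simp
  qed
  then show "qs_fund n A (image_mset h m) = qs_fund n A m"
    using h by (auto simp: qs_fund_def eq)
qed (simp add: qs_fund_def)

lemma quasisymmetric_zero: "quasisymmetric (\<lambda>m. 0)"
  by (simp add: quasisymmetric_def)

lemma quasisymmetric_lincomb:
  assumes "quasisymmetric f" "quasisymmetric g"
  shows "quasisymmetric (\<lambda>m. a * f m + b * g m)"
proof -
  obtain d e where "\<forall>m. d < size m \<longrightarrow> f m = 0" "\<forall>m. e < size m \<longrightarrow> g m = 0"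
    using assms unfolding quasisymmetric_def by blast
  then have "\<forall>m. max d e < size m \<longrightarrow> a * f m + b * g m = 0" by simp
  then have "\<exists>d. \<forall>m. d < size m \<longrightarrow> a * f m + b * g m = 0" by blast
  then show ?thesis using assms unfolding quasisymmetric_def by auto
qed

lemma quasisymmetric_sum:
  "finite S \<Longrightarrow> (\<And>s. s \<in> S \<Longrightarrow> quasisymmetric (f s)) \<Longrightarrow> quasisymmetric (\<lambda>m. \<Sum>s\<in>S. c s * f s m)"
proof (induction rule: finite_induct)
  case (insert s S)
  then have "quasisymmetric (\<lambda>m. c s * f s m + 1 * (\<Sum>s\<in>S. c s * f s m))"
    by (intro quasisymmetric_lincomb) auto
  then show ?case using insert.hyps by simp
qed (simp add: quasisymmetric_zero)

lemma comm_group_QSym: "comm_group QSym"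
proof (rule comm_groupI)
  fix f assume "f \<in> carrier QSym"
  then have "quasisymmetric (\<lambda>m. (- 1) * f m + 0 * f m)"
    by (intro quasisymmetric_lincomb) (auto simp: QSym_def)
  then show "\<exists>g\<in>carrier QSym. g \<otimes>\<^bsub>QSym\<^esub> f = \<one>\<^bsub>QSym\<^esub>"
    by (intro bexI[of _ "\<lambda>m. - f m"]) (auto simp: QSym_def)
next
  fix f g assume "f \<in> carrier QSym" "g \<in> carrier QSym"
  then have "quasisymmetric (\<lambda>m. 1 * f m + 1 * g m)"
    by (intro quasisymmetric_lincomb) (auto simp: QSym_def)
  then show "f \<otimes>\<^bsub>QSym\<^esub> g \<in> carrier QSym" by (simp add: QSym_def)
qed (auto simp: QSym_def quasisymmetric_zero algebra_simps)

text \<open>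
The Moebius inverse of \<open>F\<close> over the lattice of finite sets, by recursion instead of a signed sum, so that
\<open>sum_subset_moebius\<close> is immediate.
\<close>

function subset_moebius :: "(nat set \<Rightarrow> series) \<Rightarrow> nat set \<Rightarrow> series" where
  "subset_moebius F I = (\<lambda>m. F I m - (if finite I then \<Sum>J\<in>{J. J \<subset> I}. subset_moebius F J m else 0))"
  by auto
termination
  by (relation "measure (\<lambda>(F, I). card I)") (auto intro: psubset_card_mono)

declare subset_moebius.simps [simp del]

lemma sum_subset_moebius:
  assumes "finite D" shows "(\<Sum>I\<in>Pow D. subset_moebius F I m) = F D m"
proof -
  have "Pow D = insert D {J. J \<subset> D}" by auto
  moreover have "finite {J. J \<subset> D}" using assms finite_subset[of "{J. J \<subset> D}" "Pow D"] by auto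
  ultimately have "(\<Sum>I\<in>Pow D. subset_moebius F I m) = subset_moebius F D m + (\<Sum>J\<in>{J. J \<subset> D}. subset_moebius F J m)"
    by simp
  then show ?thesis using assms by (simp add: subset_moebius.simps[of F D])
qed

lemma quasisymmetric_subset_moebius:
  assumes "finite D" "\<And>J. J \<subseteq> D \<Longrightarrow> quasisymmetric (F J)"
  shows "quasisymmetric (subset_moebius F D)"
  using assms
proof (induction D rule: finite_psubset_induct)
  case (psubset D)
  have fin: "finite {J. J \<subset> D}" using psubset.hyps finite_subset[of "{J. J \<subset> D}" "Pow D"] by auto
  have "quasisymmetric (\<lambda>m. \<Sum>J\<in>{J. J \<subset> D}. 1 * subset_moebius F J m)"
    by (rule quasisymmetric_sum[OF fin]) (use psubset in auto)
  then have "quasisymmetric (\<lambda>m. 1 * F D m + (- 1) * (\<Sum>J\<in>{J. J \<subset> D}. 1 * subset_moebius F J m))"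
    using psubset.prems by (intro quasisymmetric_lincomb) auto
  then show ?case using psubset.hyps by (simp add: subset_moebius.simps[of F D])
qed

section \<open>Parabolic idempotents of the 0-Hecke algebra\<close>

definition act_word :: "'v hecke_module \<Rightarrow> nat list \<Rightarrow> 'v \<Rightarrow> 'v" where
  "act_word M is = foldr (act M) is"

lemma act_word_Nil [simp]: "act_word M [] x = x"
  and act_word_Cons [simp]: "act_word M (i # is) x = act M i (act_word M is x)"
  and act_word_append: "act_word M (is @ js) x = act_word M is (act_word M js x)"
  by (simp_all add: act_word_def)

lemma hecke_act_closed:
  "is_hecke_module n M \<Longrightarrow> i \<in> {1..<n} \<Longrightarrow> x \<in> carrier M \<Longrightarrow> act M i x \<in> carrier M"
  by (auto simp: is_hecke_module_def hom_def)

lemma act_word_closed: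
  "is_hecke_module n M \<Longrightarrow> set is \<subseteq> {1..<n} \<Longrightarrow> x \<in> carrier M \<Longrightarrow> act_word M is x \<in> carrier M"
  by (induction "is") (auto intro: hecke_act_closed)

lemma hecke_act_idem:
  "is_hecke_module n M \<Longrightarrow> i \<in> {1..<n} \<Longrightarrow> x \<in> carrier M \<Longrightarrow> act M i (act M i x) = act M i x"
  by (simp add: is_hecke_module_def)

lemma hecke_act_braid:
  "is_hecke_module n M \<Longrightarrow> 1 \<le> i \<Longrightarrow> Suc i < n \<Longrightarrow> x \<in> carrier M \<Longrightarrow>
   act M (Suc i) (act M i (act M (Suc i) x)) = act M i (act M (Suc i) (act M i x))"
  by (simp add: is_hecke_module_def)

lemma hecke_act_comm:
  assumes "is_hecke_module n M" "i \<in> {1..<n}" "j \<in> {1..<n}" "i + 2 \<le> j \<or> j + 2 \<le> i" "x \<in> carrier M"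
  shows "act M i (act M j x) = act M j (act M i x)"
  using assms unfolding is_hecke_module_def by (elim disjE) (metis, metis)

lemma act_word_comm:
  assumes M: "is_hecke_module n M" and "i \<in> {1..<n}" "set is \<subseteq> {1..<n}" "x \<in> carrier M"
    "\<And>j. j \<in> set is \<Longrightarrow> i + 2 \<le> j \<or> j + 2 \<le> i"
  shows "act M i (act_word M is x) = act_word M is (act M i x)"
  using assms(2-)
proof (induction "is")
  case (Cons j js)
  have "act M i (act M j (act_word M js x)) = act M j (act M i (act_word M js x))"
    using Cons.prems act_word_closed[OF M] by (intro hecke_act_comm[OF M]) auto
  then show ?case using Cons by simp
qed simp

text \<open>
The longest interval \<open>[a, m]\<close> that ends in \<open>m\<close> and is contained in \<open>I\<close>.
\<close>

fun run :: "nat set \<Rightarrow> nat \<Rightarrow> nat list" where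
  "run I 0 = []"
| "run I (Suc k) = (if Suc k \<in> I then run I k @ [Suc k] else [])"

text \<open>
A reduced word of the longest element of the parabolic subgroup of \<open>I \<inter> {1..k}\<close>, written as a product of
runs that end in \<open>k\<close>, \<open>k - 1\<close>, and so on down to 1.
\<close>

fun long_word :: "nat set \<Rightarrow> nat \<Rightarrow> nat list" where
  "long_word I 0 = []"
| "long_word I (Suc k) = run I (Suc k) @ long_word I k"

lemma run_eq: "\<exists>a. 1 \<le> a \<and> a \<le> Suc m \<and> run I m = [a..<Suc m] \<and> {a..m} \<subseteq> I \<and> (a - 1 \<notin> I \<or> a = 1)"
proof (induction m)
  case 0
  show ?case by (intro exI[of _ 1]) auto
next
  case (Suc m)
  then obtain a where a: "1 \<le> a" "a \<le> Suc m" "run I m = [a..<Suc m]" "{a..m} \<subseteq> I" "a - 1 \<notin> I \<or> a = 1" by blast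
  show ?case
  proof (cases "Suc m \<in> I")
    case True
    then have "{a..Suc m} \<subseteq> I" using a(4) by (auto simp: le_Suc_eq)
    then show ?thesis using a True by (intro exI[of _ a]) auto
  next
    case False
    then show ?thesis by (intro exI[of _ "Suc (Suc m)"]) auto
  qed
qed

lemma set_long_word: "set (long_word I k) = I \<inter> {1..k}"
proof (induction k)
  case (Suc k)
  obtain a where a: "1 \<le> a" "a \<le> Suc (Suc k)" "run I (Suc k) = [a..<Suc (Suc k)]" "{a..Suc k} \<subseteq> I"
    using run_eq[of "Suc k" I] by blast
  have "Suc k \<in> I \<Longrightarrow> Suc k \<in> set (run I (Suc k))" by simp
  moreover have "set (run I (Suc k)) \<subseteq> I \<inter> {1..Suc k}" using a by auto
  moreover have "I \<inter> {1..Suc k} \<subseteq> insert (Suc k) {} \<inter> I \<union> I \<inter> {1..k}" by (auto simp: le_Suc_eq)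
  ultimately show ?case using Suc by auto
qed simp

text \<open>
In the 0-Hecke algebra the longest word of a parabolic subgroup absorbs its generators. Induction on
\<open>k\<close>: the run ending in \<open>k\<close> is applied to a vector \<open>y\<close> that all smaller generators fix. The first letter of the
run is absorbed by idempotency. A generator further inside the run is moved by a braid relation through
its place and comes out at \<open>y\<close> with its index lowered by one; a generator outside the run
commutes with it and reaches \<open>y\<close> directly.
\<close>

lemma act_absorb_long_word:
  assumes M: "is_hecke_module n M"
  shows "k < n \<Longrightarrow> i \<in> I \<Longrightarrow> 1 \<le> i \<Longrightarrow> i \<le> k \<Longrightarrow> x \<in> carrier M \<Longrightarrow>
    act M i (act_word M (long_word I k) x) = act_word M (long_word I k) x"
proof (induction k arbitrary: i)
  case (Suc k)
  define m where "m = Suc k"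
  obtain a where a: "1 \<le> a" "a \<le> Suc m" "run I m = [a..<Suc m]" "{a..m} \<subseteq> I" "a - 1 \<notin> I \<or> a = 1"
    using run_eq[of m I] by blast
  define y where "y = act_word M (long_word I k) x"
  have sub: "set (long_word I k) \<subseteq> {1..<n}" using Suc.prems(1) by (auto simp: set_long_word)
  have y: "y \<in> carrier M" unfolding y_def by (rule act_word_closed[OF M sub Suc.prems(5)])
  have E: "act_word M (long_word I m) x = act_word M [a..<Suc m] y"
    unfolding y_def m_def long_word.simps a(3)[unfolded m_def] act_word_append ..
  have IH: "act M j y = y" if "j \<in> I" "1 \<le> j" "j \<le> k" for j
    unfolding y_def using Suc.IH[of j] Suc.prems that by simp
  have rng: "set [u..<v] \<subseteq> {1..<n}" if "1 \<le> u" "v \<le> Suc m" for u v using that Suc.prems(1) by (auto simp: m_def)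
  consider "i = a" "a \<le> m" | "a < i" | "i < a" using Suc.prems(4) m_def by linarith
  then have "act M i (act_word M [a..<Suc m] y) = act_word M [a..<Suc m] y"
  proof cases
    case 1
    then have "[a..<Suc m] = a # [Suc a..<Suc m]" by (simp add: upt_conv_Cons del: upt_Suc)
    moreover have "act_word M [Suc a..<Suc m] y \<in> carrier M" using y a(1) by (intro act_word_closed[OF M] rng) auto
    ultimately show ?thesis
      using hecke_act_idem[OF M, of a] 1 Suc.prems by simp
  next
    case 2
    \<comment> \<open>The run is \<open>\<dots> p i \<dots>\<close> with \<open>i = p + 1\<close>. After \<open>i\<close> has moved to this place, the braid relation turns \<open>i p i\<close> into \<open>p i p\<close>, and the last \<open>p\<close> commutes with the rest of the run.\<close>
    define Z where "Z = act_word M [Suc i..<Suc m] y"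
    have Z: "Z \<in> carrier M" unfolding Z_def using y Suc.prems(3) by (intro act_word_closed[OF M] rng) auto
    obtain p where p: "i = Suc p" using 2 by (cases i) auto
    have p1: "1 \<le> p" "a \<le> p" using 2 a(1) p by auto
    have i: "i \<le> m" "i < n" using Suc.prems m_def by auto
    have split: "[a..<Suc m] = [a..<p] @ p # i # [Suc i..<Suc m]"
    proof -
      have "[a..<Suc m] = [a..<p] @ [p..<Suc m]" using p1 i p upt_add_eq_append[of a p "Suc m - p"] by simp
      also have "[p..<Suc m] = p # i # [Suc i..<Suc m]" using p i by (simp add: upt_conv_Cons del: upt_Suc)
      finally show ?thesis .
    qed
    have "act_word M [a..<Suc m] y = act_word M [a..<p] (act M p (act M i Z))"
      unfolding split act_word_append by (simp add: Z_def)
    moreover have "act M i (act_word M [a..<p] (act M p (act M i Z))) = act_word M [a..<p] (act M i (act M p (act M i Z)))"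
      using i p p1 a(1) Z by (intro act_word_comm[OF M]) (auto intro!: hecke_act_closed[OF M])
    moreover have "act M i (act M p (act M i Z)) = act M p (act M i (act M p Z))"
      using hecke_act_braid[OF M p1(1) _ Z] i p by simp
    moreover have "act M p Z = Z"
    proof -
      have "act M p Z = act_word M [Suc i..<Suc m] (act M p y)"
        unfolding Z_def using i p p1 y by (intro act_word_comm[OF M] rng) auto
      moreover have "p \<in> I" using a(4) p1 p i by auto
      moreover have "p \<le> k" using i p m_def by simp
      ultimately show ?thesis using IH p1 Z_def by simp
    qed
    ultimately show ?thesis by simp
  next
    case 3
    have "i \<noteq> a - 1" using a(5) Suc.prems(2,3) 3 by auto
    then have far: "i + 2 \<le> a" using 3 by simp
    have "act M i (act_word M [a..<Suc m] y) = act_word M [a..<Suc m] (act M i y)"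
      using Suc.prems a(1) far y by (intro act_word_comm[OF M] rng) (auto simp: m_def)
    moreover have "i \<le> k" using far a(2) m_def by simp
    ultimately show ?thesis using IH Suc.prems by simp
  qed
  then show ?case using E m_def by simp
qed simp

definition parabolic :: "nat \<Rightarrow> nat set \<Rightarrow> nat list" where
  "parabolic n I = long_word I (n - 1)"

lemma set_parabolic: "I \<subseteq> {1..<n} \<Longrightarrow> set (parabolic n I) = I"
  by (force simp: parabolic_def set_long_word)

lemma act_word_fixed:
  "(\<And>i. i \<in> set is \<Longrightarrow> act M i x = x) \<Longrightarrow> act_word M is x = x"
  by (induction "is") auto

lemma parabolic_idem:
  assumes M: "is_hecke_module n M" and I: "I \<subseteq> {1..<n}" and x: "x \<in> carrier M"
  shows "act_word M (parabolic n I) (act_word M (parabolic n I) x) = act_word M (parabolic n I) x"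
proof (rule act_word_fixed)
  fix i assume "i \<in> set (parabolic n I)"
  then have i: "i \<in> I" "1 \<le> i" "i \<le> n - 1" "n - 1 < n" using set_parabolic[OF I] subsetD[OF I, of i] by auto
  show "act M i (act_word M (parabolic n I) x) = act_word M (parabolic n I) x"
    unfolding parabolic_def by (rule act_absorb_long_word[OF M i(4) i(1-3) x])
qed

section \<open>Ranks of the parabolic idempotents\<close>

abbreviation sub_mod :: "'v hecke_module \<Rightarrow> 'v set \<Rightarrow> 'v hecke_module" where
  "sub_mod M N \<equiv> M\<lparr>carrier := N\<rparr>"

lemma hecke_vectorspace: "is_hecke_module n M \<Longrightarrow> vectorspace complex_ring M"
  by (simp add: is_hecke_module_def vectorspace_def field_from_type_algebra)

lemma carrier_complex_ring [simp]: "carrier complex_ring = UNIV"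
  by (simp add: ring_of_type_algebra_def)

lemma fd_fin_dim:
  assumes "is_fd_hecke_module n M"
  shows "vectorspace.fin_dim complex_ring M"
proof -
  have M: "is_hecke_module n M" using assms by (simp add: is_fd_hecke_module_def)
  interpret vectorspace complex_ring M by (rule hecke_vectorspace[OF M])
  obtain B where B: "finite B" "B \<subseteq> carrier M"
    "\<forall>x\<in>carrier M. \<exists>c. x = finsum M (\<lambda>b. c b \<odot>\<^bsub>M\<^esub> b) B"
    using assms by (auto simp: is_fd_hecke_module_def)
  have "span B = carrier M"
  proof
    show "span B \<subseteq> carrier M" using span_is_subset2[OF B(2)] .
    show "carrier M \<subseteq> span B"
    proof
      fix x assume "x \<in> carrier M"
      then obtain c where "x = finsum M (\<lambda>b. c b \<odot>\<^bsub>M\<^esub> b) B" using B(3) by blast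
      then have "x = lincomb c B" by (simp add: lincomb_def)
      then show "x \<in> span B" unfolding span_def using B(1) by auto
    qed
  qed
  then show ?thesis unfolding fin_dim_def using B by blast
qed

lemma dim_zero_space:
  assumes "vectorspace complex_ring M" "carrier M = {\<zero>\<^bsub>M\<^esub>}"
  shows "vectorspace.dim complex_ring M = 0"
proof -
  interpret vectorspace complex_ring M by fact
  have "span {} = carrier M"
  proof
    show "span {} \<subseteq> carrier M" by (rule span_is_subset2) simp
    show "carrier M \<subseteq> span {}"
    proof
      fix x assume "x \<in> carrier M"
      then have "x = lincomb (\<lambda>v. undefined) {}" using assms(2) by (simp add: lincomb_def)
      then show "x \<in> span {}" unfolding span_def by blast
    qed
  qed
  then have "card ({} :: 'a set) \<ge> dim" by (intro gen_ge_dim) auto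
  then show ?thesis by simp
qed

text \<open>
Besides being spanned by one vector, the space is nonzero, so its dimension is not 0.
\<close>

lemma dim_line:
  assumes "vectorspace complex_ring M" "v \<in> carrier M" "v \<noteq> \<zero>\<^bsub>M\<^esub>" "carrier M = {c \<odot>\<^bsub>M\<^esub> v | c. True}"
  shows "vectorspace.dim complex_ring M = 1"
proof -
  interpret vectorspace complex_ring M by fact
  have "span {v} = carrier M"
  proof
    show "span {v} \<subseteq> carrier M" by (rule span_is_subset2) (use assms in simp)
    show "carrier M \<subseteq> span {v}"
    proof
      fix x assume "x \<in> carrier M"
      then obtain c where "x = c \<odot>\<^bsub>M\<^esub> v" using assms(4) by blast
      then have "x = lincomb (\<lambda>_. c) {v}" using assms(2) by (simp add: lincomb_def)
      then show "x \<in> span {v}"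
        unfolding span_def by (intro CollectI exI[of _ "\<lambda>_. c"] exI[of _ "{v}"]) simp
    qed
  qed
  then have le: "dim \<le> 1" using gen_ge_dim[of "{v}"] assms(2) by simp
  have fd: "fin_dim" unfolding fin_dim_def by (intro exI[of _ "{v}"] conjI) (use \<open>span {v} = carrier M\<close> assms(2) in auto)
  have "dim \<noteq> 0"
  proof
    assume "dim = 0"
    obtain \<beta> where \<beta>: "finite \<beta>" "basis \<beta>" using finite_basis_exists[OF fd] by blast
    then have "\<beta> = {}" using dim_basis[OF \<beta>] \<open>dim = 0\<close> card_0_eq[OF \<beta>(1)] by metis
    then have "span {} = carrier M" using \<beta>(2) unfolding basis_def by blast
    then have "v \<in> span {}" using assms(2) by (simp only:)
    then obtain a A where "v = lincomb a A" "A \<subseteq> {}" unfolding span_def by blast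
    then show False using assms(3) by (simp add: lincomb_def)
  qed
  then show ?thesis using le by simp
qed

lemma hecke_act_hom:
  assumes M: "is_hecke_module n M" and i: "i \<in> {1..<n}"
  shows "act M i \<in> LinearCombinations.module_hom complex_ring M M"
  using assms unfolding is_hecke_module_def LinearCombinations.module_hom_def
  by (auto simp: hom_def)

lemma act_word_hom:
  assumes M: "is_hecke_module n M" and "set is \<subseteq> {1..<n}"
  shows "act_word M is \<in> LinearCombinations.module_hom complex_ring M M"
  using assms(2)
proof (induction "is")
  case Nil
  then show ?case by (simp add: LinearCombinations.module_hom_def act_word_def)
next
  case (Cons i "is")
  then have "act_word M is \<in> LinearCombinations.module_hom complex_ring M M"
    "act M i \<in> LinearCombinations.module_hom complex_ring M M"
    using hecke_act_hom[OF M, of i] by auto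
  then show ?case by (auto simp: LinearCombinations.module_hom_def Pi_def)
qed

lemma hecke_linear_map:
  assumes "is_hecke_module n A" "is_hecke_module n B" "f \<in> hecke_hom n A B"
  shows "linear_map complex_ring A B f"
  using assms hecke_vectorspace[OF assms(1)] hecke_vectorspace[OF assms(2)]
  by (auto simp: linear_map_def mod_hom_def mod_hom_axioms_def vectorspace_def hecke_hom_def
      LinearCombinations.module_hom_def hom_def)

lemma hecke_hom_act_word:
  assumes "is_hecke_module n A" "f \<in> hecke_hom n A B" "set is \<subseteq> {1..<n}" "x \<in> carrier A"
  shows "f (act_word A is x) = act_word B is (f x)"
  using assms(3)
proof (induction "is")
  case (Cons i "is")
  then have "act_word A is x \<in> carrier A" using act_word_closed[OF assms(1)] assms(4) by simp
  then show ?case using Cons assms(2) by (auto simp: hecke_hom_def)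
qed simp

text \<open>
The rank of the idempotent on \<open>M\<close> that belongs to the parabolic subgroup of \<open>I\<close>.
\<close>

definition rank_at :: "nat \<Rightarrow> nat set \<Rightarrow> 'v hecke_module \<Rightarrow> nat" where
  "rank_at n I M = vectorspace.dim complex_ring (sub_mod M (act_word M (parabolic n I) ` carrier M))"

context
  fixes n :: nat and I :: "nat set"
  assumes I: "I \<subseteq> {1..<n}"
begin

abbreviation "E M \<equiv> act_word M (parabolic n I)"

lemma E_linear_map:
  assumes "is_hecke_module n M" shows "linear_map complex_ring M M (E M)"
  using act_word_hom[OF assms, of "parabolic n I"] set_parabolic[OF I] I hecke_vectorspace[OF assms]
  by (auto simp: linear_map_def mod_hom_def mod_hom_axioms_def vectorspace_def)

lemma E_subspace:
  assumes "is_hecke_module n M" shows "subspace complex_ring (E M ` carrier M) M"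
proof -
  interpret linear_map complex_ring M M "E M" by (rule E_linear_map[OF assms])
  show ?thesis using imT_is_subspace by (simp add: im_def)
qed

lemma E_closed: "is_hecke_module n M \<Longrightarrow> x \<in> carrier M \<Longrightarrow> E M x \<in> carrier M"
  by (rule act_word_closed) (use set_parabolic[OF I] I in simp_all)

lemma E_vectorspace:
  assumes "is_hecke_module n M" shows "vectorspace complex_ring (sub_mod M (E M ` carrier M))"
  using vectorspace.subspace_is_vs[OF hecke_vectorspace[OF assms] E_subspace[OF assms]] .

lemma E_fin_dim:
  assumes "is_fd_hecke_module n M" shows "vectorspace.fin_dim complex_ring (sub_mod M (E M ` carrier M))"
proof -
  have M: "is_hecke_module n M" using assms by (simp add: is_fd_hecke_module_def)
  have l: "linear_map complex_ring M (sub_mod M (E M ` carrier M)) (E M)"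
    using E_linear_map[OF M] E_vectorspace[OF M]
    by (auto simp: linear_map_def mod_hom_def mod_hom_axioms_def vectorspace_def LinearCombinations.module_hom_def)
  show ?thesis by (rule linear_map.rank_nullity_main(2)[OF l fd_fin_dim[OF assms]]) simp
qed

text \<open>
Taking the image of an idempotent that commutes with module homomorphisms is an exact functor, so a
short exact sequence of modules yields one of the images, and dimensions are additive.
\<close>

lemma rank_at_additive:
  assumes fd: "is_fd_hecke_module n A" "is_fd_hecke_module n B" "is_fd_hecke_module n C"
    and se: "short_exact n A B C"
  shows "rank_at n I B = rank_at n I A + rank_at n I C"
proof -
  have M: "is_hecke_module n A" "is_hecke_module n B" "is_hecke_module n C"
    using fd by (auto simp: is_fd_hecke_module_def)
  obtain f g where f: "f \<in> hecke_hom n A B" and g: "g \<in> hecke_hom n B C"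
    and inj: "inj_on f (carrier A)" and ex: "f ` carrier A = a_kernel B C g" and surj: "g ` carrier B = carrier C"
    using se by (auto simp: short_exact_def)
  have nf: "f (E A x) = E B (f x)" if "x \<in> carrier A" for x
    using hecke_hom_act_word[OF M(1) f _ that] set_parabolic[OF I] I by simp
  have ng: "g (E B x) = E C (g x)" if "x \<in> carrier B" for x
    using hecke_hom_act_word[OF M(2) g _ that] set_parabolic[OF I] I by simp
  have fc: "f x \<in> carrier B" if "x \<in> carrier A" for x using f that by (auto simp: hecke_hom_def hom_def)
  have gc: "g x \<in> carrier C" if "x \<in> carrier B" for x using g that by (auto simp: hecke_hom_def hom_def)
  have idem: "E B (E B x) = E B x" if "x \<in> carrier B" for x
    by (rule parabolic_idem[OF M(2) I that])
  let ?A = "sub_mod A (E A ` carrier A)" and ?B = "sub_mod B (E B ` carrier B)" and ?C = "sub_mod C (E C ` carrier C)"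
  have lg: "linear_map complex_ring ?B ?C g"
    using E_vectorspace[OF M(2)] E_vectorspace[OF M(3)] g gc ng E_closed[OF M(2)] E_closed[OF M(3)]
    by (auto simp: linear_map_def mod_hom_def mod_hom_axioms_def vectorspace_def
        LinearCombinations.module_hom_def hecke_hom_def hom_def)
  have lf: "linear_map complex_ring ?A ?B f"
    using E_vectorspace[OF M(1)] E_vectorspace[OF M(2)] f fc nf E_closed[OF M(2)] E_closed[OF M(1)]
    by (auto simp: linear_map_def mod_hom_def mod_hom_axioms_def vectorspace_def
        LinearCombinations.module_hom_def hecke_hom_def hom_def)
  have img: "g ` E B ` carrier B = E C ` carrier C"
  proof -
    have "g ` E B ` carrier B = (\<lambda>x. E C (g x)) ` carrier B" unfolding image_image by (rule image_cong) (auto simp: ng)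
    also have "\<dots> = E C ` carrier C" using surj by (simp flip: surj add: image_image)
    finally show ?thesis .
  qed
  have kerg: "{v \<in> E B ` carrier B. g v = \<zero>\<^bsub>C\<^esub>} = f ` E A ` carrier A"
  proof
    show "{v \<in> E B ` carrier B. g v = \<zero>\<^bsub>C\<^esub>} \<subseteq> f ` E A ` carrier A"
    proof clarify
      fix x assume x: "x \<in> carrier B" "g (E B x) = \<zero>\<^bsub>C\<^esub>"
      then have "E B x \<in> a_kernel B C g" using E_closed[OF M(2) x(1)] by (simp add: a_kernel_def')
      then obtain y where y: "y \<in> carrier A" "E B x = f y" using ex by auto
      then have "E B x = f (E A y)" using nf[OF y(1)] idem[OF x(1)] by simp
      then show "E B x \<in> f ` E A ` carrier A" using y(1) by blast
    qed
    show "f ` E A ` carrier A \<subseteq> {v \<in> E B ` carrier B. g v = \<zero>\<^bsub>C\<^esub>}"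
    proof clarify
      fix x assume x: "x \<in> carrier A"
      have "f (E A x) \<in> a_kernel B C g" using ex E_closed[OF M(1) x] by blast
      then show "f (E A x) \<in> E B ` carrier B \<and> g (f (E A x)) = \<zero>\<^bsub>C\<^esub>"
        using nf[OF x] fc[OF x] by (auto simp: a_kernel_def')
    qed
  qed
  have kerf: "{v \<in> E A ` carrier A. f v = \<zero>\<^bsub>B\<^esub>} = {\<zero>\<^bsub>A\<^esub>}"
  proof -
    interpret lf0: linear_map complex_ring A B f by (rule hecke_linear_map[OF M(1,2) f])
    interpret vA: vectorspace complex_ring ?A by (rule E_vectorspace[OF M(1)])
    have "\<zero>\<^bsub>A\<^esub> \<in> E A ` carrier A" using vA.M.zero_closed by simp
    moreover have "v = \<zero>\<^bsub>A\<^esub>" if "v \<in> E A ` carrier A" "f v = \<zero>\<^bsub>B\<^esub>" for v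
    proof -
      have "v \<in> carrier A" using that(1) E_closed[OF M(1)] by auto
      then show ?thesis using inj_onD[OF inj, of v "\<zero>\<^bsub>A\<^esub>"] that(2) lf0.f0_is_0 by simp
    qed
    ultimately show ?thesis using lf0.f0_is_0 by blast
  qed
  have rg: "vectorspace.dim complex_ring (sub_mod C (E C ` carrier C)) +
      vectorspace.dim complex_ring (sub_mod B (f ` E A ` carrier A)) = rank_at n I B"
    using linear_map.rank_nullity[OF lg E_fin_dim[OF fd(2)]]
      mod_hom.im_def[of complex_ring ?B ?C g] mod_hom.ker_def[of complex_ring ?B ?C g] lg
    by (simp add: linear_map_def img kerg rank_at_def)
  have rf: "vectorspace.dim complex_ring (sub_mod B (f ` E A ` carrier A)) +
      vectorspace.dim complex_ring (sub_mod A {\<zero>\<^bsub>A\<^esub>}) = rank_at n I A"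
    using linear_map.rank_nullity[OF lf E_fin_dim[OF fd(1)]]
      mod_hom.im_def[of complex_ring ?A ?B f] mod_hom.ker_def[of complex_ring ?A ?B f] lf
    by (simp add: linear_map_def kerf rank_at_def)
  have "vectorspace.dim complex_ring (sub_mod A {\<zero>\<^bsub>A\<^esub>}) = 0"
  proof (rule dim_zero_space)
    interpret lf: linear_map complex_ring ?A ?B f by (rule lf)
    have "subspace complex_ring {\<zero>\<^bsub>A\<^esub>} ?A" using lf.kerT_is_subspace by (simp add: lf.ker_def kerf)
    from vectorspace.subspace_is_vs[OF E_vectorspace[OF M(1)] this]
    show "vectorspace complex_ring (sub_mod A {\<zero>\<^bsub>A\<^esub>})" by simp
  qed simp
  then show ?thesis using rg rf by (simp add: rank_at_def)
qed

text \<open>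
On a one-dimensional module a word acts as 1 if none of its letters acts as 0, and as 0
otherwise.
\<close>

lemma rank_at_irr:
  assumes "is_irr_module n \<alpha> M"
  shows "rank_at n I M = (if I \<inter> comp_set \<alpha> = {} then 1 else 0)"
proof -
  have M: "is_hecke_module n M" using assms by (simp add: is_irr_module_def)
  interpret vectorspace complex_ring M by (rule hecke_vectorspace[OF M])
  interpret lE: linear_map complex_ring M M "E M" by (rule E_linear_map[OF M])
  obtain v where v: "v \<in> carrier M" "v \<noteq> \<zero>\<^bsub>M\<^esub>" "carrier M = {c \<odot>\<^bsub>M\<^esub> v | c. True}"
    and av: "\<And>i. i \<in> {1..<n} \<Longrightarrow> act M i v = (if i \<in> comp_set \<alpha> then \<zero>\<^bsub>M\<^esub> else v)"
    using assms by (auto simp: is_irr_module_def)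
  have az: "act M i \<zero>\<^bsub>M\<^esub> = \<zero>\<^bsub>M\<^esub>" if "i \<in> {1..<n}" for i
  proof -
    interpret l: mod_hom complex_ring M M "act M i"
      by (simp add: mod_hom_def mod_hom_axioms_def hecke_act_hom[OF M that] module_axioms)
    show ?thesis by (rule l.f0_is_0)
  qed
  have w: "act_word M is v = (if set is \<inter> comp_set \<alpha> = {} then v else \<zero>\<^bsub>M\<^esub>)" if "set is \<subseteq> {1..<n}" for "is"
    using that by (induction "is") (auto simp: av az)
  have Ev: "E M v = (if I \<inter> comp_set \<alpha> = {} then v else \<zero>\<^bsub>M\<^esub>)"
    using w[of "parabolic n I"] set_parabolic[OF I] I by simp
  have Ec: "E M (c \<odot>\<^bsub>M\<^esub> v) = c \<odot>\<^bsub>M\<^esub> E M v" for c using lE.f_smult v(1) by simp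
  show ?thesis
  proof (cases "I \<inter> comp_set \<alpha> = {}")
    case True
    have "E M x = x" if "x \<in> carrier M" for x using that Ec Ev True v(3) by auto
    then have "E M ` carrier M = carrier M" by simp
    then have "rank_at n I M = vectorspace.dim complex_ring M" by (simp add: rank_at_def)
    also have "\<dots> = 1" by (rule dim_line[OF hecke_vectorspace[OF M] v])
    finally show ?thesis using True by simp
  next
    case False
    have "E M x = \<zero>\<^bsub>M\<^esub>" if "x \<in> carrier M" for x using that Ec Ev False v(3) by auto
    then have im: "E M ` carrier M = {\<zero>\<^bsub>M\<^esub>}" using v(1) by auto
    have "rank_at n I M = 0"
      unfolding rank_at_def im
      by (rule dim_zero_space) (use E_vectorspace[OF M] im in simp_all)
    then show ?thesis using False by simp
  qed
qed

end

section \<open>Existence of the quasisymmetric characteristic\<close>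

text \<open>
The characteristic in terms of ranks. The ranks are additive in \<open>M\<close>; on \<open>\<^bold>F\<^sub>\<alpha>\<close> they select the subsets \<open>I\<close> of
the complement of \<open>set(\<alpha>)\<close>, over which the Moebius inverses add up to \<open>F\<^sub>\<alpha>\<close>.
\<close>

definition char_series :: "nat \<Rightarrow> 'v hecke_module \<Rightarrow> series" where
  "char_series n M = (\<lambda>m. \<Sum>I\<in>Pow {1..<n}. int (rank_at n I M) *
     subset_moebius (\<lambda>D. qs_fund n ({1..<n} - D)) I m)"

lemma quasisymmetric_char_series: "quasisymmetric (char_series n M)"
  unfolding char_series_def
  by (intro quasisymmetric_sum quasisymmetric_subset_moebius quasisymmetric_qs_fund)
    (auto intro: finite_subset[OF _ finite_atLeastLessThan])

lemma char_series_additive: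
  assumes "is_fd_hecke_module n A" "is_fd_hecke_module n B" "is_fd_hecke_module n C" "short_exact n A B C"
  shows "char_series n B m = char_series n A m + char_series n C m"
  unfolding char_series_def sum.distrib[symmetric]
  by (rule sum.cong) (use rank_at_additive[OF _ assms] in \<open>auto simp: algebra_simps\<close>)

lemma comp_set_subset: "composition_of n \<alpha> \<Longrightarrow> comp_set \<alpha> \<subseteq> {1..<n}"
proof
  fix j assume \<alpha>: "composition_of n \<alpha>" and "j \<in> comp_set \<alpha>"
  then obtain k where k: "1 \<le> k" "k < length \<alpha>" "j = sum_list (take k \<alpha>)" by (auto simp: comp_set_def)
  have pos: "0 < sum_list xs" if "xs \<noteq> []" "set xs \<subseteq> set \<alpha>" for xs
    using that \<alpha> by (cases xs) (auto simp: composition_of_def intro: gr0I)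
  have "n = j + sum_list (drop k \<alpha>)"
    using \<alpha> k(3) by (metis append_take_drop_id composition_of_def sum_list_append)
  moreover have "0 < j" unfolding k(3) using k by (intro pos) (auto dest: in_set_takeD)
  moreover have "0 < sum_list (drop k \<alpha>)" using k by (intro pos) (auto dest: in_set_dropD)
  ultimately show "j \<in> {1..<n}" by simp
qed

lemma char_series_irr:
  assumes "composition_of n \<alpha>" "is_irr_module n \<alpha> M"
  shows "char_series n M = fundamental \<alpha>"
proof
  fix m
  let ?D = "{1..<n} - comp_set \<alpha>" and ?G = "subset_moebius (\<lambda>D. qs_fund n ({1..<n} - D))"
  have "char_series n M m = (\<Sum>I\<in>Pow {1..<n}. if I \<in> Pow ?D then ?G I m else 0)"
    unfolding char_series_def
  proof (rule sum.cong)
    fix I assume I: "I \<in> Pow {1..<n}"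
    then have "I \<inter> comp_set \<alpha> = {} \<longleftrightarrow> I \<in> Pow ?D" by auto
    then show "int (rank_at n I M) * ?G I m = (if I \<in> Pow ?D then ?G I m else 0)"
      using rank_at_irr[OF _ assms(2), of I] I by simp
  qed simp
  also have "\<dots> = (\<Sum>I\<in>Pow {1..<n} \<inter> Pow ?D. ?G I m)"
    by (rule sum.inter_restrict[symmetric]) simp
  also have "Pow {1..<n} \<inter> Pow ?D = Pow ?D" by auto
  also have "(\<Sum>I\<in>Pow ?D. ?G I m) = qs_fund n ({1..<n} - ?D) m" by (rule sum_subset_moebius) simp
  also have "{1..<n} - ?D = comp_set \<alpha>" using comp_set_subset[OF assms(1)] by auto
  finally show "char_series n M m = fundamental \<alpha> m"
    using assms(1) by (simp add: fundamental_eq_qs_fund composition_of_def)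
qed

lemma irr_module_fd:
  assumes "is_irr_module n \<alpha> M" shows "is_fd_hecke_module n M"
proof -
  have M: "is_hecke_module n M" using assms by (simp add: is_irr_module_def)
  interpret vectorspace complex_ring M by (rule hecke_vectorspace[OF M])
  obtain v where v: "v \<in> carrier M" "carrier M = {c \<odot>\<^bsub>M\<^esub> v | c. True}"
    using assms by (auto simp: is_irr_module_def)
  have "\<exists>c. x = finsum M (\<lambda>b. c b \<odot>\<^bsub>M\<^esub> b) {v}" if x: "x \<in> carrier M" for x
  proof -
    obtain c where "x = c \<odot>\<^bsub>M\<^esub> v" using x v(2) by blast
    then show ?thesis using v(1) by (intro exI[of _ "\<lambda>_. c"]) simp
  qed
  then show ?thesis unfolding is_fd_hecke_module_def using M v(1) by (intro conjI exI[of _ "{v}"]) auto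
qed

lemma ses_relations_carrier: "ses_relations n \<subseteq> carrier (free_module_group n)"
  by (auto simp: ses_relations_def free_module_group_def dest!: subsetD[OF keys_diff])

lemma free_module_comm_group: "comm_group (free_module_group n)"
  by (simp add: free_module_group_def abelian_free_Abelian_group)

lemma normal_ses:
  "generate (free_module_group n) (ses_relations n) \<lhd> free_module_group n"
proof -
  interpret comm_group "free_module_group n" by (rule free_module_comm_group)
  show ?thesis by (rule subgroup_imp_normal[OF generate_is_subgroup[OF ses_relations_carrier]])
qed

text \<open>
The additive invariant \<open>char_series\<close> extends to the free abelian group on all modules and vanishes on
the relations from short exact sequences, so it descends to the Grothendieck group.
\<close>

theorem ex_qs_characteristic: "\<exists>ch. is_qs_characteristic n (ch :: ('v hecke_module \<Rightarrow>\<^sub>0 int) set \<Rightarrow> series)"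
proof -
  let ?G = "free_module_group n :: ('v hecke_module \<Rightarrow>\<^sub>0 int) monoid"
  let ?N = "generate ?G (ses_relations n)"
  interpret Q: comm_group QSym by (rule comm_group_QSym)
  interpret G: comm_group ?G by (rule free_module_comm_group)
  have "char_series n ` {M :: 'v hecke_module. is_fd_hecke_module n M} \<subseteq> carrier QSym"
    using quasisymmetric_char_series by (auto simp: QSym_def)
  then obtain h where h: "h \<in> hom ?G QSym"
    and hf: "\<And>M :: 'v hecke_module. is_fd_hecke_module n M \<Longrightarrow> h (frag_of M) = char_series n M"
    unfolding free_module_group_def using Q.free_Abelian_group_universal by (metis mem_Collect_eq)
  interpret h: group_hom ?G QSym h by unfold_locales (rule h)
  have "ses_relations n \<subseteq> kernel ?G QSym h"
  proof
    fix r :: "'v hecke_module \<Rightarrow>\<^sub>0 int" assume r: "r \<in> ses_relations n"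
    then obtain A B C where rr: "r = frag_of B - frag_of A - frag_of C"
      and fd: "is_fd_hecke_module n A" "is_fd_hecke_module n B" "is_fd_hecke_module n C" "short_exact n A B C"
      by (auto simp: ses_relations_def)
    have c: "r \<in> carrier ?G" "frag_of A \<in> carrier ?G" "frag_of C \<in> carrier ?G"
      using subsetD[OF ses_relations_carrier r] fd by (simp_all add: free_module_group_def)
    have "frag_of B = r \<otimes>\<^bsub>?G\<^esub> (frag_of A \<otimes>\<^bsub>?G\<^esub> frag_of C)"
      by (simp add: rr free_module_group_def)
    then have "h (frag_of B) = h r \<otimes>\<^bsub>QSym\<^esub> (h (frag_of A) \<otimes>\<^bsub>QSym\<^esub> h (frag_of C))"
      using c by simp
    then have "char_series n B = (\<lambda>m. h r m + (char_series n A m + char_series n C m))"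
      using hf fd by (simp add: QSym_def)
    then have "h r = (\<lambda>m. 0)" using char_series_additive[OF fd] by (auto simp: fun_eq_iff)
    then show "r \<in> kernel ?G QSym h" using c(1) by (simp add: kernel_def QSym_def)
  qed
  then have "?N \<subseteq> kernel ?G QSym h" by (rule G.generate_subgroup_incl[OF _ h.subgroup_kernel])
  then obtain g where g: "g \<in> hom (?G Mod ?N) QSym" "\<And>x. x \<in> carrier ?G \<Longrightarrow> g (?N #>\<^bsub>?G\<^esub> x) = h x"
    using h.FactGroup_universal_kernel[OF normal_ses] by blast
  have "is_qs_characteristic n g"
    unfolding is_qs_characteristic_def grothendieck_group_def
  proof (intro conjI allI impI g(1))
    fix \<alpha> and M :: "'v hecke_module" assume M: "composition_of n \<alpha> \<and> is_irr_module n \<alpha> M"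
    then have fd: "is_fd_hecke_module n M" using irr_module_fd by blast
    then have "g (module_class n M) = h (frag_of M)"
      unfolding module_class_def by (intro g(2)) (simp add: free_module_group_def)
    then show "g (module_class n M) = fundamental \<alpha>" using hf[OF fd] char_series_irr[of n \<alpha> M] M by simp
  qed
  then show ?thesis by blast
qed

lemma qs_char_characteristic:
  "is_qs_characteristic n (qs_char n :: ('v hecke_module \<Rightarrow>\<^sub>0 int) set \<Rightarrow> series)"
  unfolding qs_char_def by (rule someI_ex[OF ex_qs_characteristic])

definition qch :: "nat \<Rightarrow> 'v hecke_module \<Rightarrow> series" where
  "qch n M = qs_char n (module_class n M)"

lemma qch_irr: "composition_of n \<alpha> \<Longrightarrow> is_irr_module n \<alpha> M \<Longrightarrow> qch n M = fundamental \<alpha>"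
  using qs_char_characteristic by (auto simp: qch_def is_qs_characteristic_def)

lemma qch_additive:
  fixes A B C :: "'v hecke_module"
  assumes fd: "is_fd_hecke_module n A" "is_fd_hecke_module n B" "is_fd_hecke_module n C" "short_exact n A B C"
  shows "qch n B m = qch n A m + qch n C m"
proof -
  let ?G = "free_module_group n :: ('v hecke_module \<Rightarrow>\<^sub>0 int) monoid"
  let ?N = "generate ?G (ses_relations n)"
  interpret G: comm_group ?G by (rule free_module_comm_group)
  interpret N: normal ?N ?G by (rule normal_ses)
  have c: "frag_of A \<in> carrier ?G" "frag_of B \<in> carrier ?G" "frag_of C \<in> carrier ?G"
    using fd by (auto simp: free_module_group_def)
  have "frag_of B - frag_of A - frag_of C \<in> ses_relations n"
    using fd unfolding ses_relations_def by blast
  then have r: "frag_of B - frag_of A - frag_of C \<in> ?N" by (rule generate.incl)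
  have eq: "frag_of B = (frag_of B - frag_of A - frag_of C) \<otimes>\<^bsub>?G\<^esub> (frag_of A \<otimes>\<^bsub>?G\<^esub> frag_of C)"
    by (simp add: free_module_group_def)
  have "frag_of B \<in> ?N #>\<^bsub>?G\<^esub> (frag_of A \<otimes>\<^bsub>?G\<^esub> frag_of C)"
    unfolding r_coset_def using r eq by blast
  then have "?N #>\<^bsub>?G\<^esub> frag_of B = ?N #>\<^bsub>?G\<^esub> (frag_of A \<otimes>\<^bsub>?G\<^esub> frag_of C)"
    using G.repr_independence[OF _ _ N.subgroup_axioms] c by simp
  also have "\<dots> = (?N #>\<^bsub>?G\<^esub> frag_of A) <#>\<^bsub>?G\<^esub> (?N #>\<^bsub>?G\<^esub> frag_of C)"
    using N.rcos_sum[OF c(1,3)] by simp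
  finally have "module_class n B = module_class n A \<otimes>\<^bsub>grothendieck_group n\<^esub> module_class n C"
    by (simp add: module_class_def grothendieck_group_def FactGroup_def)
  moreover have "module_class n A \<in> carrier (grothendieck_group n)" "module_class n C \<in> carrier (grothendieck_group n)"
    using c unfolding module_class_def grothendieck_group_def FactGroup_def RCOSETS_def by auto
  moreover have "qs_char n \<in> hom (grothendieck_group n :: ('v hecke_module \<Rightarrow>\<^sub>0 int) set monoid) QSym"
    using qs_char_characteristic by (auto simp: is_qs_characteristic_def)
  ultimately have "qch n B = qch n A \<otimes>\<^bsub>QSym\<^esub> qch n C"
    by (simp add: qch_def hom_mult)
  then show ?thesis by (simp add: QSym_def)
qed

section \<open>The left weak order\<close>

text \<open>
Acting on the inverse permutation, \<open>\<pi>\<^sub>i\<close> works on the places \<open>i\<close> and \<open>i + 1\<close> of the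
one-line notation: it is a step of bubble sort. In this form its relations are comparisons of
at most four values.
\<close>

definition swap_ascent :: "nat \<Rightarrow> (nat \<Rightarrow> nat) \<Rightarrow> nat \<Rightarrow> nat" where
  "swap_ascent i \<tau> = (if \<tau> (Suc i) < \<tau> i then \<tau> else \<tau> \<circ> simple_transp i)"

lemma swap_ascent_idem: "swap_ascent i (swap_ascent i \<tau>) = swap_ascent i \<tau>"
  by (auto simp: swap_ascent_def fun_eq_iff transpose_def)

lemma swap_ascent_comm: "i + 2 \<le> j \<Longrightarrow> swap_ascent i (swap_ascent j \<tau>) = swap_ascent j (swap_ascent i \<tau>)"
  by (auto simp: swap_ascent_def fun_eq_iff transpose_def)

lemma swap_ascent_braid:
  assumes "inj \<tau>"
  shows "swap_ascent i (swap_ascent (Suc i) (swap_ascent i \<tau>)) = swap_ascent (Suc i) (swap_ascent i (swap_ascent (Suc i) \<tau>))"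
proof -
  have "\<tau> i \<noteq> \<tau> (Suc i)" "\<tau> i \<noteq> \<tau> (Suc (Suc i))" "\<tau> (Suc i) \<noteq> \<tau> (Suc (Suc i))"
    using injD[OF assms, of i "Suc i"] injD[OF assms, of i "Suc (Suc i)"] injD[OF assms, of "Suc i" "Suc (Suc i)"]
    by auto
  then show ?thesis
    by (cases "\<tau> (Suc i) < \<tau> i"; cases "\<tau> (Suc (Suc i)) < \<tau> (Suc i)"; cases "\<tau> (Suc (Suc i)) < \<tau> i")
      (auto simp: swap_ascent_def fun_eq_iff transpose_def)
qed

text \<open>
The action of \<open>\<pi>\<^sub>i\<close> on the basis of the regular representation: a step upwards in the left weak
order, or none.
\<close>

definition ascend :: "nat \<Rightarrow> nat \<Rightarrow> (nat \<Rightarrow> nat) \<Rightarrow> nat \<Rightarrow> nat" where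
  "ascend n i \<gamma> = (if i \<in> Des_L n \<gamma> then \<gamma> else simple_transp i \<circ> \<gamma>)"

definition ascend_word :: "nat \<Rightarrow> nat list \<Rightarrow> (nat \<Rightarrow> nat) \<Rightarrow> nat \<Rightarrow> nat" where
  "ascend_word n is = foldr (ascend n) is"

lemma ascend_word_Nil [simp]: "ascend_word n [] \<gamma> = \<gamma>"
  and ascend_word_Cons [simp]: "ascend_word n (i # is) \<gamma> = ascend n i (ascend_word n is \<gamma>)"
  by (simp_all add: ascend_word_def)

lemma ascend_permutes: "\<gamma> permutes {1..n} \<Longrightarrow> i \<in> {1..<n} \<Longrightarrow> ascend n i \<gamma> permutes {1..n}"
  using permutes_simple_transp[of \<gamma> n i] by (simp add: ascend_def)

lemma ascend_word_permutes: "\<gamma> permutes {1..n} \<Longrightarrow> set is \<subseteq> {1..<n} \<Longrightarrow> ascend_word n is \<gamma> permutes {1..n}"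
  by (induction "is") (auto simp del: One_nat_def intro: ascend_permutes)

lemma pinv_ascend:
  assumes "\<gamma> permutes {1..n}" "i \<in> {1..<n}"
  shows "pinv (ascend n i \<gamma>) = swap_ascent i (pinv \<gamma>)"
  using assms inv_simple_transp_comp[OF assms(1), of i]
  by (auto simp: ascend_def swap_ascent_def Des_L_iff fun_eq_iff)

lemma permutes_pinv_eqD:
  assumes "\<gamma> permutes {1..n}" "\<delta> permutes {1..n}" "pinv \<gamma> = pinv \<delta>"
  shows "\<gamma> = \<delta>"
  by (metis assms permutes_inv_inv)

lemma ascend_idem:
  assumes "\<gamma> permutes {1..n}" "i \<in> {1..<n}"
  shows "ascend n i (ascend n i \<gamma>) = ascend n i \<gamma>"
  by (rule permutes_pinv_eqD[of _ n]) (use assms in \<open>simp_all del: One_nat_def add: ascend_permutes pinv_ascend swap_ascent_idem\<close>)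

lemma ascend_comm:
  assumes "\<gamma> permutes {1..n}" "i \<in> {1..<n}" "j \<in> {1..<n}" "i + 2 \<le> j"
  shows "ascend n i (ascend n j \<gamma>) = ascend n j (ascend n i \<gamma>)"
  by (rule permutes_pinv_eqD[of _ n]) (use assms in \<open>simp_all del: One_nat_def add: ascend_permutes pinv_ascend swap_ascent_comm[OF assms(4)]\<close>)

lemma ascend_braid:
  assumes "\<gamma> permutes {1..n}" "1 \<le> i" "Suc i < n"
  shows "ascend n i (ascend n (Suc i) (ascend n i \<gamma>)) = ascend n (Suc i) (ascend n i (ascend n (Suc i) \<gamma>))"
  by (rule permutes_pinv_eqD[of _ n])
    (use assms permutes_inj[OF permutes_inv[OF assms(1)]] in \<open>simp_all del: One_nat_def add: ascend_permutes pinv_ascend swap_ascent_braid\<close>)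

lemma Invs_ascend:
  assumes "\<gamma> permutes {1..n}" "i \<in> {1..<n}"
  shows "Invs n \<gamma> \<subseteq> Invs n (ascend n i \<gamma>)" "ascend n i \<gamma> = \<gamma> \<or> card (Invs n \<gamma>) < card (Invs n (ascend n i \<gamma>))"
proof -
  consider "i \<in> Des_L n \<gamma>" | "i \<notin> Des_L n \<gamma>" "pinv \<gamma> i < pinv \<gamma> (Suc i)"
    using inv_values_neq[OF assms(1), of i] Des_L_iff[OF assms(1), of i] assms(2) by force
  then have "Invs n \<gamma> \<subseteq> Invs n (ascend n i \<gamma>) \<and> (ascend n i \<gamma> = \<gamma> \<or> card (Invs n \<gamma>) < card (Invs n (ascend n i \<gamma>)))"
  proof cases
    case 2
    then have "ascend n i \<gamma> = simple_transp i \<circ> \<gamma>" by (simp add: ascend_def)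
    then have "Invs n \<gamma> \<subset> Invs n (ascend n i \<gamma>)" using Invs_step(1)[OF assms 2(2)] by auto
    then show ?thesis using psubset_card_mono[OF finite_Invs] by blast
  qed (simp add: ascend_def)
  then show "Invs n \<gamma> \<subseteq> Invs n (ascend n i \<gamma>)" "ascend n i \<gamma> = \<gamma> \<or> card (Invs n \<gamma>) < card (Invs n (ascend n i \<gamma>))" by auto
qed

lemma Invs_ascend_word:
  assumes "\<gamma> permutes {1..n}" "set is \<subseteq> {1..<n}"
  shows "Invs n \<gamma> \<subseteq> Invs n (ascend_word n is \<gamma>) \<and> (ascend_word n is \<gamma> = \<gamma> \<or> card (Invs n \<gamma>) < card (Invs n (ascend_word n is \<gamma>)))"
  using assms(2)
proof (induction "is")
  case (Cons i "is")
  let ?\<delta> = "ascend_word n is \<gamma>"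
  have \<delta>: "?\<delta> permutes {1..n}" "i \<in> {1..<n}" using ascend_word_permutes[OF assms(1)] Cons.prems by auto
  have IH: "Invs n \<gamma> \<subseteq> Invs n ?\<delta>" "?\<delta> = \<gamma> \<or> card (Invs n \<gamma>) < card (Invs n ?\<delta>)" using Cons by auto
  have step: "Invs n ?\<delta> \<subseteq> Invs n (ascend n i ?\<delta>)" "ascend n i ?\<delta> = ?\<delta> \<or> card (Invs n ?\<delta>) < card (Invs n (ascend n i ?\<delta>))"
    using Invs_ascend[OF \<delta>] by auto
  show ?case unfolding ascend_word_Cons
  proof
    show "Invs n \<gamma> \<subseteq> Invs n (ascend n i ?\<delta>)" using IH(1) step(1) by (rule subset_trans)
    show "ascend n i ?\<delta> = \<gamma> \<or> card (Invs n \<gamma>) < card (Invs n (ascend n i ?\<delta>))"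
      using IH(2) step(2) by (metis order.strict_trans)
  qed
qed simp

text \<open>
An ascending path that has left \<open>S\<close> never returns to \<open>S\<close>. So it makes no difference whether the terms outside
\<open>S\<close> are discarded after every step or at the end, which is why the truncated action on \<open>S\<close> satisfies the
relations of the 0-Hecke algebra.
\<close>

definition hconvex :: "nat \<Rightarrow> (nat \<Rightarrow> nat) set \<Rightarrow> bool" where
  "hconvex n S \<longleftrightarrow> (\<forall>\<epsilon>\<in>S. \<epsilon> permutes {1..n}) \<and> (\<forall>\<epsilon>\<in>S. \<forall>is js. set is \<subseteq> {1..<n} \<and> set js \<subseteq> {1..<n} \<and>
     ascend_word n js (ascend_word n is \<epsilon>) \<in> S \<longrightarrow> ascend_word n is \<epsilon> \<in> S)"

text \<open>
Inversion sets grow along ascending paths.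
\<close>

lemma hconvexI:
  assumes "\<And>\<epsilon>. \<epsilon> \<in> S \<Longrightarrow> \<epsilon> permutes {1..n}"
    "\<And>\<epsilon> \<delta> \<delta>'. \<epsilon> \<in> S \<Longrightarrow> \<delta>' \<in> S \<Longrightarrow> \<delta> permutes {1..n} \<Longrightarrow> Invs n \<epsilon> \<subseteq> Invs n \<delta> \<Longrightarrow> Invs n \<delta> \<subseteq> Invs n \<delta>' \<Longrightarrow> \<delta> \<in> S"
  shows "hconvex n S"
  unfolding hconvex_def
proof (intro conjI ballI allI impI)
  fix \<epsilon> "is" js assume e: "\<epsilon> \<in> S" and *: "set is \<subseteq> {1..<n} \<and> set js \<subseteq> {1..<n} \<and> ascend_word n js (ascend_word n is \<epsilon>) \<in> S"
  have p: "ascend_word n is \<epsilon> permutes {1..n}" using ascend_word_permutes assms(1)[OF e] * by blast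
  show "ascend_word n is \<epsilon> \<in> S"
    using assms(2)[OF e _ p, of "ascend_word n js (ascend_word n is \<epsilon>)"] * Invs_ascend_word[OF assms(1)[OF e], of "is"] Invs_ascend_word[OF p, of js]
    by blast
qed (rule assms(1))

lemma hconvexD:
  assumes "hconvex n S" "\<epsilon> \<in> S" "set is \<subseteq> {1..<n}" "set js \<subseteq> {1..<n}" "ascend_word n js (ascend_word n is \<epsilon>) \<in> S"
  shows "ascend_word n is \<epsilon> \<in> S"
  using assms unfolding hconvex_def by blast

lemma finite_hconvex: "hconvex n S \<Longrightarrow> finite S"
  by (rule finite_subset[of _ "{\<sigma>. \<sigma> permutes {1..n}}"]) (auto simp: hconvex_def finite_permutations)

section \<open>Modules on convex sets of permutations\<close>

definition supp_in :: "'a set \<Rightarrow> ('a \<Rightarrow> complex) set" where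
  "supp_in S = {f. \<forall>\<gamma>. \<gamma> \<notin> S \<longrightarrow> f \<gamma> = 0}"

text \<open>
The ascending action on the functions supported on \<open>S\<close>, where terms outside \<open>S\<close> are discarded.
\<close>

definition conv_module :: "nat \<Rightarrow> (nat \<Rightarrow> nat) set \<Rightarrow> ((nat \<Rightarrow> nat) \<Rightarrow> complex) hecke_module" where
  "conv_module n S = \<lparr>carrier = supp_in S, monoid.mult = undefined, one = undefined,
     zero = (\<lambda>\<gamma>. 0), add = (\<lambda>f g \<gamma>. f \<gamma> + g \<gamma>), module.smult = (\<lambda>c f \<gamma>. c * f \<gamma>),
     act = (\<lambda>i f \<delta>. if \<delta> \<in> S then \<Sum>\<gamma> | \<gamma> \<in> S \<and> ascend n i \<gamma> = \<delta>. f \<gamma> else 0)\<rparr>"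

lemma conv_module_simps [simp]:
  "carrier (conv_module n S) = supp_in S"
  "\<zero>\<^bsub>conv_module n S\<^esub> = (\<lambda>\<gamma>. 0)"
  "f \<oplus>\<^bsub>conv_module n S\<^esub> g = (\<lambda>\<gamma>. f \<gamma> + g \<gamma>)"
  "c \<odot>\<^bsub>conv_module n S\<^esub> f = (\<lambda>\<gamma>. c * f \<gamma>)"
  "act (conv_module n S) i f = (\<lambda>\<delta>. if \<delta> \<in> S then \<Sum>\<gamma> | \<gamma> \<in> S \<and> ascend n i \<gamma> = \<delta>. f \<gamma> else 0)"
  by (simp_all add: conv_module_def)

lemma complex_ring_simps [simp]:
  "a \<oplus>\<^bsub>complex_ring\<^esub> b = a + b" "a \<otimes>\<^bsub>complex_ring\<^esub> b = a * b" "\<one>\<^bsub>complex_ring\<^esub> = 1" "\<zero>\<^bsub>complex_ring\<^esub> = 0"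
  by (simp_all add: ring_of_type_algebra_def)

lemma module_conv_module: "Module.module complex_ring (conv_module n S)"
proof (rule moduleI)
  show "cring complex_ring" by (rule cring_from_type_algebra)
  show "abelian_group (conv_module n S)"
  proof (rule abelian_groupI)
    fix f assume "f \<in> carrier (conv_module n S)"
    then show "\<exists>g\<in>carrier (conv_module n S). g \<oplus>\<^bsub>conv_module n S\<^esub> f = \<zero>\<^bsub>conv_module n S\<^esub>"
      by (intro bexI[of _ "\<lambda>\<gamma>. - f \<gamma>"]) (auto simp: supp_in_def)
  qed (auto simp: supp_in_def algebra_simps)
qed (auto simp: supp_in_def algebra_simps)

text \<open>
A summand that reaches \<open>\<delta>\<close> in \<open>S\<close> at the end has stayed in \<open>S\<close> all the time, by convexity. So
truncating after every step amounts to truncating once.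
\<close>

lemma conv_module_act_word:
  assumes S: "hconvex n S" and f: "f \<in> supp_in S" and "set is \<subseteq> {1..<n}"
  shows "act_word (conv_module n S) is f = (\<lambda>\<delta>. if \<delta> \<in> S then \<Sum>\<gamma> | \<gamma> \<in> S \<and> ascend_word n is \<gamma> = \<delta>. f \<gamma> else 0)"
  using assms(3)
proof (induction "is")
  case Nil
  have "(\<Sum>\<gamma> | \<gamma> \<in> S \<and> \<gamma> = \<delta>. f \<gamma>) = f \<delta>" if "\<delta> \<in> S" for \<delta>
  proof -
    have "{\<gamma>. \<gamma> \<in> S \<and> \<gamma> = \<delta>} = {\<delta>}" using that by auto
    then show ?thesis by simp
  qed
  then show ?case using f by (auto simp: supp_in_def fun_eq_iff)
next
  case (Cons i "is")
  have fin: "finite S" by (rule finite_hconvex[OF S])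
  have "(\<Sum>\<gamma> | \<gamma> \<in> S \<and> ascend n i \<gamma> = \<delta>. \<Sum>\<epsilon> | \<epsilon> \<in> S \<and> ascend_word n is \<epsilon> = \<gamma>. f \<epsilon>)
      = (\<Sum>\<epsilon> | \<epsilon> \<in> S \<and> ascend n i (ascend_word n is \<epsilon>) = \<delta>. f \<epsilon>)" if \<delta>: "\<delta> \<in> S" for \<delta>
  proof -
    let ?A = "{\<epsilon>. \<epsilon> \<in> S \<and> ascend n i (ascend_word n is \<epsilon>) = \<delta>}" and ?B = "{\<gamma>. \<gamma> \<in> S \<and> ascend n i \<gamma> = \<delta>}"
    have mem: "ascend_word n is \<epsilon> \<in> S" if e: "\<epsilon> \<in> ?A" for \<epsilon>
    proof -
      have "ascend_word n [i] (ascend_word n is \<epsilon>) \<in> S" using e \<delta> by simp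
      then show ?thesis using S e Cons.prems unfolding hconvex_def
        by (metis (no_types, lifting) insert_subset list.simps(15) mem_Collect_eq empty_subsetI list.set(1))
    qed
    have "(\<Sum>\<gamma>\<in>?B. \<Sum>\<epsilon> | \<epsilon> \<in> S \<and> ascend_word n is \<epsilon> = \<gamma>. f \<epsilon>) = (\<Sum>\<gamma>\<in>?B. sum f {\<epsilon> \<in> ?A. ascend_word n is \<epsilon> = \<gamma>})"
      by (rule sum.cong) (auto intro!: sum.cong)
    also have "\<dots> = sum f ?A"
      by (rule sum.group) (use fin mem in auto)
    finally show ?thesis .
  qed
  then show ?case using Cons by (auto simp: fun_eq_iff intro!: sum.cong)
qed

lemma hecke_conv_module:
  assumes S: "hconvex n S"
  shows "is_hecke_module n (conv_module n S)"
proof -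
  let ?M = "conv_module n S"
  have perm: "\<gamma> permutes {1..n}" if "\<gamma> \<in> S" for \<gamma> using S that by (auto simp: hconvex_def)
  have eq: "act_word ?M is f = act_word ?M js f"
    if "f \<in> supp_in S" "set is \<subseteq> {1..<n}" "set js \<subseteq> {1..<n}" "\<And>\<gamma>. \<gamma> \<in> S \<Longrightarrow> ascend_word n is \<gamma> = ascend_word n js \<gamma>" for "is" js f
  proof -
    have "{\<gamma>. \<gamma> \<in> S \<and> ascend_word n is \<gamma> = \<delta>} = {\<gamma>. \<gamma> \<in> S \<and> ascend_word n js \<gamma> = \<delta>}" for \<delta> using that(4) by auto
    then show ?thesis unfolding conv_module_act_word[OF S that(1,2)] conv_module_act_word[OF S that(1,3)]
      by (intro ext) (simp only:)
  qed
  have lin: "act ?M i \<in> hom (add_monoid ?M) (add_monoid ?M)"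
     "\<forall>c. \<forall>x\<in>carrier ?M. act ?M i (c \<odot>\<^bsub>?M\<^esub> x) = c \<odot>\<^bsub>?M\<^esub> act ?M i x" for i
    by (auto simp: hom_def supp_in_def sum.distrib sum_distrib_left fun_eq_iff)
  have idem: "act ?M i (act ?M i f) = act ?M i f" if "i \<in> {1..<n}" "f \<in> supp_in S" for i f
    using eq[OF that(2), of "[i, i]" "[i]"] that(1) ascend_idem perm by (simp del: conv_module_simps)
  have braid: "act ?M i (act ?M (i + 1) (act ?M i f)) = act ?M (i + 1) (act ?M i (act ?M (i + 1) f))"
    if "1 \<le> i" "i + 1 < n" "f \<in> supp_in S" for i f
    using eq[OF that(3), of "[i, i + 1, i]" "[i + 1, i, i + 1]"] that ascend_braid perm by (simp del: conv_module_simps)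
  have comm: "act ?M i (act ?M j f) = act ?M j (act ?M i f)"
    if "i \<in> {1..<n}" "j \<in> {1..<n}" "i + 2 \<le> j" "f \<in> supp_in S" for i j f
    using eq[OF that(4), of "[i, j]" "[j, i]"] that(1,2) ascend_comm[OF perm that(1-3)] by (simp del: conv_module_simps)
  show ?thesis
    unfolding is_hecke_module_def
    using module_conv_module lin idem braid comm by (simp only: conv_module_simps(1)) blast
qed

lemma fd_iff_fin_dim:
  "is_fd_hecke_module n M \<longleftrightarrow> is_hecke_module n M \<and> vectorspace.fin_dim complex_ring M"
proof
  assume "is_fd_hecke_module n M"
  then show "is_hecke_module n M \<and> vectorspace.fin_dim complex_ring M"
    using fd_fin_dim by (auto simp: is_fd_hecke_module_def)
next
  assume M: "is_hecke_module n M \<and> vectorspace.fin_dim complex_ring M"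
  interpret vectorspace complex_ring M by (rule hecke_vectorspace) (use M in blast)
  obtain A where A: "finite A" "A \<subseteq> carrier M" "span A = carrier M"
    using M unfolding fin_dim_def by blast
  have "\<exists>c. x = finsum M (\<lambda>b. c b \<odot>\<^bsub>M\<^esub> b) A" if "x \<in> carrier M" for x
  proof -
    have "x \<in> span A" using that A(3) by simp
    then obtain a where "x = lincomb a A" using finite_span[OF A(1,2)] by blast
    then show ?thesis by (auto simp: lincomb_def)
  qed
  then show "is_fd_hecke_module n M" unfolding is_fd_hecke_module_def using M A by blast
qed

lemma fd_conv_module:
  assumes S: "hconvex n S"
  shows "is_fd_hecke_module n (conv_module n S)"
proof -
  let ?M = "conv_module n S"
  interpret M: Module.module complex_ring ?M by (rule module_conv_module)
  have fin: "finite S" by (rule finite_hconvex[OF S])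
  have fs: "finsum ?M g B = (\<lambda>\<delta>. \<Sum>b\<in>B. g b \<delta>)" if "finite B" "g \<in> B \<rightarrow> supp_in S"
    for g and B :: "((nat \<Rightarrow> nat) \<Rightarrow> complex) set"
    using that
  proof (induction B rule: finite_induct)
    case (insert b B)
    then have "finsum ?M g (insert b B) = g b \<oplus>\<^bsub>?M\<^esub> finsum ?M g B"
      by (intro M.finsum_insert) auto
    then show ?case using insert by (simp add: Pi_def)
  qed simp
  have inj: "inj_on (basis_vec :: (nat \<Rightarrow> nat) \<Rightarrow> _) S"
    by (rule inj_onI) (metis basis_vec_def one_neq_zero)
  have "\<exists>c. f = finsum ?M (\<lambda>b. c b \<odot>\<^bsub>?M\<^esub> b) (basis_vec ` S)" if f: "f \<in> supp_in S" for f
  proof (intro exI)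
    let ?c = "\<lambda>b. f (inv_into S basis_vec b)"
    have "finsum ?M (\<lambda>b. ?c b \<odot>\<^bsub>?M\<^esub> b) (basis_vec ` S) = (\<lambda>\<delta>. \<Sum>b\<in>basis_vec ` S. (?c b \<odot>\<^bsub>?M\<^esub> b) \<delta>)"
      by (rule fs) (use fin in \<open>auto simp: supp_in_def basis_vec_def\<close>)
    also have "\<dots> = (\<lambda>\<delta>. \<Sum>\<gamma>\<in>S. f \<gamma> * basis_vec \<gamma> \<delta>)"
      by (rule ext) (subst sum.reindex[OF inj], auto simp: inj inv_into_f_f intro!: sum.cong)
    also have "\<dots> = f"
    proof
      fix \<delta>
      have "(\<Sum>\<gamma>\<in>S. f \<gamma> * basis_vec \<gamma> \<delta>) = (\<Sum>\<gamma>\<in>S. if \<gamma> = \<delta> then f \<gamma> else 0)"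
        by (rule sum.cong) (auto simp: basis_vec_def)
      then show "(\<Sum>\<gamma>\<in>S. f \<gamma> * basis_vec \<gamma> \<delta>) = f \<delta>" using fin f by (auto simp: supp_in_def)
    qed
    finally show "f = finsum ?M (\<lambda>b. ?c b \<odot>\<^bsub>?M\<^esub> b) (basis_vec ` S)" by simp
  qed
  moreover have "basis_vec ` S \<subseteq> supp_in S" by (auto simp: basis_vec_def supp_in_def)
  ultimately show ?thesis
    unfolding is_fd_hecke_module_def using hecke_conv_module[OF S] fin
    by (intro conjI exI[of _ "basis_vec ` S"]) auto
qed

section \<open>Transport along isomorphisms\<close>

definition hecke_iso :: "nat \<Rightarrow> 'v hecke_module \<Rightarrow> 'w hecke_module \<Rightarrow> ('v \<Rightarrow> 'w) \<Rightarrow> bool" where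
  "hecke_iso n M N \<phi> \<longleftrightarrow> bij_betw \<phi> (carrier M) (carrier N) \<and> \<phi> \<zero>\<^bsub>M\<^esub> = \<zero>\<^bsub>N\<^esub> \<and>
     (\<forall>x\<in>carrier M. \<forall>y\<in>carrier M. \<phi> (x \<oplus>\<^bsub>M\<^esub> y) = \<phi> x \<oplus>\<^bsub>N\<^esub> \<phi> y) \<and>
     (\<forall>c. \<forall>x\<in>carrier M. \<phi> (c \<odot>\<^bsub>M\<^esub> x) = c \<odot>\<^bsub>N\<^esub> \<phi> x) \<and>
     (\<forall>i\<in>{1..<n}. \<forall>x\<in>carrier M. \<phi> (act M i x) = act N i (\<phi> x))"

text \<open>
Lets the quotient modules of the filtration inherit the module axioms from the modules
on convex sets.
\<close>

lemma hecke_iso_module: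
  assumes M: "is_hecke_module n M" and iso: "hecke_iso n M N \<phi>"
  shows "is_hecke_module n N"
proof -
  interpret M: Module.module complex_ring M using M by (simp add: is_hecke_module_def)
  have car: "carrier N = \<phi> ` carrier M" using iso by (simp add: hecke_iso_def bij_betw_def)
  have zero: "\<zero>\<^bsub>N\<^esub> = \<phi> \<zero>\<^bsub>M\<^esub>" using iso by (simp add: hecke_iso_def)
  have add: "\<phi> x \<oplus>\<^bsub>N\<^esub> \<phi> y = \<phi> (x \<oplus>\<^bsub>M\<^esub> y)" if "x \<in> carrier M" "y \<in> carrier M" for x y
    using iso that by (simp add: hecke_iso_def)
  have smult: "c \<odot>\<^bsub>N\<^esub> \<phi> x = \<phi> (c \<odot>\<^bsub>M\<^esub> x)" if "x \<in> carrier M" for c x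
    using iso that by (simp add: hecke_iso_def)
  have act: "act N i (\<phi> x) = \<phi> (act M i x)" if "i \<in> {1..<n}" "x \<in> carrier M" for i x
    using iso that by (simp add: hecke_iso_def)
  have ac: "act M i x \<in> carrier M" if "i \<in> {1..<n}" "x \<in> carrier M" for i x
    using hecke_act_closed[OF M that] .
  have mod: "Module.module complex_ring N"
  proof (rule moduleI)
    show "cring complex_ring" by (rule cring_from_type_algebra)
    show "abelian_group N"
    proof (rule abelian_groupI)
      fix x assume "x \<in> carrier N"
      then obtain a where a: "a \<in> carrier M" "x = \<phi> a" by (auto simp: car)
      then have "\<phi> (\<ominus>\<^bsub>M\<^esub> a) \<oplus>\<^bsub>N\<^esub> x = \<zero>\<^bsub>N\<^esub>" by (simp add: add zero M.l_neg)
      then show "\<exists>y\<in>carrier N. y \<oplus>\<^bsub>N\<^esub> x = \<zero>\<^bsub>N\<^esub>" using a(1) by (auto simp: car)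
    qed (auto simp: car zero add M.a_ac)
  qed (auto simp: car add smult M.smult_l_distr[simplified] M.smult_r_distr[simplified] M.smult_assoc1[simplified] M.smult_one[simplified])
  have lin: "act N i \<in> hom (add_monoid N) (add_monoid N)"
     "\<forall>c. \<forall>x\<in>carrier N. act N i (c \<odot>\<^bsub>N\<^esub> x) = c \<odot>\<^bsub>N\<^esub> act N i x" if i: "i \<in> {1..<n}" for i
  proof -
    have l: "act M i (x \<oplus>\<^bsub>M\<^esub> y) = act M i x \<oplus>\<^bsub>M\<^esub> act M i y" "act M i (c \<odot>\<^bsub>M\<^esub> x) = c \<odot>\<^bsub>M\<^esub> act M i x"
      if "x \<in> carrier M" "y \<in> carrier M" for x y c
      using hecke_act_hom[OF M i] that by (auto simp: LinearCombinations.module_hom_def)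
    show "act N i \<in> hom (add_monoid N) (add_monoid N)"
      using ac[OF i] by (auto simp: hom_def car act[OF i] add l)
    show "\<forall>c. \<forall>x\<in>carrier N. act N i (c \<odot>\<^bsub>N\<^esub> x) = c \<odot>\<^bsub>N\<^esub> act N i x"
      using ac[OF i] by (auto simp: car act[OF i] smult l)
  qed
  have idem: "act N i (act N i x) = act N i x" if "i \<in> {1..<n}" "x \<in> carrier N" for i x
    using that hecke_act_idem[OF M] by (auto simp: car act ac simp del: One_nat_def)
  have braid: "act N i (act N (i + 1) (act N i x)) = act N (i + 1) (act N i (act N (i + 1) x))"
    if r: "1 \<le> i" "i + 1 < n" and x: "x \<in> carrier N" for i x
  proof -
    have i: "i \<in> {1..<n}" "Suc i \<in> {1..<n}" using r by auto
    obtain a where "a \<in> carrier M" "x = \<phi> a" using x by (auto simp: car)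
    then show ?thesis using hecke_act_braid[OF M r(1), of a] r(2) i unfolding Suc_eq_plus1[symmetric] by (simp add: act ac del: One_nat_def atLeastLessThan_iff)
  qed
  have comm: "act N i (act N j x) = act N j (act N i x)"
    if "i \<in> {1..<n}" "j \<in> {1..<n}" "i + 2 \<le> j" "x \<in> carrier N" for i j x
    using that(4) hecke_act_comm[OF M that(1,2)] that(3) by (auto simp: car act[OF that(1)] act[OF that(2)] ac[OF that(1)] ac[OF that(2)])
  show ?thesis unfolding is_hecke_module_def using mod lin idem braid comm by blast
qed

lemma hecke_iso_fd:
  assumes M: "is_fd_hecke_module n M" and iso: "hecke_iso n M N \<phi>"
  shows "is_fd_hecke_module n N"
proof -
  have hM: "is_hecke_module n M" using M by (simp add: is_fd_hecke_module_def)
  have hN: "is_hecke_module n N" by (rule hecke_iso_module[OF hM iso])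
  have l: "linear_map complex_ring M N \<phi>"
    using hecke_vectorspace[OF hM] hecke_vectorspace[OF hN] iso
    by (auto simp: linear_map_def mod_hom_def mod_hom_axioms_def vectorspace_def hecke_iso_def
        LinearCombinations.module_hom_def bij_betw_def)
  have "vectorspace.fin_dim complex_ring N"
    by (rule linear_map.rank_nullity_main(2)[OF l fd_fin_dim[OF M]]) (use iso in \<open>simp add: hecke_iso_def bij_betw_def\<close>)
  then show ?thesis using hN by (simp add: fd_iff_fin_dim)
qed

lemma hecke_iso_hom: "hecke_iso n M N \<phi> \<Longrightarrow> \<phi> \<in> hecke_hom n M N"
  by (auto simp: hecke_iso_def hecke_hom_def hom_def bij_betw_def)

lemma hecke_iso_inv:
  assumes M: "is_hecke_module n M" and iso: "hecke_iso n M N \<phi>"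
  shows "hecke_iso n N M (inv_into (carrier M) \<phi>)"
proof -
  interpret M: Module.module complex_ring M using M by (simp add: is_hecke_module_def)
  have bij: "bij_betw \<phi> (carrier M) (carrier N)" using iso by (simp add: hecke_iso_def)
  have inj: "inv_into (carrier M) \<phi> (\<phi> x) = x" if "x \<in> carrier M" for x
    using bij that by (auto simp: bij_betw_def)
  have car: "carrier N = \<phi> ` carrier M" using bij by (simp add: bij_betw_def)
  have iso': "\<phi> x \<oplus>\<^bsub>N\<^esub> \<phi> y = \<phi> (x \<oplus>\<^bsub>M\<^esub> y)" "c \<odot>\<^bsub>N\<^esub> \<phi> x = \<phi> (c \<odot>\<^bsub>M\<^esub> x)"
    "i \<in> {1..<n} \<Longrightarrow> act N i (\<phi> x) = \<phi> (act M i x)"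
    if "x \<in> carrier M" "y \<in> carrier M" for x y c i
    using iso that by (auto simp: hecke_iso_def)
  have zero: "\<zero>\<^bsub>N\<^esub> = \<phi> \<zero>\<^bsub>M\<^esub>" using iso by (simp add: hecke_iso_def)
  show ?thesis
    unfolding hecke_iso_def car zero
    using bij_betw_inv_into[OF bij] hecke_act_closed[OF M]
    by (auto simp: iso' inj car simp del: One_nat_def atLeastLessThan_iff)
qed

lemma hecke_hom_comp:
  "f \<in> hecke_hom n A B \<Longrightarrow> g \<in> hecke_hom n B C \<Longrightarrow> g \<circ> f \<in> hecke_hom n A C"
  by (auto simp: hecke_hom_def hom_def Pi_def)

lemma short_exact_iso:
  assumes M: "is_hecke_module n A" "is_hecke_module n B" "is_hecke_module n C"
    and iso: "hecke_iso n A A' \<alpha>" "hecke_iso n B B' \<beta>" "hecke_iso n C C' \<gamma>"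
    and se: "short_exact n A B C"
  shows "short_exact n A' B' C'"
proof -
  obtain f g where f: "f \<in> hecke_hom n A B" and g: "g \<in> hecke_hom n B C"
    and inj: "inj_on f (carrier A)" and ex: "f ` carrier A = a_kernel B C g" and surj: "g ` carrier B = carrier C"
    using se by (auto simp: short_exact_def)
  let ?a = "inv_into (carrier A) \<alpha>" and ?b = "inv_into (carrier B) \<beta>"
  let ?f = "\<beta> \<circ> (f \<circ> ?a)" and ?g = "\<gamma> \<circ> (g \<circ> ?b)"
  have ia: "hecke_iso n A' A ?a" by (rule hecke_iso_inv[OF M(1) iso(1)])
  have ib: "hecke_iso n B' B ?b" by (rule hecke_iso_inv[OF M(2) iso(2)])
  have bij: "bij_betw ?a (carrier A') (carrier A)" "bij_betw ?b (carrier B') (carrier B)"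
    "bij_betw \<beta> (carrier B) (carrier B')" "bij_betw \<gamma> (carrier C) (carrier C')"
    using ia ib iso by (auto simp: hecke_iso_def)
  have fc: "f ` carrier A \<subseteq> carrier B" using f by (auto simp: hecke_hom_def hom_def)
  have gc: "g ` carrier B \<subseteq> carrier C" using surj by simp
  have bb: "\<beta> (?b y) = y" if "y \<in> carrier B'" for y using bij(3) that by (simp add: bij_betw_def f_inv_into_f)
  have bb': "?b (\<beta> x) = x" if "x \<in> carrier B" for x using bij(3) that by (auto simp: bij_betw_def)
  have zC: "\<zero>\<^bsub>C\<^esub> \<in> carrier C"
  proof -
    interpret C: Module.module complex_ring C using M(3) by (simp add: is_hecke_module_def)
    show ?thesis by simp
  qed
  have \<gamma>0: "\<gamma> x = \<zero>\<^bsub>C'\<^esub> \<longleftrightarrow> x = \<zero>\<^bsub>C\<^esub>" if "x \<in> carrier C" for x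
    using iso(3) that zC by (auto simp: hecke_iso_def bij_betw_def inj_on_def)
  have fh: "?f \<in> hecke_hom n A' B'"
    by (rule hecke_hom_comp[OF hecke_hom_comp[OF hecke_iso_hom[OF ia] f] hecke_iso_hom[OF iso(2)]])
  moreover have gh: "?g \<in> hecke_hom n B' C'"
    by (rule hecke_hom_comp[OF hecke_hom_comp[OF hecke_iso_hom[OF ib] g] hecke_iso_hom[OF iso(3)]])
  moreover have "inj_on ?f (carrier A')"
  proof (intro comp_inj_on)
    show "inj_on ?a (carrier A')" using bij(1) by (simp add: bij_betw_def)
    show "inj_on f (?a ` carrier A')" using bij(1) inj by (simp add: bij_betw_def)
    show "inj_on \<beta> ((f \<circ> ?a) ` carrier A')"
    proof (rule inj_on_subset[of _ "carrier B"])
      show "inj_on \<beta> (carrier B)" using bij(3) by (simp only: bij_betw_def)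
      have "?a ` carrier A' = carrier A" using bij(1) by (simp only: bij_betw_def)
      then show "(f \<circ> ?a) ` carrier A' \<subseteq> carrier B" using fc by (simp only: image_comp[symmetric])
    qed
  qed
  moreover have "?f ` carrier A' = a_kernel B' C' ?g"
  proof -
    have "?f ` carrier A' = \<beta> ` (f ` (?a ` carrier A'))" by (simp only: image_comp)
    also have "\<dots> = \<beta> ` (f ` carrier A)" using bij(1) by (simp only: bij_betw_def)
    also have "\<dots> = \<beta> ` {x \<in> carrier B. g x = \<zero>\<^bsub>C\<^esub>}" unfolding ex by (simp add: a_kernel_def')
    also have "\<dots> = {y \<in> carrier B'. \<gamma> (g (?b y)) = \<zero>\<^bsub>C'\<^esub>}"
    proof
      show "\<beta> ` {x \<in> carrier B. g x = \<zero>\<^bsub>C\<^esub>} \<subseteq> {y \<in> carrier B'. \<gamma> (g (?b y)) = \<zero>\<^bsub>C'\<^esub>}"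
        using bij(3) bb' \<gamma>0 zC by (auto simp: bij_betw_def)
      show "{y \<in> carrier B'. \<gamma> (g (?b y)) = \<zero>\<^bsub>C'\<^esub>} \<subseteq> \<beta> ` {x \<in> carrier B. g x = \<zero>\<^bsub>C\<^esub>}"
      proof clarify
        fix y assume y: "y \<in> carrier B'" "\<gamma> (g (?b y)) = \<zero>\<^bsub>C'\<^esub>"
        have "?b y \<in> carrier B" using bij(2) y(1) by (auto simp: bij_betw_def)
        then have "?b y \<in> {x \<in> carrier B. g x = \<zero>\<^bsub>C\<^esub>}" using y(2) \<gamma>0 gc by auto
        then show "y \<in> \<beta> ` {x \<in> carrier B. g x = \<zero>\<^bsub>C\<^esub>}" using bb[OF y(1)] by (metis imageI)
      qed
    qed
    also have "\<dots> = a_kernel B' C' ?g" by (simp add: a_kernel_def')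
    finally show ?thesis .
  qed
  moreover have "?g ` carrier B' = carrier C'"
  proof -
    have "?g ` carrier B' = \<gamma> ` (g ` (?b ` carrier B'))" by (simp only: image_comp)
    also have "?b ` carrier B' = carrier B" using bij(2) by (simp only: bij_betw_def)
    finally show ?thesis using bij(4) surj by (simp only: bij_betw_def)
  qed
  ultimately show ?thesis unfolding short_exact_def by blast
qed

section \<open>The characteristic of a convex set\<close>

text \<open>
If \<open>V\<close> is closed under ascents within \<open>S\<close>, extension by zero embeds the module of \<open>V\<close>, and restriction of
functions to \<open>S - V\<close> is the projection onto the quotient.
\<close>

lemma short_exact_conv_module:
  assumes S: "V \<subseteq> S" "finite S" and up: "\<And>\<gamma> i. \<gamma> \<in> V \<Longrightarrow> i \<in> {1..<n} \<Longrightarrow> ascend n i \<gamma> \<in> S \<Longrightarrow> ascend n i \<gamma> \<in> V"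
  shows "short_exact n (conv_module n V) (conv_module n S) (conv_module n (S - V))"
proof -
  let ?g = "\<lambda>f \<delta>. if \<delta> \<in> S - V then f \<delta> else (0 :: complex)"
  have "(\<lambda>f. f) \<in> hecke_hom n (conv_module n V) (conv_module n S)"
  proof -
    have "act (conv_module n V) i f = act (conv_module n S) i f" if "i \<in> {1..<n}" "f \<in> supp_in V" for i f
    proof
      fix \<delta>
      show "act (conv_module n V) i f \<delta> = act (conv_module n S) i f \<delta>"
      proof (cases "\<delta> \<in> S")
        case True
        have eq: "(\<Sum>\<gamma> | \<gamma> \<in> S \<and> ascend n i \<gamma> = \<delta>. f \<gamma>) = (\<Sum>\<gamma> | \<gamma> \<in> V \<and> ascend n i \<gamma> = \<delta>. f \<gamma>)"
          by (rule sum.mono_neutral_right) (use S that(2) in \<open>auto simp: supp_in_def\<close>)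
        show ?thesis
        proof (cases "\<delta> \<in> V")
          case False
          then have E: "{\<gamma>. \<gamma> \<in> V \<and> ascend n i \<gamma> = \<delta>} = {}" using up[OF _ that(1)] True by auto
          have "(\<Sum>\<gamma> | \<gamma> \<in> S \<and> ascend n i \<gamma> = \<delta>. f \<gamma>) = 0" unfolding eq E by simp
          then show ?thesis using True False by simp
        qed (use True eq in simp)
      qed (use S in auto)
    qed
    then show ?thesis using S by (auto simp: hecke_hom_def hom_def supp_in_def)
  qed
  moreover have "?g \<in> hecke_hom n (conv_module n S) (conv_module n (S - V))"
  proof -
    have "?g (act (conv_module n S) i f) = act (conv_module n (S - V)) i (?g f)" if "i \<in> {1..<n}" for i f
    proof
      fix \<delta>
      show "?g (act (conv_module n S) i f) \<delta> = act (conv_module n (S - V)) i (?g f) \<delta>"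
      proof (cases "\<delta> \<in> S - V")
        case True
        then have "{\<gamma>. \<gamma> \<in> S \<and> ascend n i \<gamma> = \<delta>} = {\<gamma>. \<gamma> \<in> S - V \<and> ascend n i \<gamma> = \<delta>}" using up[OF _ that] by auto
        then show ?thesis using True by (auto intro!: sum.cong)
      qed auto
    qed
    then show ?thesis by (auto simp: hecke_hom_def hom_def supp_in_def fun_eq_iff simp del: conv_module_simps(5))
  qed
  moreover have "(\<lambda>f. f) ` carrier (conv_module n V) = a_kernel (conv_module n S) (conv_module n (S - V)) ?g"
    using S(1) by (auto simp: a_kernel_def' supp_in_def fun_eq_iff split: if_splits)
  moreover have "?g ` carrier (conv_module n S) = carrier (conv_module n (S - V))"
  proof
    show "carrier (conv_module n (S - V)) \<subseteq> ?g ` carrier (conv_module n S)"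
    proof
      fix f assume f: "f \<in> carrier (conv_module n (S - V))"
      then have "f = ?g f" by (auto simp: supp_in_def fun_eq_iff)
      moreover have "f \<in> carrier (conv_module n S)" using f by (auto simp: supp_in_def)
      ultimately show "f \<in> ?g ` carrier (conv_module n S)" by blast
    qed
  qed (auto simp: supp_in_def)
  ultimately show ?thesis unfolding short_exact_def by (intro bexI[of _ "\<lambda>f. f"] bexI[of _ ?g]) auto
qed

text \<open>
The Grothendieck group only compares modules over one type of vectors. The quotients of the
filtration consist of sets of functions, so the modules that they are compared with are
copied to the type of sets, as singletons.
\<close>

definition singleton_copy :: "'v hecke_module \<Rightarrow> 'v set hecke_module" where
  "singleton_copy M = \<lparr>carrier = (\<lambda>x. {x}) ` carrier M, monoid.mult = undefined, one = undefined,
     zero = {\<zero>\<^bsub>M\<^esub>}, add = (\<lambda>U V. {the_elem U \<oplus>\<^bsub>M\<^esub> the_elem V}),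
     module.smult = (\<lambda>c U. {c \<odot>\<^bsub>M\<^esub> the_elem U}), act = (\<lambda>i U. {act M i (the_elem U)})\<rparr>"

lemma singleton_copy_simps [simp]:
  "carrier (singleton_copy M) = (\<lambda>x. {x}) ` carrier M" "\<zero>\<^bsub>singleton_copy M\<^esub> = {\<zero>\<^bsub>M\<^esub>}"
  "c \<odot>\<^bsub>singleton_copy M\<^esub> {x} = {c \<odot>\<^bsub>M\<^esub> x}" "act (singleton_copy M) i {x} = {act M i x}"
  by (simp_all add: singleton_copy_def)

lemma hecke_iso_singleton_copy: "hecke_iso n M (singleton_copy M) (\<lambda>x. {x})"
  by (auto simp: hecke_iso_def singleton_copy_def bij_betw_def)

text \<open>
Compositions of \<open>n\<close> correspond to subsets of \<open>{1..<n}\<close>: the largest element of the subset is the sum of all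
parts but the last.
\<close>

lemma ex_composition:
  "A \<subseteq> {1..<n} \<Longrightarrow> \<exists>\<alpha>. composition_of n \<alpha> \<and> comp_set \<alpha> = A"
proof (induction "card A" arbitrary: A n)
  case 0
  then have A: "A = {}" using finite_subset[OF "0.prems"] by simp
  show ?case
  proof (cases "n = 0")
    case True
    then show ?thesis using A by (intro exI[of _ "[]"]) (simp add: composition_of_def comp_set_def)
  next
    case False
    then show ?thesis using A by (intro exI[of _ "[n]"]) (simp add: composition_of_def comp_set_def)
  qed
next
  case (Suc k)
  have fin: "finite A" using finite_subset[OF Suc.prems] by simp
  have ne: "A \<noteq> {}" using Suc.hyps(2) by auto
  define a where "a = Max A"
  have a: "a \<in> A" "\<And>b. b \<in> A \<Longrightarrow> b \<le> a" using fin ne by (auto simp: a_def)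
  have an: "1 \<le> a" "a < n" using a(1) Suc.prems by auto
  have "A - {a} \<subseteq> {1..<a}" using a(2) Suc.prems by (force simp: le_less)
  moreover have "k = card (A - {a})" using Suc.hyps(2) a(1) fin by simp
  ultimately obtain \<beta> where \<beta>: "composition_of a \<beta>" "comp_set \<beta> = A - {a}" using Suc.hyps(1) by blast
  have bne: "\<beta> \<noteq> []" using \<beta>(1) an by (auto simp: composition_of_def)
  have "comp_set (\<beta> @ [n - a]) = insert a (comp_set \<beta>)"
  proof -
    have "{k. 1 \<le> k \<and> k < Suc (length \<beta>)} = insert (length \<beta>) {k. 1 \<le> k \<and> k < length \<beta>}"
      using bne by (auto simp: Suc_le_eq less_Suc_eq)
    moreover have "comp_set \<gamma> = (\<lambda>k. sum_list (take k \<gamma>)) ` {k. 1 \<le> k \<and> k < length \<gamma>}" for \<gamma>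
      by (auto simp: comp_set_def)
    moreover have "sum_list \<beta> = a" using \<beta>(1) by (simp add: composition_of_def)
    ultimately show ?thesis by (auto simp: image_iff)
  qed
  moreover have "composition_of n (\<beta> @ [n - a])" using \<beta>(1) an by (auto simp: composition_of_def)
  ultimately show ?case using \<beta>(2) a(1) by (intro exI[of _ "\<beta> @ [n - a]"]) auto
qed

text \<open>
On the line of \<open>\<gamma>\<close> the generator \<open>\<pi>\<^sub>i\<close> acts as 1 if \<open>i\<close> is a left descent; otherwise
it leads out of the line and acts as 0.
\<close>

lemma irr_singleton_module:
  assumes \<gamma>: "\<gamma> permutes {1..n}" and \<alpha>: "comp_set \<alpha> = {1..<n} - Des_L n \<gamma>"
    and h: "hconvex n {\<gamma>}"
  shows "is_irr_module n \<alpha> (singleton_copy (conv_module n {\<gamma>}))"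
proof -
  let ?M = "conv_module n {\<gamma>}" let ?b = "basis_vec \<gamma> :: (nat \<Rightarrow> nat) \<Rightarrow> complex"
  have "is_hecke_module n (singleton_copy ?M)"
    by (rule hecke_iso_module[OF hecke_conv_module[OF h] hecke_iso_singleton_copy])
  moreover have act: "act ?M i ?b = (if i \<in> comp_set \<alpha> then \<zero>\<^bsub>?M\<^esub> else ?b)" if i: "i \<in> {1..<n}" for i
  proof (cases "i \<in> Des_L n \<gamma>")
    case True
    then have E: "{\<gamma>'. \<gamma>' \<in> {\<gamma>} \<and> ascend n i \<gamma>' = \<gamma>} = {\<gamma>}" by (auto simp: ascend_def)
    have "act ?M i ?b \<delta> = ?b \<delta>" for \<delta>
    proof (cases "\<delta> = \<gamma>")
      case T: True
      show ?thesis unfolding conv_module_simps T E by simp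
    qed (simp add: basis_vec_def)
    then show ?thesis using True \<alpha> by (simp add: fun_eq_iff del: conv_module_simps(5))
  next
    case False
    have "simple_transp i \<circ> \<gamma> \<noteq> \<gamma>"
    proof
      assume "simple_transp i \<circ> \<gamma> = \<gamma>"
      then have "(simple_transp i \<circ> \<gamma>) (pinv \<gamma> i) = \<gamma> (pinv \<gamma> i)" by (rule fun_cong)
      then show False unfolding comp_apply permutes_inverses(1)[OF \<gamma>] by simp
    qed
    then have E: "{\<gamma>'. \<gamma>' \<in> {\<gamma>} \<and> ascend n i \<gamma>' = \<gamma>} = {}" using False by (auto simp: ascend_def)
    have "act ?M i ?b \<delta> = 0" for \<delta>
    proof (cases "\<delta> = \<gamma>")
      case True
      show ?thesis unfolding conv_module_simps True E by simp
    qed simp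
    then show ?thesis using False i \<alpha> by (simp add: fun_eq_iff del: conv_module_simps(5))
  qed
  moreover have supp: "supp_in {\<gamma>} = {\<lambda>\<delta>. c * ?b \<delta> | c. True}"
  proof
    show "supp_in {\<gamma>} \<subseteq> {\<lambda>\<delta>. c * ?b \<delta> | c. True}"
    proof
      fix f assume "f \<in> supp_in {\<gamma>}"
      then have "f = (\<lambda>\<delta>. f \<gamma> * ?b \<delta>)" by (auto simp: supp_in_def basis_vec_def)
      then show "f \<in> {\<lambda>\<delta>. c * ?b \<delta> | c. True}" by blast
    qed
  qed (auto simp: supp_in_def basis_vec_def)
  let ?Q = "singleton_copy ?M"
  have "?b \<in> supp_in {\<gamma>}" unfolding supp_in_def basis_vec_def by simp
  then have "{?b} \<in> carrier ?Q" by simp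
  moreover have "{?b} \<noteq> \<zero>\<^bsub>?Q\<^esub>"
  proof
    assume "{?b} = \<zero>\<^bsub>?Q\<^esub>"
    then have "?b = (\<lambda>\<delta>. 0)" unfolding singleton_copy_simps conv_module_simps by (rule singleton_inject)
    then have "?b \<gamma> = 0" by (rule fun_cong)
    then show False by (simp add: basis_vec_def)
  qed
  moreover have "carrier ?Q = {c \<odot>\<^bsub>?Q\<^esub> {?b} | c. True}"
  proof -
    have "carrier ?Q = range (\<lambda>c. {\<lambda>\<delta>. c * ?b \<delta>})"
      unfolding singleton_copy_simps conv_module_simps supp by (simp only: simp_thms full_SetCompr_eq image_image)
    then show ?thesis unfolding singleton_copy_simps conv_module_simps by (simp only: simp_thms full_SetCompr_eq)
  qed
  moreover have "\<forall>i\<in>{1..<n}. act ?Q i {?b} = (if i \<in> comp_set \<alpha> then \<zero>\<^bsub>?Q\<^esub> else {?b})"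
  proof
    fix i assume i: "i \<in> {1..<n}"
    show "act ?Q i {?b} = (if i \<in> comp_set \<alpha> then \<zero>\<^bsub>?Q\<^esub> else {?b})"
      unfolding singleton_copy_simps act[OF i] by (cases "i \<in> comp_set \<alpha>") (simp_all only: if_True if_False)
  qed
  ultimately show ?thesis unfolding is_irr_module_def by (intro conjI bexI[of _ "{?b}"])
qed

text \<open>
A proper ascent would add inversions, so an element with the largest number of inversions can
only be fixed or leave \<open>S\<close>.
\<close>

lemma max_inversions_fixed:
  assumes "hconvex n S" "\<gamma> \<in> S" "\<And>\<delta>. \<delta> \<in> S \<Longrightarrow> card (Invs n \<delta>) \<le> card (Invs n \<gamma>)" "set is \<subseteq> {1..<n}" "ascend_word n is \<gamma> \<in> S"
  shows "ascend_word n is \<gamma> = \<gamma>"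
  using Invs_ascend_word[of \<gamma> n "is"] assms(1,2,4) assms(3)[OF assms(5)] by (auto simp: hconvex_def)

text \<open>
Induction on the size of \<open>S\<close>. An element \<open>\<gamma>\<close> with the largest number of inversions spans a submodule, and
both \<open>{\<gamma>}\<close> and \<open>S - {\<gamma>}\<close> are convex again. The isomorphic module \<open>Q\<close> is arbitrary, because
the induction passes from a quotient of the filtration to singleton copies.
\<close>

theorem qch_conv_module:
  fixes Q :: "((nat \<Rightarrow> nat) \<Rightarrow> complex) set hecke_module"
  assumes "hconvex n S" "hecke_iso n (conv_module n S) Q \<phi>"
  shows "qch n Q m = (\<Sum>\<gamma>\<in>S. qs_fund n ({1..<n} - Des_L n \<gamma>) m)"
  using assms
proof (induction "card S" arbitrary: S Q \<phi>)
  case 0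
  then have S: "S = {}" using finite_hconvex by auto
  have fd: "is_fd_hecke_module n Q" by (rule hecke_iso_fd[OF fd_conv_module[OF 0(2)] 0(3)])
  have "short_exact n (conv_module n {}) (conv_module n {}) (conv_module n ({} - {}))"
    by (rule short_exact_conv_module) auto
  then have "short_exact n Q Q Q"
    using short_exact_iso[of n "conv_module n {}" "conv_module n {}" "conv_module n {}"]
      hecke_conv_module[OF 0(2)] 0(3) S by simp
  \<comment> \<open>The zero module is an extension of itself by itself.\<close>
  then have "qch n Q m = qch n Q m + qch n Q m" by (rule qch_additive[OF fd fd fd])
  then show ?case using S by simp
next
  case (Suc k)
  have fin: "finite S" by (rule finite_hconvex[OF Suc.prems(1)])
  have ne: "S \<noteq> {}" using Suc.hyps(2) by auto
  obtain \<gamma> where \<gamma>: "\<gamma> \<in> S" and max: "\<And>\<delta>. \<delta> \<in> S \<Longrightarrow> card (Invs n \<delta>) \<le> card (Invs n \<gamma>)"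
  proof -
    let ?m = "Max ((\<lambda>\<delta>. card (Invs n \<delta>)) ` S)"
    have "?m \<in> (\<lambda>\<delta>. card (Invs n \<delta>)) ` S" using fin ne by (intro Max_in) auto
    then obtain \<gamma> where "\<gamma> \<in> S" "card (Invs n \<gamma>) = ?m" by auto
    moreover have "card (Invs n \<delta>) \<le> ?m" if "\<delta> \<in> S" for \<delta> using fin that by (intro Max_ge) auto
    ultimately show ?thesis using that by simp
  qed
  have stay: "ascend_word n is \<gamma> = \<gamma>" if "set is \<subseteq> {1..<n}" "ascend_word n is \<gamma> \<in> S" for "is"
    by (rule max_inversions_fixed[OF Suc.prems(1) \<gamma> max that])
  have perm: "\<delta> permutes {1..n}" if "\<delta> \<in> S" for \<delta> using Suc.prems(1) that by (auto simp: hconvex_def)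
  have h1: "hconvex n {\<gamma>}"
    unfolding hconvex_def
  proof (intro conjI ballI allI impI)
    fix \<epsilon> "is" js assume e: "\<epsilon> \<in> {\<gamma>}" and *: "set is \<subseteq> {1..<n} \<and> set js \<subseteq> {1..<n} \<and> ascend_word n js (ascend_word n is \<epsilon>) \<in> {\<gamma>}"
    have "ascend_word n is \<gamma> \<in> S" by (rule hconvexD[OF Suc.prems(1) \<gamma>, of _ js]) (use * e \<gamma> in auto)
    then show "ascend_word n is \<epsilon> \<in> {\<gamma>}" using stay * e by simp
  qed (use perm \<gamma> in auto)
  have h2: "hconvex n (S - {\<gamma>})"
    unfolding hconvex_def
  proof (intro conjI ballI allI impI)
    fix \<epsilon> "is" js assume e: "\<epsilon> \<in> S - {\<gamma>}"
      and *: "set is \<subseteq> {1..<n} \<and> set js \<subseteq> {1..<n} \<and> ascend_word n js (ascend_word n is \<epsilon>) \<in> S - {\<gamma>}"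
    have "ascend_word n is \<epsilon> \<in> S" by (rule hconvexD[OF Suc.prems(1), of _ _ js]) (use * e in auto)
    moreover have "ascend_word n is \<epsilon> \<noteq> \<gamma>" using stay[of js] * by auto
    ultimately show "ascend_word n is \<epsilon> \<in> S - {\<gamma>}" by simp
  qed (use perm in auto)
  have up: "ascend n i \<delta> \<in> {\<gamma>}" if "\<delta> \<in> {\<gamma>}" "i \<in> {1..<n}" "ascend n i \<delta> \<in> S" for \<delta> i
    using stay[of "[i]"] that by simp
  have se: "short_exact n (conv_module n {\<gamma>}) (conv_module n S) (conv_module n (S - {\<gamma>}))"
    by (rule short_exact_conv_module[OF _ fin up]) (use \<gamma> in auto)
  let ?A = "singleton_copy (conv_module n {\<gamma>})" and ?C = "singleton_copy (conv_module n (S - {\<gamma>}))"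
  have "short_exact n ?A Q ?C"
    by (rule short_exact_iso[OF hecke_conv_module[OF h1] hecke_conv_module[OF Suc.prems(1)] hecke_conv_module[OF h2]
        hecke_iso_singleton_copy Suc.prems(2) hecke_iso_singleton_copy se])
  moreover have "is_fd_hecke_module n ?A" by (rule hecke_iso_fd[OF fd_conv_module[OF h1] hecke_iso_singleton_copy])
  moreover have "is_fd_hecke_module n ?C" by (rule hecke_iso_fd[OF fd_conv_module[OF h2] hecke_iso_singleton_copy])
  moreover have "is_fd_hecke_module n Q" by (rule hecke_iso_fd[OF fd_conv_module[OF Suc.prems(1)] Suc.prems(2)])
  ultimately have "qch n Q m = qch n ?A m + qch n ?C m" using qch_additive by blast
  moreover have "qch n ?C m = (\<Sum>\<delta>\<in>S - {\<gamma>}. qs_fund n ({1..<n} - Des_L n \<delta>) m)"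
    using Suc.hyps(1)[OF _ h2 hecke_iso_singleton_copy] Suc.hyps(2) fin \<gamma> by simp
  moreover have "qch n ?A m = qs_fund n ({1..<n} - Des_L n \<gamma>) m"
  proof -
    obtain \<alpha> where \<alpha>: "composition_of n \<alpha>" "comp_set \<alpha> = {1..<n} - Des_L n \<gamma>"
      using ex_composition[of "{1..<n} - Des_L n \<gamma>" n] by auto
    have "qch n ?A = fundamental \<alpha>" by (rule qch_irr[OF \<alpha>(1) irr_singleton_module[OF perm[OF \<gamma>] \<alpha>(2) h1]])
    then show ?thesis using \<alpha> by (simp add: fundamental_eq_qs_fund composition_of_def)
  qed
  ultimately show ?case using fin \<gamma> by (simp add: sum.remove)
qed

section \<open>Classes of equal insertion tableau\<close>

text \<open>
The more inversions \<open>\<gamma>\<close> has, the fewer decreasing pairs its word has, and the easier it is for a set of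
letters to be free of long decreasing subsequences.
\<close>

lemma greene_key_mono:
  assumes "\<gamma> permutes {1..n}" "\<gamma>' permutes {1..n}" "Invs n \<gamma> \<subseteq> Invs n \<gamma>'"
  shows "greene_key (word_of n \<gamma>) j k \<le> greene_key (word_of n \<gamma>') j k"
  unfolding greene_key_def set_word_of[OF assms(1)] set_word_of[OF assms(2)]
proof (rule greene_mono)
  fix x y assume x: "x \<in> (\<lambda>x. - int x) ` {1..n} \<inter> {..j}" and y: "y \<in> (\<lambda>x. - int x) ` {1..n} \<inter> {..j}"
    and lt: "x < y" and p: "pos (word_of n \<gamma>') y < pos (word_of n \<gamma>') x"
  obtain a b where ab: "a \<in> {1..n}" "x = - int a" "b \<in> {1..n}" "y = - int b" using x y by auto
  have ba: "b < a" using lt ab by simp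
  have "\<gamma>' b - 1 < \<gamma>' a - 1"
    using p unfolding ab(2,4) pos_word_of[OF assms(2) ab(1)] pos_word_of[OF assms(2) ab(3)] .
  then have "\<not> \<gamma>' a < \<gamma>' b" by linarith
  then have "(b, a) \<notin> Invs n \<gamma>'" by (simp add: Invs_def)
  then have "(b, a) \<notin> Invs n \<gamma>" using assms(3) by blast
  then have "\<gamma> b \<le> \<gamma> a" using ab ba by (simp add: Invs_def)
  moreover have "\<gamma> b \<noteq> \<gamma> a" using inj_eq[OF permutes_inj[OF assms(1)]] ba by simp
  moreover have "\<gamma> b \<in> {1..n}" using permutes_in_image[OF assms(1)] ab(3) by simp
  ultimately have "\<gamma> b - 1 < \<gamma> a - 1" unfolding atLeastAtMost_iff by linarith
  then show "pos (word_of n \<gamma>) y < pos (word_of n \<gamma>) x"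
    unfolding ab(2,4) pos_word_of[OF assms(1) ab(1)] pos_word_of[OF assms(1) ab(3)] .
qed simp

definition tab :: "nat \<Rightarrow> (nat \<Rightarrow> nat) \<Rightarrow> int list list" where
  "tab n \<gamma> = P_tab (word_of n \<gamma>)"

text \<open>
The sum of all the Greene invariants, as a function of the tableau alone. Its order on
the tableaux extends the one induced by the left weak order.
\<close>

definition weight :: "nat \<Rightarrow> int list list \<Rightarrow> nat" where
  "weight n T = (\<Sum>j\<in>{1..n}. \<Sum>k\<le>n. card {x \<in> set (concat (take k T)). x \<le> - int j})"

lemma tab_eqI:
  assumes "\<gamma> permutes {1..n}" "\<gamma>' permutes {1..n}"
    "\<And>j k. j \<in> {1..n} \<Longrightarrow> k \<le> n \<Longrightarrow> greene_key (word_of n \<gamma>) (- int j) k = greene_key (word_of n \<gamma>') (- int j) k"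
  shows "tab n \<gamma> = tab n \<gamma>'"
  unfolding tab_def
proof (rule P_tab_eqI[OF distinct_word_of[OF assms(1)] distinct_word_of[OF assms(2)] set_word_of[OF assms(1)] set_word_of[OF assms(2)]])
  fix j k assume "j \<in> (\<lambda>x. - int x) ` {1..n}" and k: "k \<le> card ((\<lambda>x. - int x) ` {1..n})"
  then obtain a where a: "a \<in> {1..n}" "j = - int a" by auto
  have "card ((\<lambda>x. - int x) ` {1..n}) = n" by (simp add: card_image inj_on_def)
  then show "greene_key (word_of n \<gamma>) j k = greene_key (word_of n \<gamma>') j k" using a assms(3) k by simp
qed

lemma weight_tab:
  assumes "\<gamma> permutes {1..n}"
  shows "weight n (tab n \<gamma>) = (\<Sum>j\<in>{1..n}. \<Sum>k\<le>n. greene_key (word_of n \<gamma>) (- int j) k)"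
  unfolding weight_def tab_def greene_key_P_tab[OF distinct_word_of[OF assms]] ..

text \<open>
All the invariants grow weakly along the left weak order. If they all stayed the same, so would
the tableau.
\<close>

lemma weight_less:
  assumes g: "\<gamma> permutes {1..n}" "\<gamma>' permutes {1..n}" "Invs n \<gamma> \<subseteq> Invs n \<gamma>'" and ne: "tab n \<gamma> \<noteq> tab n \<gamma>'"
  shows "weight n (tab n \<gamma>) < weight n (tab n \<gamma>')"
proof -
  note mono = greene_key_mono[OF g]
  obtain j k where jk: "j \<in> {1..n}" "k \<le> n" "greene_key (word_of n \<gamma>) (- int j) k \<noteq> greene_key (word_of n \<gamma>') (- int j) k"
    using tab_eqI[OF g(1,2)] ne by blast
  have "(\<Sum>k\<le>n. greene_key (word_of n \<gamma>) (- int j) k) < (\<Sum>k\<le>n. greene_key (word_of n \<gamma>') (- int j) k)"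
    using jk(2,3) by (intro sum_strict_mono_ex1) (auto intro!: mono bexI[of _ k] simp: less_le)
  then show ?thesis
    unfolding weight_tab[OF g(1)] weight_tab[OF g(2)]
    using jk(1) by (intro sum_strict_mono_ex1) (auto intro!: sum_mono mono bexI[of _ j] simp del: One_nat_def)
qed

text \<open>
A relation \<open>(i, j)\<close> of \<open>P\<close> with \<open>i < j\<close> forbids an inversion at \<open>i\<close> and \<open>j\<close>, one with \<open>j < i\<close> enforces
it. The first condition passes on to smaller inversion sets, the second one to larger
ones.
\<close>

lemma Sigma_L_between:
  assumes "\<epsilon> \<in> Sigma_L n P" "\<delta>' \<in> Sigma_L n P" "\<delta> permutes {1..n}"
    "Invs n \<epsilon> \<subseteq> Invs n \<delta>" "Invs n \<delta> \<subseteq> Invs n \<delta>'" and P: "P \<subseteq> {1..n} \<times> {1..n}"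
  shows "\<delta> \<in> Sigma_L n P"
proof -
  have "\<delta> i \<le> \<delta> j" if ij: "(i, j) \<in> P" for i j
  proof (rule ccontr)
    assume lt: "\<not> \<delta> i \<le> \<delta> j"
    have in_n: "i \<in> {1..n}" "j \<in> {1..n}" using P ij by auto
    have le: "\<epsilon> i \<le> \<epsilon> j" "\<delta>' i \<le> \<delta>' j" using assms(1,2) ij by (auto simp: Sigma_L_def)
    consider "i < j" | "i = j" | "j < i" by linarith
    then show False
    proof cases
      case 1
      then have "(i, j) \<in> Invs n \<delta>" using lt in_n by (simp add: Invs_def)
      then have "(i, j) \<in> Invs n \<delta>'" using assms(5) by blast
      then show False using le by (simp add: Invs_def)
    next
      case 3
      have "\<epsilon> permutes {1..n}" using assms(1) by (simp add: Sigma_L_def)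
      then have "\<epsilon> i \<noteq> \<epsilon> j" using inj_eq[OF permutes_inj] 3 by fastforce
      then have "(j, i) \<in> Invs n \<epsilon>" using le in_n 3 by (simp add: Invs_def)
      then have "(j, i) \<in> Invs n \<delta>" using assms(4) by blast
      then show False using lt by (simp add: Invs_def)
    qed (use lt in simp)
  qed
  then show ?thesis using assms(3) by (auto simp: Sigma_L_def)
qed

lemma Sigma_L_permutes: "\<gamma> \<in> Sigma_L n P \<Longrightarrow> \<gamma> permutes {1..n}"
  by (simp add: Sigma_L_def)

lemma hconvex_Sigma_L:
  assumes "P \<subseteq> {1..n} \<times> {1..n}" shows "hconvex n (Sigma_L n P)"
  by (rule hconvexI[OF Sigma_L_permutes]) (auto intro: Sigma_L_between[OF _ _ _ _ _ assms])

definition tab_class :: "nat \<Rightarrow> nat rel \<Rightarrow> int list list \<Rightarrow> (nat \<Rightarrow> nat) set" where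
  "tab_class n P T = {\<gamma> \<in> Sigma_L n P. tab n \<gamma> = T}"

text \<open>
The weight grows weakly along an interval of the left weak order and strictly whenever the tableau
changes, so the tableau is constant on an interval whose ends have equal tableaux.
\<close>

lemma hconvex_tab_class:
  assumes "P \<subseteq> {1..n} \<times> {1..n}" shows "hconvex n (tab_class n P T)"
proof (rule hconvexI)
  fix \<epsilon> assume "\<epsilon> \<in> tab_class n P T"
  then show "\<epsilon> permutes {1..n}" by (simp add: tab_class_def Sigma_L_def)
next
  fix \<epsilon> \<delta> \<delta>'
  assume "\<epsilon> \<in> tab_class n P T" "\<delta>' \<in> tab_class n P T" and d: "\<delta> permutes {1..n}"
    and I: "Invs n \<epsilon> \<subseteq> Invs n \<delta>" "Invs n \<delta> \<subseteq> Invs n \<delta>'"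
  then have e: "\<epsilon> \<in> Sigma_L n P" "\<delta>' \<in> Sigma_L n P" "tab n \<epsilon> = T" "tab n \<delta>' = T" by (auto simp: tab_class_def)
  have "tab n \<delta> = T"
  proof (rule ccontr)
    assume ne: "tab n \<delta> \<noteq> T"
    have "weight n (tab n \<epsilon>) < weight n (tab n \<delta>)"
      by (rule weight_less[OF Sigma_L_permutes[OF e(1)] d I(1)]) (use ne e in simp)
    moreover have "weight n (tab n \<delta>) < weight n (tab n \<delta>')"
      by (rule weight_less[OF d Sigma_L_permutes[OF e(2)] I(2)]) (use ne e in simp)
    ultimately show False using e by simp
  qed
  then show "\<delta> \<in> tab_class n P T" using Sigma_L_between[OF e(1,2) d I assms] by (simp add: tab_class_def)
qed

text \<open>
As \<open>\<Sigma>\<^sub>L(P)\<close> is a union of Knuth classes, the class contains every word with this insertion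
tableau, and the Schur expansion over the whole Knuth class applies.
\<close>

lemma sum_tab_class:
  assumes P: "P \<in> RSP n" and \<gamma>: "\<gamma> \<in> Sigma_L n P"
  shows "(\<Sum>\<delta>\<in>tab_class n P (tab n \<gamma>). qs_fund n ({1..<n} - Des_L n \<delta>) m) = schur (map length (tab n \<gamma>)) m"
    (is "?l = _")
proof -
  let ?T = "tab n \<gamma>"
  have \<gamma>p: "\<gamma> permutes {1..n}" using \<gamma> by (rule Sigma_L_permutes)
  have n: "length (concat ?T) = n"
    unfolding tab_def using arg_cong[OF mset_P_tab[of "word_of n \<gamma>"], of size] by (simp only: size_mset length_word_of)
  have bij: "bij_betw (word_of n) (tab_class n P ?T) {w. distinct w \<and> P_tab w = ?T}"
    unfolding bij_betw_def
  proof
    show "inj_on (word_of n) (tab_class n P ?T)"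
      by (rule inj_onI) (auto simp: tab_class_def intro: word_of_inj dest: Sigma_L_permutes)
    show "word_of n ` tab_class n P ?T = {w. distinct w \<and> P_tab w = ?T}"
    proof
      show "word_of n ` tab_class n P ?T \<subseteq> {w. distinct w \<and> P_tab w = ?T}"
        by (auto simp: tab_class_def tab_def dest: Sigma_L_permutes intro: distinct_word_of)
      show "{w. distinct w \<and> P_tab w = ?T} \<subseteq> word_of n ` tab_class n P ?T"
      proof clarify
        fix w assume w: "distinct w" "P_tab w = ?T"
        have "knuth_eq (word_of n \<gamma>) w"
          by (rule P_tab_eq_imp_knuth_eq[OF distinct_word_of[OF \<gamma>p] w(1)]) (use w(2) in \<open>simp add: tab_def\<close>)
        then have "w \<in> word_of n ` Sigma_L n P" using knuth_class_Sigma_L[OF P] \<gamma> by blast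
        then obtain \<delta> where d: "\<delta> \<in> Sigma_L n P" "w = word_of n \<delta>" by auto
        then have "tab n \<delta> = ?T" using w(2) by (simp add: tab_def)
        then have "\<delta> \<in> tab_class n P ?T" using d(1) by (simp add: tab_class_def)
        then show "w \<in> word_of n ` tab_class n P ?T" unfolding d(2) by (rule imageI)
      qed
    qed
  qed
  have "?l = (\<Sum>\<delta>\<in>tab_class n P ?T. qs_fund n {j \<in> {1..<n}. \<not> word_of n \<delta> ! (j - 1) < word_of n \<delta> ! j} m)"
  proof (rule sum.cong[OF refl])
    fix \<delta> assume "\<delta> \<in> tab_class n P ?T"
    then have "\<delta> permutes {1..n}" by (simp add: tab_class_def Sigma_L_def)
    then have "{1..<n} - Des_L n \<delta> = {j \<in> {1..<n}. \<not> word_of n \<delta> ! (j - 1) < word_of n \<delta> ! j}"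
      using Des_L_word_of by blast
    then show "qs_fund n ({1..<n} - Des_L n \<delta>) m = qs_fund n {j \<in> {1..<n}. \<not> word_of n \<delta> ! (j - 1) < word_of n \<delta> ! j} m"
      by (rule arg_cong[where f = "\<lambda>A. qs_fund n A m"])
  qed
  also have "\<dots> = (\<Sum>w | distinct w \<and> P_tab w = ?T. qs_fund n {j \<in> {1..<n}. \<not> w ! (j - 1) < w ! j} m)"
    by (rule sum.reindex_bij_betw[OF bij])
  also have "\<dots> = schur (map length ?T) m"
  proof -
    have "tableau ?T" "distinct (concat ?T)"
      unfolding tab_def using distinct_word_of[OF \<gamma>p] by (simp_all only: tableau_P_tab distinct_P_tab)
    from sum_qs_fund_eq_schur[OF this, of m] show ?thesis unfolding n .
  qed
  finally show ?thesis .
qed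

lemma schur_tab_in:
  assumes "\<gamma> permutes {1..n}"
  shows "schur (map length (tab n \<gamma>)) \<in> schur_functions n"
proof -
  have t: "tableau (tab n \<gamma>)" unfolding tab_def by (rule tableau_P_tab[OF distinct_word_of[OF assms]])
  have "length (concat (tab n \<gamma>)) = n"
    unfolding tab_def using arg_cong[OF mset_P_tab[of "word_of n \<gamma>"], of size] by (simp only: size_mset length_word_of)
  then have "sum_list (map length (tab n \<gamma>)) = n" by (simp add: length_concat)
  moreover have "is_partition (map length (tab n \<gamma>))"
    using tableau_lengths[OF t] tableau_nonempty[OF t] by (auto simp: is_partition_def)
  ultimately show ?thesis unfolding schur_functions_def by blast
qed

section \<open>Submodules and quotients of the poset module\<close>

text \<open>
Collecting the basis elements that are sent to \<open>\<delta>\<close> rewrites the linear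
extension of the action as the truncated ascending action.
\<close>

lemma poset_module_act:
  assumes "i \<in> {1..<n}" "finite (Sigma_L n P)"
  shows "act (poset_module n P) i f = act (conv_module n (Sigma_L n P)) i f"
proof
  fix \<delta>
  have pa: "poset_act n P i \<gamma> \<delta> = (if ascend n i \<gamma> = \<delta> \<and> \<delta> \<in> Sigma_L n P then 1 else 0)" if "\<gamma> \<in> Sigma_L n P" for \<gamma>
    using that by (auto simp: poset_act_def ascend_def basis_vec_def)
  have "act (poset_module n P) i f \<delta> = (\<Sum>\<gamma>\<in>Sigma_L n P. f \<gamma> * poset_act n P i \<gamma> \<delta>)"
    by (simp add: poset_module_def)
  also have "\<dots> = (\<Sum>\<gamma>\<in>Sigma_L n P. if ascend n i \<gamma> = \<delta> \<and> \<delta> \<in> Sigma_L n P then f \<gamma> else 0)"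
    by (rule sum.cong) (simp_all add: pa)
  also have "\<dots> = act (conv_module n (Sigma_L n P)) i f \<delta>"
    by (cases "\<delta> \<in> Sigma_L n P") (simp_all add: sum.inter_filter[OF assms(2)])
  finally show "act (poset_module n P) i f \<delta> = act (conv_module n (Sigma_L n P)) i f \<delta>" .
qed

lemma poset_module_simps:
  "carrier (poset_module n P) = supp_in (Sigma_L n P)" "\<zero>\<^bsub>poset_module n P\<^esub> = (\<lambda>\<gamma>. 0)"
  "f \<oplus>\<^bsub>poset_module n P\<^esub> g = (\<lambda>\<gamma>. f \<gamma> + g \<gamma>)" "c \<odot>\<^bsub>poset_module n P\<^esub> f = (\<lambda>\<gamma>. c * f \<gamma>)"
  by (simp_all add: poset_module_def supp_in_def)

lemma poset_module_iso:
  assumes "finite (Sigma_L n P)"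
  shows "hecke_iso n (conv_module n (Sigma_L n P)) (poset_module n P) id"
  unfolding hecke_iso_def
  by (intro conjI ballI allI) (simp_all add: poset_module_simps poset_module_act[OF _ assms] del: conv_module_simps(5) One_nat_def)

definition up_closed :: "nat \<Rightarrow> (nat \<Rightarrow> nat) set \<Rightarrow> (nat \<Rightarrow> nat) set \<Rightarrow> bool" where
  "up_closed n S U \<longleftrightarrow> U \<subseteq> S \<and> (\<forall>\<gamma>\<in>U. \<forall>i\<in>{1..<n}. ascend n i \<gamma> \<in> S \<longrightarrow> ascend n i \<gamma> \<in> U)"

lemma act_supp_in:
  assumes U: "up_closed n S U" and i: "i \<in> {1..<n}" and f: "f \<in> supp_in U"
  shows "act (conv_module n S) i f \<in> supp_in U"
  unfolding supp_in_def
proof clarify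
  fix \<delta> assume d: "\<delta> \<notin> U"
  have "f \<gamma> = 0" if "\<gamma> \<in> S" "ascend n i \<gamma> = \<delta>" "\<delta> \<in> S" for \<gamma>
  proof -
    have "\<gamma> \<notin> U" using U i d that by (auto simp: up_closed_def)
    then show ?thesis using f by (simp add: supp_in_def)
  qed
  then show "act (conv_module n S) i f \<delta> = 0" by simp
qed

lemma supp_in_submodule:
  assumes hM: "is_hecke_module n (poset_module n P)" and U: "up_closed n (Sigma_L n P) U"
    and fin: "finite (Sigma_L n P)"
  shows "is_hecke_submodule n (poset_module n P) (supp_in U)"
  unfolding is_hecke_submodule_def
proof (intro conjI ballI)
  interpret M: Module.module complex_ring "poset_module n P" using hM by (simp add: is_hecke_module_def)
  show "Module.submodule (supp_in U) complex_ring (poset_module n P)"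
  proof (rule M.submoduleI)
    show sub: "supp_in U \<subseteq> carrier (poset_module n P)"
      using U by (auto simp: poset_module_simps supp_in_def up_closed_def)
    fix f :: "(nat \<Rightarrow> nat) \<Rightarrow> complex" assume f: "f \<in> supp_in U"
    have neg: "(\<lambda>\<gamma>. - f \<gamma>) \<in> supp_in U" using f by (simp add: supp_in_def)
    have "(\<lambda>\<gamma>. - f \<gamma>) \<oplus>\<^bsub>poset_module n P\<^esub> f = \<zero>\<^bsub>poset_module n P\<^esub>" by (simp add: poset_module_simps)
    then have "\<ominus>\<^bsub>poset_module n P\<^esub> f = (\<lambda>\<gamma>. - f \<gamma>)"
      by (rule M.minus_equality) (use sub f neg in blast)+
    then show "\<ominus>\<^bsub>poset_module n P\<^esub> f \<in> supp_in U" using neg by simp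
  qed (simp_all add: poset_module_simps supp_in_def)
  fix i f assume "i \<in> {1..<n}" "f \<in> supp_in U"
  then show "act (poset_module n P) i f \<in> supp_in U"
    using act_supp_in[OF U] by (simp add: poset_module_act[OF _ fin] del: conv_module_simps(5) One_nat_def atLeastLessThan_iff)
qed

text \<open>
The coset of \<open>f\<close> modulo the functions supported on \<open>V\<close>.
\<close>

definition agree_off :: "'a set \<Rightarrow> ('a \<Rightarrow> complex) \<Rightarrow> ('a \<Rightarrow> complex) set" where
  "agree_off V f = {g. \<forall>\<delta>. \<delta> \<notin> V \<longrightarrow> g \<delta> = f \<delta>}"

lemma agree_off_eqI: "(\<And>\<delta>. \<delta> \<notin> V \<Longrightarrow> f \<delta> = g \<delta>) \<Longrightarrow> agree_off V f = agree_off V g"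
  by (simp add: agree_off_def)

lemma agree_off_self: "f \<in> agree_off V f"
  by (simp add: agree_off_def)

text \<open>
Every coset has exactly one representative that vanishes on \<open>V\<close>, and the action on these
representatives is the truncated action on \<open>U - V\<close>: what \<open>V\<close> contributes stays in \<open>V\<close>, and nothing leaves \<open>U\<close>.
\<close>

lemma quotient_iso:
  assumes U: "up_closed n (Sigma_L n P) U" and V: "up_closed n (Sigma_L n P) V" and VU: "V \<subseteq> U"
    and fin: "finite (Sigma_L n P)"
  shows "hecke_iso n (conv_module n (U - V))
    (quotient_module (poset_module n P\<lparr>carrier := supp_in U\<rparr>) (supp_in V)) (agree_off V)"
    (is "hecke_iso n ?C (quotient_module ?M ?N) _")
proof -
  have coset: "?N +>\<^bsub>?M\<^esub> f = agree_off V f" for f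
  proof
    show "?N +>\<^bsub>?M\<^esub> f \<subseteq> agree_off V f"
      by (auto simp: a_r_coset_def' poset_module_def supp_in_def agree_off_def)
    show "agree_off V f \<subseteq> ?N +>\<^bsub>?M\<^esub> f"
    proof
      fix g assume g: "g \<in> agree_off V f"
      then have "(\<lambda>\<delta>. g \<delta> - f \<delta>) \<in> ?N" by (simp add: supp_in_def agree_off_def)
      moreover have "g = (\<lambda>\<delta>. g \<delta> - f \<delta>) \<oplus>\<^bsub>?M\<^esub> f" by (simp add: poset_module_def)
      ultimately show "g \<in> ?N +>\<^bsub>?M\<^esub> f" unfolding a_r_coset_def' by blast
    qed
  qed
  have Qcar: "carrier (quotient_module ?M ?N) = agree_off V ` supp_in U"
    by (auto simp: quotient_module_def A_RCOSETS_def' coset)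
  have onto: "agree_off V ` supp_in (U - V) = agree_off V ` supp_in U"
  proof
    show "agree_off V ` supp_in U \<subseteq> agree_off V ` supp_in (U - V)"
    proof clarify
      fix f :: "(nat \<Rightarrow> nat) \<Rightarrow> complex" assume f: "f \<in> supp_in U"
      let ?f = "\<lambda>\<delta>. if \<delta> \<in> V then 0 else f \<delta>"
      have "agree_off V f = agree_off V ?f" by (rule agree_off_eqI) simp
      moreover have "?f \<in> supp_in (U - V)" using f by (simp add: supp_in_def)
      ultimately show "agree_off V f \<in> agree_off V ` supp_in (U - V)" by (rule image_eqI)
    qed
    show "agree_off V ` supp_in (U - V) \<subseteq> agree_off V ` supp_in U"
      by (rule image_mono) (auto simp: supp_in_def)
  qed
  have inj: "inj_on (agree_off V) (supp_in (U - V))"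
  proof (rule inj_onI)
    fix f g assume fg: "f \<in> supp_in (U - V)" "g \<in> supp_in (U - V)" "agree_off V f = agree_off V g"
    have "f \<in> agree_off V g" using agree_off_self[of f V] fg(3) by simp
    then show "f = g" using fg(1,2) by (fastforce simp: agree_off_def supp_in_def)
  qed
  have union: "(\<Union>y\<in>agree_off V f. agree_off V (F y)) = agree_off V g"
    if "\<And>y. y \<in> agree_off V f \<Longrightarrow> agree_off V (F y) = agree_off V g" for f F g
    using that agree_off_self[of f V] by auto
  have act: "agree_off V (act ?M i y) = agree_off V (act ?C i f)"
    if i: "i \<in> {1..<n}" and f: "f \<in> supp_in (U - V)" and y: "y \<in> agree_off V f" for i f y
  proof (rule agree_off_eqI)
    fix \<delta> assume d: "\<delta> \<notin> V"
    have "act ?M i y \<delta> = act (conv_module n (Sigma_L n P)) i y \<delta>"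
      using poset_module_act[OF i fin, of y] by simp
    also have "\<dots> = act ?C i f \<delta>"
    proof (cases "\<delta> \<in> Sigma_L n P")
      case True
      have eq: "y \<gamma> = f \<gamma>" if "\<gamma> \<in> Sigma_L n P" "ascend n i \<gamma> = \<delta>" for \<gamma>
      proof -
        have "\<gamma> \<notin> V" using V i d that True by (auto simp: up_closed_def)
        then show ?thesis using y by (simp add: agree_off_def)
      qed
      have "(\<Sum>\<gamma> | \<gamma> \<in> Sigma_L n P \<and> ascend n i \<gamma> = \<delta>. y \<gamma>) = (\<Sum>\<gamma> | \<gamma> \<in> Sigma_L n P \<and> ascend n i \<gamma> = \<delta>. f \<gamma>)"
        by (rule sum.cong) (simp_all add: eq)
      also have "\<dots> = (\<Sum>\<gamma> | \<gamma> \<in> U - V \<and> ascend n i \<gamma> = \<delta>. f \<gamma>)"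
        by (rule sum.mono_neutral_right) (use fin U f in \<open>auto simp: up_closed_def supp_in_def\<close>)
      also have "\<dots> = (if \<delta> \<in> U - V then \<Sum>\<gamma> | \<gamma> \<in> U - V \<and> ascend n i \<gamma> = \<delta>. f \<gamma> else 0)"
      proof (cases "\<delta> \<in> U")
        case False
        then have E: "{\<gamma>. \<gamma> \<in> U - V \<and> ascend n i \<gamma> = \<delta>} = {}" using U i True by (auto simp: up_closed_def)
        show ?thesis unfolding E using False by simp
      qed (use d in simp)
      finally show ?thesis using True by simp
    qed (use U in \<open>auto simp: up_closed_def\<close>)
    finally show "act ?M i y \<delta> = act ?C i f \<delta>" .
  qed
  show ?thesis
    unfolding hecke_iso_def
  proof (intro conjI ballI allI)
    show "bij_betw (agree_off V) (carrier ?C) (carrier (quotient_module ?M ?N))"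
      unfolding Qcar bij_betw_def using inj onto by simp
    show "agree_off V \<zero>\<^bsub>?C\<^esub> = \<zero>\<^bsub>quotient_module ?M ?N\<^esub>"
      by (simp add: quotient_module_def agree_off_def supp_in_def)
    fix f assume f: "f \<in> carrier ?C"
    show "agree_off V (c \<odot>\<^bsub>?C\<^esub> f) = c \<odot>\<^bsub>quotient_module ?M ?N\<^esub> agree_off V f" for c
    proof -
      have "(\<Union>y\<in>agree_off V f. agree_off V (c \<odot>\<^bsub>?M\<^esub> y)) = agree_off V (c \<odot>\<^bsub>?C\<^esub> f)"
        by (rule union, rule agree_off_eqI) (simp add: poset_module_def agree_off_def)
      then show ?thesis by (simp add: quotient_module_def coset)
    qed
    show "agree_off V (act ?C i f) = act (quotient_module ?M ?N) i (agree_off V f)" if "i \<in> {1..<n}" for i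
    proof -
      have "(\<Union>y\<in>agree_off V f. agree_off V (act ?M i y)) = agree_off V (act ?C i f)"
        by (rule union, rule act[OF that]) (use f in simp_all)
      then show ?thesis by (simp add: quotient_module_def coset del: conv_module_simps(5))
    qed
    fix g assume g: "g \<in> carrier ?C"
    have "agree_off V (\<lambda>\<delta>. f \<delta> + g \<delta>) = agree_off V f <+>\<^bsub>?M\<^esub> agree_off V g"
    proof
      show "agree_off V (\<lambda>\<delta>. f \<delta> + g \<delta>) \<subseteq> agree_off V f <+>\<^bsub>?M\<^esub> agree_off V g"
      proof
        fix h assume h: "h \<in> agree_off V (\<lambda>\<delta>. f \<delta> + g \<delta>)"
        then have "(\<lambda>\<delta>. h \<delta> - f \<delta>) \<in> agree_off V g" by (simp add: agree_off_def)
        moreover have "h = f \<oplus>\<^bsub>?M\<^esub> (\<lambda>\<delta>. h \<delta> - f \<delta>)" by (simp add: poset_module_def)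
        ultimately show "h \<in> agree_off V f <+>\<^bsub>?M\<^esub> agree_off V g"
          unfolding set_add_def' using agree_off_self[of f V] by blast
      qed
      show "agree_off V f <+>\<^bsub>?M\<^esub> agree_off V g \<subseteq> agree_off V (\<lambda>\<delta>. f \<delta> + g \<delta>)"
        unfolding set_add_def' by (auto simp: poset_module_def agree_off_def)
    qed
    then show "agree_off V (f \<oplus>\<^bsub>?C\<^esub> g) = agree_off V f \<oplus>\<^bsub>quotient_module ?M ?N\<^esub> agree_off V g"
      by (simp add: quotient_module_def)
  qed
qed

theorem theorem6p7:
  fixes n :: nat and P :: "nat rel"
  assumes "P \<in> RSP n"
  shows "\<exists>l Ms. distinguished_filtration n (poset_module n P) (schur_functions n) l Ms"
proof -
  let ?S = "Sigma_L n P"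
  have Psub: "P \<subseteq> {1..n} \<times> {1..n}"
    using assms by (auto simp: RSP_def regular_poset_def partial_order_on_def preorder_on_def refl_on_def)
  have fin: "finite ?S" by (rule finite_hconvex[OF hconvex_Sigma_L[OF Psub]])
  have fd: "is_fd_hecke_module n (poset_module n P)"
    by (rule hecke_iso_fd[OF fd_conv_module[OF hconvex_Sigma_L[OF Psub]] poset_module_iso[OF fin]])
  then have hM: "is_hecke_module n (poset_module n P)" by (simp add: is_fd_hecke_module_def)
  \<comment> \<open>Sorting by \<open>f\<close> lists the tableaux by decreasing weight, so that an ascent leads to an earlier class.\<close>
  define f where "f T = - int (weight n T)" for T
  obtain xs where xs: "set xs = tab n ` ?S" "distinct xs" using finite_distinct_list[OF finite_imageI[OF fin, of "tab n"]] by auto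
  define Ts where "Ts = sort_key f xs"
  have Ts: "set Ts = tab n ` ?S" "distinct Ts" "sorted (map f Ts)" using xs by (simp_all add: Ts_def)
  define U where "U k = {\<gamma> \<in> ?S. tab n \<gamma> \<in> set (take k Ts)}" for k
  have up: "up_closed n ?S (U k)" for k
    unfolding up_closed_def
  proof (intro conjI ballI impI)
    fix \<gamma> i assume g: "\<gamma> \<in> U k" and i: "i \<in> {1..<n}" and u: "ascend n i \<gamma> \<in> ?S"
    show "ascend n i \<gamma> \<in> U k"
    proof (cases "tab n \<gamma> = tab n (ascend n i \<gamma>)")
      case True
      then show ?thesis using g u by (simp add: U_def)
    next
      case False
      have gS: "\<gamma> permutes {1..n}" using g by (auto simp: U_def Sigma_L_def)
      have "weight n (tab n \<gamma>) < weight n (tab n (ascend n i \<gamma>))"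
        by (rule weight_less[OF gS Sigma_L_permutes[OF u] Invs_ascend(1)[OF gS i] False])
      then have less: "f (tab n (ascend n i \<gamma>)) < f (tab n \<gamma>)" by (simp add: f_def)
      obtain a where a: "a < k" "a < length Ts" "Ts ! a = tab n \<gamma>"
        using g by (auto simp: U_def in_set_conv_nth)
      obtain b where b: "b < length Ts" "Ts ! b = tab n (ascend n i \<gamma>)"
        using Ts(1) u by (metis imageI in_set_conv_nth)
      have "b < a"
      proof (rule ccontr)
        assume "\<not> b < a"
        then have "map f Ts ! a \<le> map f Ts ! b" using b(1) by (intro sorted_nth_mono[OF Ts(3)]) auto
        then show False using less a b by simp
      qed
      then have "tab n (ascend n i \<gamma>) \<in> set (take k Ts)" using a b by (auto simp: in_set_conv_nth intro!: exI[of _ b])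
      then show ?thesis using u by (simp add: U_def)
    qed
  qed (simp add: U_def)
  have sub: "is_hecke_submodule n (poset_module n P) (supp_in (U k))" for k
    by (rule supp_in_submodule[OF hM up fin])
  have step: "supp_in (U (k - 1)) \<subset> supp_in (U k) \<and>
      qs_char n (module_class n (quotient_module (poset_module n P\<lparr>carrier := supp_in (U k)\<rparr>) (supp_in (U (k - 1)))))
        \<in> schur_functions n" if k: "k \<in> {1..length Ts}" for k
  proof -
    obtain k' where k': "k = Suc k'" "k' < length Ts" using k by (cases k) auto
    obtain \<gamma> where g: "\<gamma> \<in> ?S" "tab n \<gamma> = Ts ! k'" using Ts(1) k'(2) by (metis imageE nth_mem)
    have take: "set (take k Ts) = insert (tab n \<gamma>) (set (take k' Ts))" "tab n \<gamma> \<notin> set (take k' Ts)"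
      using k' g Ts(2) by (auto simp: take_Suc_conv_app_nth in_set_conv_nth nth_eq_iff_index_eq)
    have diff: "U k - U k' = tab_class n P (tab n \<gamma>)" and le: "U k' \<subseteq> U k"
      using take by (auto simp: U_def tab_class_def)
    have "basis_vec \<gamma> \<in> supp_in (U k) - supp_in (U k')"
      using take g(1) by (auto simp: supp_in_def basis_vec_def U_def)
    moreover have "supp_in (U k') \<subseteq> supp_in (U k)" using le by (auto simp: supp_in_def)
    ultimately have strict: "supp_in (U k') \<subset> supp_in (U k)" by blast
    let ?Q = "quotient_module (poset_module n P\<lparr>carrier := supp_in (U k)\<rparr>) (supp_in (U k'))"
    have iso: "hecke_iso n (conv_module n (tab_class n P (tab n \<gamma>))) ?Q (agree_off (U k'))"
      using quotient_iso[OF up up le fin] unfolding diff .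
    have "qch n ?Q m = schur (map length (tab n \<gamma>)) m" for m
      using qch_conv_module[OF hconvex_tab_class[OF Psub] iso] sum_tab_class[OF assms g(1)] by simp
    then have "qs_char n (module_class n ?Q) = schur (map length (tab n \<gamma>))" by (auto simp: qch_def)
    then show ?thesis using strict schur_tab_in[OF Sigma_L_permutes[OF g(1)]] k'(1) by simp
  qed
  have "supp_in (U 0) = {\<zero>\<^bsub>poset_module n P\<^esub>}" by (auto simp: U_def supp_in_def poset_module_simps)
  moreover have "U (length Ts) = ?S" using Ts(1) by (auto simp: U_def)
  then have "supp_in (U (length Ts)) = carrier (poset_module n P)" by (simp add: poset_module_simps)
  ultimately have "distinguished_filtration n (poset_module n P) (schur_functions n) (length Ts) (\<lambda>k. supp_in (U k))"
    unfolding distinguished_filtration_def using fd sub step by blast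
  then show ?thesis by blast
qed

end
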